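(* Let $(\mathcal{C},\mathcal{M})$ be an AECat with the amalgamation property and let $\mathcal{B}$ be a base class. Suppose that $(\mathcal{C},\mathcal{M})$ satisfies the $\mathcal{B}$-existence axiom and that $\mathop{\perp\!\!\!\perp}$ is an NSOP$_1$-like independence relation over $\mathcal{B}$. Then $\mathop{\perp\!\!\!\perp}=\mathop{\perp\!\!\!\perp}^{\mathrm{lK}}$ over $\mathcal{B}$: for every model $M$ and all subobjects $A,B,C\le M$ with $C\in\mathcal{B}$ we have $A\mathop{\perp\!\!\!\perp}_C^M B$ if and only if $A\mathop{\perp\!\!\!\perp}^{\mathrm{lK},M}_C B$.
   Context: All cardinals are regular. An AECat is a pair $(\mathcal{C},\mathcal{M})$ of accessible categories with $\mathcal{M}$ a full subcategory of $\mathcal{C}$, such that $\mathcal{M}$ has directed colimits and the inclusion $\mathcal{M}\hookrightarrow\mathcal{C}$ preserves them, and every arrow of $\mathcal{C}$ is a monomorphism. Objects of $\mathcal{M}$ are models. It has the amalgamation property (AP) if every span $N_1\leftarrow M\to N_2$ of models completes to a commutative square into a model. An extension of a model $M$ is an arrow $M\to N$ with $N$ a model; given such an extension and $a:A\to M$, we also write $a$ for $A\to M\to N$, and subobjects of $M$ are regarded as subobjects of $N$. The notation $((a_i)_{i\in I};M)$ means $M$ is a model and each $a_i$ is an arrow into $M$. We write $\mathrm{gtp}((a_i)_{i\in I};M)=\mathrm{gtp}((a_i')_{i\in I};M')$ if $\mathrm{dom}(a_i)=\mathrm{dom}(a_i')$ for all $i$ and there are extensions $f:M\to N$, $f':M'\to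 N$ with $fa_i=f'a_i'$ for all $i$. Lascar strong Galois types: write $((a_i)_i/(b_j)_j;M)\sim((a_i')_i/(b_j)_j;M)$ if there are an extension $M\to N$ and $m_0:M_0\to N$ with $M_0$ a model such that each $b_j$ factors through $m_0$ and $\mathrm{gtp}((a_i)_i,m_0;N)=\mathrm{gtp}((a_i')_i,m_0;N)$; the transitive closure is written $\mathrm{Lgtp}((a_i)_i/(b_j)_j;M)=\mathrm{Lgtp}((a_i')_i/(b_j)_j;M)$. A base class is a collection $\mathcal{B}$ of objects of $\mathcal{C}$ containing all models; for a subobject $C$ write $C\in\mathcal{B}$ if its domain is in $\mathcal{B}$. An independence relation is a relation on triples of subobjects of a model $M$, written $A\mathop{\perp\!\!\!\perp}_C^MB$ (arrows may replace the subobjects they represent; $M$ is a subobject of itself). It is over $\mathcal{B}$ ($\mathcal{B}=\mathrm{base}(\mathop{\perp\!\!\!\perp})$) if $A\mathop{\perp\!\!\!\perp}_C^MB$ implies $C\in\mathcal{B}$. Properties: Invariance: $a\mathop{\perp\!\!\!\perp}_c^Mb$ and $\mathrm{gtp}(a,b,c;M)=\mathrm{gtp}(a',b',c';M')$ imply $a'\mathop{\perp\!\!\!\perp}_{c'}^{M'}b'$. Monotonicity: $A\mathop{\perp\!\!\!\perp}_C^MB$, $A'\le A$ imply $A'\mathop{\perp\!\!\!\perp}_C^MB$. Transitivity: $A\mathop{\perp\!\!\!\perp}_B^MC$, $A\mathop{\perp\!\!\!\perp}_C^MD$, $B\le C$ imply $A\mathop{\perp\!\!\!\perp}_B^MD$.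 Symmetry: $A\mathop{\perp\!\!\!\perp}_C^MB$ implies $B\mathop{\perp\!\!\!\perp}_C^MA$. Existence: $A\mathop{\perp\!\!\!\perp}_C^MC$ whenever $C\in\mathrm{base}(\mathop{\perp\!\!\!\perp})$. Extension: if $a\mathop{\perp\!\!\!\perp}_c^Mb$ and $b$ factors through $(b';M)$, there are an extension $M\to N$ and $(a';N)$ with $\mathrm{gtp}(a',b,c;N)=\mathrm{gtp}(a,b,c;M)$ and $a'\mathop{\perp\!\!\!\perp}_c^Nb'$. Union: if $(B_i)_{i\in I}$ is a directed system with a cocone into a model $M$ and $B=\mathrm{colim}_iB_i$ exists, then $A\mathop{\perp\!\!\!\perp}_C^MB_i$ for all $i$ implies $A\mathop{\perp\!\!\!\perp}_C^MB$. Club Local Character: for $\kappa$ let $\mathrm{Sub}^\kappa_{\mathcal{M}}(M)$ be the poset of subobjects of $M$ in $\mathcal{M}$ with $\kappa$-presentable domain; a nonempty $\mathcal{F}\subseteq\mathrm{Sub}^\kappa_{\mathcal{M}}(M)$ is club if every element is below some element of $\mathcal{F}$ and for every chain $(M_i)_{i<\theta}$ in $\mathcal{F}$ with $\theta<\kappa$ the join $\mathrm{colim}_{i<\theta}M_i$ is in $\mathcal{F}$; the property says: for every $\lambda$ there is $\Upsilon(\lambda)$ such that for all $\kappa\ge\Upsilon(\lambda)$, whenever $A,M\le N$ with $A$ $\lambda$-presentable and $M$ a model, there is a club $\mathcal{F}\subseteq\mathrm{Sub}^\kappa_{\mathcal{M}}(M)$ with $A\mathop{\perp\!\!\!\perp}_{M_0}^NM$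 for all $M_0\in\mathcal{F}$. Independence Theorem: if $a\mathop{\perp\!\!\!\perp}_c^Mb$, $a'\mathop{\perp\!\!\!\perp}_c^Mb'$, $b\mathop{\perp\!\!\!\perp}_c^Mb'$ and $\mathrm{Lgtp}(a/c;M)=\mathrm{Lgtp}(a'/c;M)$, then there are an extension $M\to N$ and $(a^*;N)$ with $\mathrm{Lgtp}(a^*,b/c;N)=\mathrm{Lgtp}(a,b/c;N)$, $\mathrm{Lgtp}(a^*,b'/c;N)=\mathrm{Lgtp}(a',b'/c;N)$ and $a^*\mathop{\perp\!\!\!\perp}_c^NM$. An NSOP$_1$-like independence relation satisfies Invariance, Monotonicity, Transitivity, Symmetry, Existence, Extension, Union, Club Local Character and Independence Theorem. Sequences: a chain of initial segments for a sequence $((a_i)_{i<\lambda};N)$ (all $a_i$ with same domain) is a continuous chain of models $(M_i)_{i<\lambda}$ ($M_\ell=\mathrm{colim}_{i<\ell}M_i$ at limits) with a cocone $m_i:M_i\to N$ such that each $a_i$ factors through $m_{i+1}$; $c$ embeds in it if $c$ factors through $m_0$. It is an isi-sequence over $c$ if moreover $c$ embeds and $\mathrm{gtp}(a_i,m_i;N)=\mathrm{gtp}(a_j,m_i;N)$ for $i\le j$. For an independence relation $\mathop{\perp\!\!\!\perp}'$, the sequence is $\mathop{\perp\!\!\!\perp}'_c$-independent if it has a chain of initial segments in which $c$ embeds with $a_i\mathop{\perp\!\!\!\perp}'^{N}_c m_i$ for all $i$. Dividing: for $(a,b,c;M)$ and a sequence $(b_i)_{i\in I}$ in an extension $N$ of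 $M$ with $\mathrm{gtp}(b_i,c;N)=\mathrm{gtp}(b,c;M)$, $\mathrm{gtp}(a,b,c;M)$ is consistent for $(b_i)_{i\in I}$ if there are an extension $N\to N'$ and $(a';N')$ with $\mathrm{gtp}(a',b_i,c;N')=\mathrm{gtp}(a,b,c;M)$ for all $i\in I$. $\mathrm{gtp}(a,b,c;M)$ isi-divides over $c$ if there is $\mu$ such that for every $\lambda\ge\mu$ there is an isi-sequence $(b_i)_{i<\lambda}$ over $c$ in some extension $N$ of $M$ with $\mathrm{gtp}(b_i,c;N)=\mathrm{gtp}(b,c;M)$ and some $\kappa<\lambda$ such that for every $I\subseteq\lambda$ with $|I|=\kappa$, $\mathrm{gtp}(a,b,c;M)$ is not consistent for $(b_i)_{i\in I}$. $\mathrm{gtp}(a,b,c;M)$ isi-forks over $c$ if there are an extension $M\to N$ and $((a_j)_{j\in J},(d_j)_{j\in J};N)$ with $\mathrm{dom}(a_j)=\mathrm{dom}(a)$ such that each $\mathrm{gtp}(a_j,d_j,c;N)$ isi-divides over $c$, and for every extension $N\to N'$ and $(a';N')$ with $\mathrm{gtp}(a',b,c;N')=\mathrm{gtp}(a,b,c;N)$ there is $j$ with $\mathrm{gtp}(a',d_j,c;N')=\mathrm{gtp}(a_j,d_j,c;N)$. $A\mathop{\perp\!\!\!\perp}^{\mathrm{isi\text{-}f},M}_CB$ means $\mathrm{gtp}(a,b,c;M)$ does not isi-fork over $c$ for representatives $a,b,c$ (independent of the choice). $\mathrm{gtp}(a,b,c;M)$ long Kim-divides over $c$ if the definition of isi-dividing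 holds with "isi-sequence over $c$" replaced by "$\mathop{\perp\!\!\!\perp}^{\mathrm{isi\text{-}f}}_c$-independent sequence"; $A\mathop{\perp\!\!\!\perp}^{\mathrm{lK},M}_CB$ means it does not long Kim-divide over $c$. $(\mathcal{C},\mathcal{M})$ satisfies the $\mathcal{B}$-existence axiom if $A\mathop{\perp\!\!\!\perp}^{\mathrm{isi\text{-}f},M}_CC$ for all $A,C\le M$ with $C\in\mathcal{B}$. *)

theory Defs
  imports Main
begin

unbundle cardinal_syntax

section \<open>Cardinals and smallness\<close>

text \<open>
  The set/class distinction is rendered by a strongly inaccessible cardinal \<open>U\<close> (a Grothendieck
  universe): \<^emph>\<open>small\<close> means of cardinality below \<open>U\<close>.  Cardinals are well-order
  relations as in the HOL library; every small cardinal is order-isomorphic to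
  some \<open>\<kappa> :: 'u rel\<close> with \<open>\<kappa> <o U\<close>, and every small poset to one whose carrier lies in \<open>'u\<close>.
\<close>

definition inaccessible :: "'u rel \<Rightarrow> bool" where
  "inaccessible U \<longleftrightarrow>
     Card_order U \<and> natLeq <o U \<and> regularCard U \<and>
     (\<forall>X :: 'u set. |X| <o U \<longrightarrow> |Pow X| <o U)"

definition small :: "'u rel \<Rightarrow> 'b set \<Rightarrow> bool" where
  "small U X \<longleftrightarrow> |X| <o U"

definition regular_cardinal :: "'u rel \<Rightarrow> 'u rel \<Rightarrow> bool" where
  "regular_cardinal U \<kappa> \<longleftrightarrow> Cinfinite \<kappa> \<and> regularCard \<kappa> \<and> \<kappa> <o U"

text \<open>A cardinal \<open>\<kappa>\<close> doubles as the index set \<open>Field \<kappa>\<close> of sequences of length \<open>\<kappa>\<close>.\<close>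

definition ozero :: "'u rel \<Rightarrow> 'u" where
  "ozero r = wo_rel.minim r (Field r)"

definition osuc :: "'u rel \<Rightarrow> 'u \<Rightarrow> 'u" where
  "osuc r i = wo_rel.suc r {i}"

definition olimit :: "'u rel \<Rightarrow> 'u \<Rightarrow> bool" where
  "olimit r l \<longleftrightarrow> l \<in> Field r \<and> l \<noteq> ozero r \<and> (\<forall>i \<in> underS r l. osuc r i \<noteq> l)"

section \<open>Categories\<close>

record ('o, 'a) category =
  Obj :: "'o set"
  Arr :: "'a set"
  Dom :: "'a \<Rightarrow> 'o"
  Cod :: "'a \<Rightarrow> 'o"
  Ident :: "'o \<Rightarrow> 'a"
  Comp :: "'a \<Rightarrow> 'a \<Rightarrow> 'a"  (infixr "\<cdot>\<index>" 75)

definition hom :: "('o, 'a, 'm) category_scheme \<Rightarrow> 'o \<Rightarrow> 'o \<Rightarrow> 'a set" where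
  "hom C X Y = {f \<in> Arr C. Dom C f = X \<and> Cod C f = Y}"

locale category =
  fixes C :: "('o, 'a, 'm) category_scheme" (structure)
  assumes Dom_Obj: "f \<in> Arr C \<Longrightarrow> Dom C f \<in> Obj C"
    and Cod_Obj: "f \<in> Arr C \<Longrightarrow> Cod C f \<in> Obj C"
    and Ident_hom: "X \<in> Obj C \<Longrightarrow> Ident C X \<in> hom C X X"
    and Comp_hom: "f \<in> hom C X Y \<Longrightarrow> g \<in> hom C Y Z \<Longrightarrow> g \<cdot> f \<in> hom C X Z"
    and Comp_Ident: "f \<in> hom C X Y \<Longrightarrow> f \<cdot> Ident C X = f"
    and Ident_Comp: "f \<in> hom C X Y \<Longrightarrow> Ident C Y \<cdot> f = f"
    and Comp_assoc: "f \<in> hom C W X \<Longrightarrow> g \<in> hom C X Y \<Longrightarrow> h \<in> hom C Y Z \<Longrightarrow>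
      (h \<cdot> g) \<cdot> f = h \<cdot> (g \<cdot> f)"

definition mono_arrow :: "('o, 'a, 'm) category_scheme \<Rightarrow> 'a \<Rightarrow> bool" where
  "mono_arrow C f \<longleftrightarrow> f \<in> Arr C \<and>
     (\<forall>X. \<forall>g \<in> hom C X (Dom C f). \<forall>h \<in> hom C X (Dom C f). f \<cdot>\<^bsub>C\<^esub> g = f \<cdot>\<^bsub>C\<^esub> h \<longrightarrow> g = h)"

text \<open>Diagrams are indexed by posets, given as partial order relations \<open>r\<close> with carrier \<open>Field r\<close>.\<close>

definition diagram ::
  "('o, 'a, 'm) category_scheme \<Rightarrow> 'u rel \<Rightarrow> ('u \<Rightarrow> 'o) \<Rightarrow> ('u \<Rightarrow> 'u \<Rightarrow> 'a) \<Rightarrow> bool" where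
  "diagram C r D t \<longleftrightarrow>
     Partial_order r \<and>
     (\<forall>i \<in> Field r. D i \<in> Obj C \<and> t i i = Ident C (D i)) \<and>
     (\<forall>i j. (i, j) \<in> r \<longrightarrow> t i j \<in> hom C (D i) (D j)) \<and>
     (\<forall>i j k. (i, j) \<in> r \<longrightarrow> (j, k) \<in> r \<longrightarrow> t j k \<cdot>\<^bsub>C\<^esub> t i j = t i k)"

definition cocone ::
  "('o, 'a, 'm) category_scheme \<Rightarrow> 'u rel \<Rightarrow> ('u \<Rightarrow> 'o) \<Rightarrow> ('u \<Rightarrow> 'u \<Rightarrow> 'a) \<Rightarrow> 'o \<Rightarrow> ('u \<Rightarrow> 'a) \<Rightarrow> bool" where
  "cocone C r D t X k \<longleftrightarrow>
     X \<in> Obj C \<and> (\<forall>i \<in> Field r. k i \<in> hom C (D i) X) \<and>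
     (\<forall>i j. (i, j) \<in> r \<longrightarrow> k j \<cdot>\<^bsub>C\<^esub> t i j = k i)"

definition colimit ::
  "('o, 'a, 'm) category_scheme \<Rightarrow> 'u rel \<Rightarrow> ('u \<Rightarrow> 'o) \<Rightarrow> ('u \<Rightarrow> 'u \<Rightarrow> 'a) \<Rightarrow> 'o \<Rightarrow> ('u \<Rightarrow> 'a) \<Rightarrow> bool" where
  "colimit C r D t X k \<longleftrightarrow>
     diagram C r D t \<and> cocone C r D t X k \<and>
     (\<forall>Y h. cocone C r D t Y h \<longrightarrow> (\<exists>!u. u \<in> hom C X Y \<and> (\<forall>i \<in> Field r. u \<cdot>\<^bsub>C\<^esub> k i = h i)))"

text \<open>Taking \<open>S = {}\<close> shows that a \<open>\<nu>\<close>-directed poset is nonempty.\<close>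

definition directed :: "'u rel \<Rightarrow> 'k rel \<Rightarrow> 'u rel \<Rightarrow> bool" where
  "directed U \<nu> r \<longleftrightarrow>
     Partial_order r \<and> small U (Field r) \<and>
     (\<forall>S \<subseteq> Field r. |S| <o \<nu> \<longrightarrow> (\<exists>u \<in> Field r. \<forall>s \<in> S. (s, u) \<in> r))"

definition has_directed_colimits :: "'u rel \<Rightarrow> 'k rel \<Rightarrow> ('o, 'a, 'm) category_scheme \<Rightarrow> bool" where
  "has_directed_colimits U \<nu> C \<longleftrightarrow>
     (\<forall>r D t. directed U \<nu> r \<longrightarrow> diagram C r D t \<longrightarrow> (\<exists>X k. colimit C r D t X k))"

text \<open>
  \<open>Hom(X, -)\<close> preserves \<open>\<nu>\<close>-directed colimits: every arrow from \<open>X\<close> into such a colimit factors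
  essentially uniquely through a stage of the diagram.
\<close>

definition presentable :: "'u rel \<Rightarrow> 'k rel \<Rightarrow> ('o, 'a, 'm) category_scheme \<Rightarrow> 'o \<Rightarrow> bool" where
  "presentable U \<nu> C X \<longleftrightarrow>
     X \<in> Obj C \<and>
     (\<forall>r D t Y k. directed U \<nu> r \<longrightarrow> colimit C r D t Y k \<longrightarrow>
        (\<forall>f \<in> hom C X Y. \<exists>i \<in> Field r. \<exists>g \<in> hom C X (D i). k i \<cdot>\<^bsub>C\<^esub> g = f) \<and>
        (\<forall>i \<in> Field r. \<forall>g \<in> hom C X (D i). \<forall>h \<in> hom C X (D i).
           k i \<cdot>\<^bsub>C\<^esub> g = k i \<cdot>\<^bsub>C\<^esub> h \<longrightarrow> (\<exists>j. (i, j) \<in> r \<and> t i j \<cdot>\<^bsub>C\<^esub> g = t i j \<cdot>\<^bsub>C\<^esub> h)))"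

definition accessible :: "'u rel \<Rightarrow> ('o, 'a, 'm) category_scheme \<Rightarrow> bool" where
  "accessible U C \<longleftrightarrow>
     category C \<and>
     (\<forall>X \<in> Obj C. \<forall>Y \<in> Obj C. small U (hom C X Y)) \<and>
     (\<exists>\<nu>. regular_cardinal U \<nu> \<and> has_directed_colimits U \<nu> C \<and>
        (\<exists>P. small U P \<and> (\<forall>X \<in> P. presentable U \<nu> C X) \<and>
           (\<forall>Y \<in> Obj C. \<exists>r D t k. directed U \<nu> r \<and> (\<forall>i \<in> Field r. D i \<in> P) \<and> colimit C r D t Y k)))"

section \<open>AECats\<close>

text \<open>The category \<open>\<C>\<close> together with the objects of \<open>\<M>\<close> and the universe cardinal.\<close>

record ('o, 'a, 'u) aecat = "('o, 'a) category" +
  Mod :: "'o set"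
  Univ :: "'u rel"

definition models :: "('o, 'a, 'u) aecat \<Rightarrow> ('o, 'a) category" where
  "models K = \<lparr> Obj = Mod K, Arr = {f \<in> Arr K. Dom K f \<in> Mod K \<and> Cod K f \<in> Mod K},
                Dom = Dom K, Cod = Cod K, Ident = Ident K, Comp = Comp K \<rparr>"

locale AECat =
  fixes K :: "('o, 'a, 'u) aecat" (structure)
  assumes accessible_C: "accessible (Univ K) K"
    and accessible_M: "accessible (Univ K) (models K)"
    and Mod_subset: "Mod K \<subseteq> Obj K"
    and M_directed_colimits: "has_directed_colimits (Univ K) natLeq (models K)"
    and M_preserves: "directed (Univ K) natLeq r \<Longrightarrow> colimit (models K) r D t X k \<Longrightarrow> colimit K r D t X k"
    and all_mono: "f \<in> Arr K \<Longrightarrow> mono_arrow K f"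

definition extension :: "('o, 'a, 'u) aecat \<Rightarrow> 'o \<Rightarrow> 'a \<Rightarrow> 'o \<Rightarrow> bool" where
  "extension K M f N \<longleftrightarrow> M \<in> Mod K \<and> N \<in> Mod K \<and> f \<in> hom K M N"

definition amalgamation_property :: "('o, 'a, 'u) aecat \<Rightarrow> bool" where
  "amalgamation_property K \<longleftrightarrow>
     (\<forall>M N1 N2 f1 f2. extension K M f1 N1 \<longrightarrow> extension K M f2 N2 \<longrightarrow>
        (\<exists>N g1 g2. extension K N1 g1 N \<and> extension K N2 g2 N \<and> g1 \<cdot>\<^bsub>K\<^esub> f1 = g2 \<cdot>\<^bsub>K\<^esub> f2))"

text \<open>
  Subobjects are handled through representing arrows: \<open>into K a M\<close> says that \<open>a\<close> represents a
  subobject of the model \<open>M\<close>, and \<open>sub_le K a b\<close> that \<open>a\<close> factors through \<open>b\<close>.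
\<close>

definition into :: "('o, 'a, 'u) aecat \<Rightarrow> 'a \<Rightarrow> 'o \<Rightarrow> bool" where
  "into K a M \<longleftrightarrow> M \<in> Mod K \<and> a \<in> Arr K \<and> Cod K a = M"

definition sub_le :: "('o, 'a, 'm) category_scheme \<Rightarrow> 'a \<Rightarrow> 'a \<Rightarrow> bool" where
  "sub_le C a b \<longleftrightarrow> (\<exists>u \<in> hom C (Dom C a) (Dom C b). b \<cdot>\<^bsub>C\<^esub> u = a)"

definition sub_eq :: "('o, 'a, 'm) category_scheme \<Rightarrow> 'a \<Rightarrow> 'a \<Rightarrow> bool" where
  "sub_eq C a b \<longleftrightarrow> sub_le C a b \<and> sub_le C b a"

section \<open>Galois types\<close>

text \<open>
  \<open>gtp_eq K as M as' M'\<close> is \<open>gtp(as; M) = gtp(as'; M')\<close>.  Only types of finite tuples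
  are ever needed, so tuples are lists.
\<close>

definition gtp_eq :: "('o, 'a, 'u) aecat \<Rightarrow> 'a list \<Rightarrow> 'o \<Rightarrow> 'a list \<Rightarrow> 'o \<Rightarrow> bool" where
  "gtp_eq K as M as' M' \<longleftrightarrow>
     (\<forall>a \<in> set as. into K a M) \<and> (\<forall>a \<in> set as'. into K a M') \<and>
     map (Dom K) as = map (Dom K) as' \<and>
     (\<exists>N f f'. extension K M f N \<and> extension K M' f' N \<and>
        map (\<lambda>a. f \<cdot>\<^bsub>K\<^esub> a) as = map (\<lambda>a. f' \<cdot>\<^bsub>K\<^esub> a) as')"

text \<open>\<open>Lgtp_eq K bs M as as'\<close> is \<open>Lgtp(as / bs; M) = Lgtp(as' / bs; M)\<close>.\<close>

definition Lstep :: "('o, 'a, 'u) aecat \<Rightarrow> 'a list \<Rightarrow> 'o \<Rightarrow> 'a list \<Rightarrow> 'a list \<Rightarrow> bool" where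
  "Lstep K bs M as as' \<longleftrightarrow>
     (\<forall>x \<in> set as \<union> set as' \<union> set bs. into K x M) \<and>
     (\<exists>N f M0 m0. extension K M f N \<and> extension K M0 m0 N \<and>
        (\<forall>b \<in> set bs. sub_le K (f \<cdot>\<^bsub>K\<^esub> b) m0) \<and>
        gtp_eq K (map (\<lambda>a. f \<cdot>\<^bsub>K\<^esub> a) as @ [m0]) N (map (\<lambda>a. f \<cdot>\<^bsub>K\<^esub> a) as' @ [m0]) N)"

definition Lgtp_eq :: "('o, 'a, 'u) aecat \<Rightarrow> 'a list \<Rightarrow> 'o \<Rightarrow> 'a list \<Rightarrow> 'a list \<Rightarrow> bool" where
  "Lgtp_eq K bs M = (Lstep K bs M)\<^sup>+\<^sup>+"

section \<open>Independence relations\<close>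

text \<open>\<open>ind M a c b\<close> stands for ``\<open>a\<close> is independent from \<open>b\<close> over \<open>c\<close> in \<open>M\<close>''.\<close>

type_synonym ('o, 'a) indep = "'o \<Rightarrow> 'a \<Rightarrow> 'a \<Rightarrow> 'a \<Rightarrow> bool"

text \<open>The second conjunct makes \<open>ind\<close> a relation on subobjects rather than on arrows.\<close>

definition independence_relation :: "('o, 'a, 'u) aecat \<Rightarrow> ('o, 'a) indep \<Rightarrow> bool" where
  "independence_relation K ind \<longleftrightarrow>
     (\<forall>M a c b. ind M a c b \<longrightarrow> into K a M \<and> into K c M \<and> into K b M) \<and>
     (\<forall>M a c b a' c' b'. ind M a c b \<longrightarrow> into K a' M \<longrightarrow> into K c' M \<longrightarrow> into K b' M \<longrightarrow>
        sub_eq K a a' \<longrightarrow> sub_eq K c c' \<longrightarrow> sub_eq K b b' \<longrightarrow> ind M a' c' b')"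

definition base_class :: "('o, 'a, 'u) aecat \<Rightarrow> 'o set \<Rightarrow> bool" where
  "base_class K B \<longleftrightarrow> Mod K \<subseteq> B \<and> B \<subseteq> Obj K"

text \<open>
  The subobject represented by \<open>c\<close> lies in \<open>B\<close>: the domain of a subobject is only determined up
  to isomorphism, so some representative has its domain in \<open>B\<close>.  For isomorphism-closed \<open>B\<close>
  this is just \<open>Dom K c \<in> B\<close>.
\<close>

definition sub_in :: "('o, 'a, 'u) aecat \<Rightarrow> 'a \<Rightarrow> 'o set \<Rightarrow> bool" where
  "sub_in K c B \<longleftrightarrow> (\<exists>c'. sub_eq K c c' \<and> Dom K c' \<in> B)"

definition over_base :: "('o, 'a, 'u) aecat \<Rightarrow> 'o set \<Rightarrow> ('o, 'a) indep \<Rightarrow> bool" where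
  "over_base K B ind \<longleftrightarrow> (\<forall>M a c b. ind M a c b \<longrightarrow> sub_in K c B)"

definition Invariance :: "('o, 'a, 'u) aecat \<Rightarrow> ('o, 'a) indep \<Rightarrow> bool" where
  "Invariance K ind \<longleftrightarrow>
     (\<forall>M a c b M' a' c' b'. ind M a c b \<longrightarrow> gtp_eq K [a, b, c] M [a', b', c'] M' \<longrightarrow> ind M' a' c' b')"

definition Monotonicity :: "('o, 'a, 'u) aecat \<Rightarrow> ('o, 'a) indep \<Rightarrow> bool" where
  "Monotonicity K ind \<longleftrightarrow>
     (\<forall>M a c b a'. ind M a c b \<longrightarrow> into K a' M \<longrightarrow> sub_le K a' a \<longrightarrow> ind M a' c b)"

definition Transitivity :: "('o, 'a, 'u) aecat \<Rightarrow> ('o, 'a) indep \<Rightarrow> bool" where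
  "Transitivity K ind \<longleftrightarrow>
     (\<forall>M a b c d. ind M a b c \<longrightarrow> ind M a c d \<longrightarrow> sub_le K b c \<longrightarrow> ind M a b d)"

definition Symmetry :: "('o, 'a, 'u) aecat \<Rightarrow> ('o, 'a) indep \<Rightarrow> bool" where
  "Symmetry K ind \<longleftrightarrow> (\<forall>M a c b. ind M a c b \<longrightarrow> ind M b c a)"

definition Existence :: "('o, 'a, 'u) aecat \<Rightarrow> 'o set \<Rightarrow> ('o, 'a) indep \<Rightarrow> bool" where
  "Existence K B ind \<longleftrightarrow>
     (\<forall>M a c. into K a M \<longrightarrow> into K c M \<longrightarrow> sub_in K c B \<longrightarrow> ind M a c c)"

definition Extension :: "('o, 'a, 'u) aecat \<Rightarrow> ('o, 'a) indep \<Rightarrow> bool" where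
  "Extension K ind \<longleftrightarrow>
     (\<forall>M a c b b'. ind M a c b \<longrightarrow> into K b' M \<longrightarrow> sub_le K b b' \<longrightarrow>
        (\<exists>N f a'. extension K M f N \<and> into K a' N \<and>
           gtp_eq K [a', f \<cdot>\<^bsub>K\<^esub> b, f \<cdot>\<^bsub>K\<^esub> c] N [a, b, c] M \<and>
           ind N a' (f \<cdot>\<^bsub>K\<^esub> c) (f \<cdot>\<^bsub>K\<^esub> b')))"

text \<open>The arrow \<open>b\<close> is the one that the cocone \<open>bs\<close> induces from the colimit \<open>X\<close> to \<open>M\<close>.\<close>

definition Union_property :: "('o, 'a, 'u) aecat \<Rightarrow> ('o, 'a) indep \<Rightarrow> bool" where
  "Union_property K ind \<longleftrightarrow>
     (\<forall>r D t M bs X k a c b.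
        directed (Univ K) natLeq r \<longrightarrow> M \<in> Mod K \<longrightarrow> cocone K r D t M bs \<longrightarrow> colimit K r D t X k \<longrightarrow>
        b \<in> hom K X M \<longrightarrow> (\<forall>i \<in> Field r. b \<cdot>\<^bsub>K\<^esub> k i = bs i) \<longrightarrow>
        (\<forall>i \<in> Field r. ind M a c (bs i)) \<longrightarrow> ind M a c b)"

text \<open>\<open>\<kappa>\<close>-presentability of the domain is understood in the category of models.\<close>

definition Sub_models :: "('o, 'a, 'u) aecat \<Rightarrow> 'u rel \<Rightarrow> 'o \<Rightarrow> 'a set" where
  "Sub_models K \<kappa> M = {m. \<exists>M0. extension K M0 m M \<and> presentable (Univ K) \<kappa> (models K) M0}"

text \<open>
  A set of subobjects is a set of arrows closed under \<open>sub_eq\<close>.  In the last clause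
  \<open>x\<close> is a chain of length \<open>\<theta>\<close> in \<open>F\<close>, with (unique) transition arrows \<open>t\<close>, and \<open>z\<close> is the arrow
  into \<open>M\<close> induced from its colimit \<open>Z\<close>, that is, the join of the chain.
\<close>

definition club :: "('o, 'a, 'u) aecat \<Rightarrow> 'u rel \<Rightarrow> 'o \<Rightarrow> 'a set \<Rightarrow> bool" where
  "club K \<kappa> M F \<longleftrightarrow>
     F \<noteq> {} \<and> F \<subseteq> Sub_models K \<kappa> M \<and>
     (\<forall>m \<in> F. \<forall>m' \<in> Sub_models K \<kappa> M. sub_eq K m m' \<longrightarrow> m' \<in> F) \<and>
     (\<forall>m \<in> Sub_models K \<kappa> M. \<exists>m' \<in> F. sub_le K m m') \<and>
     (\<forall>\<theta> x t Z k z. regular_cardinal (Univ K) \<theta> \<longrightarrow> \<theta> <o \<kappa> \<longrightarrow>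
        (\<forall>i \<in> Field \<theta>. x i \<in> F) \<longrightarrow>
        (\<forall>i j. (i, j) \<in> \<theta> \<longrightarrow> t i j \<in> hom K (Dom K (x i)) (Dom K (x j)) \<and> x j \<cdot>\<^bsub>K\<^esub> t i j = x i) \<longrightarrow>
        colimit (models K) \<theta> (\<lambda>i. Dom K (x i)) t Z k \<longrightarrow>
        z \<in> hom K Z M \<longrightarrow> (\<forall>i \<in> Field \<theta>. z \<cdot>\<^bsub>K\<^esub> k i = x i) \<longrightarrow> z \<in> F)"

definition Club_Local_Character :: "('o, 'a, 'u) aecat \<Rightarrow> ('o, 'a) indep \<Rightarrow> bool" where
  "Club_Local_Character K ind \<longleftrightarrow>
     (\<forall>\<nu>. regular_cardinal (Univ K) \<nu> \<longrightarrow>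
        (\<exists>\<upsilon>. regular_cardinal (Univ K) \<upsilon> \<and>
           (\<forall>\<kappa>. regular_cardinal (Univ K) \<kappa> \<longrightarrow> \<upsilon> \<le>o \<kappa> \<longrightarrow>
              (\<forall>N a M m. into K a N \<longrightarrow> presentable (Univ K) \<nu> K (Dom K a) \<longrightarrow> extension K M m N \<longrightarrow>
                 (\<exists>F. club K \<kappa> M F \<and> (\<forall>m0 \<in> F. ind N a (m \<cdot>\<^bsub>K\<^esub> m0) m))))))"

text \<open>The model \<open>M\<close>, as a subobject of its extension \<open>N\<close>, is represented by \<open>f\<close>.\<close>

definition Independence_Theorem :: "('o, 'a, 'u) aecat \<Rightarrow> ('o, 'a) indep \<Rightarrow> bool" where
  "Independence_Theorem K ind \<longleftrightarrow>
     (\<forall>M a a' b b' c.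
        ind M a c b \<longrightarrow> ind M a' c b' \<longrightarrow> ind M b c b' \<longrightarrow> Lgtp_eq K [c] M [a] [a'] \<longrightarrow>
        (\<exists>N f s. extension K M f N \<and> into K s N \<and>
           Lgtp_eq K [f \<cdot>\<^bsub>K\<^esub> c] N [s, f \<cdot>\<^bsub>K\<^esub> b] [f \<cdot>\<^bsub>K\<^esub> a, f \<cdot>\<^bsub>K\<^esub> b] \<and>
           Lgtp_eq K [f \<cdot>\<^bsub>K\<^esub> c] N [s, f \<cdot>\<^bsub>K\<^esub> b'] [f \<cdot>\<^bsub>K\<^esub> a', f \<cdot>\<^bsub>K\<^esub> b'] \<and>
           ind N s (f \<cdot>\<^bsub>K\<^esub> c) f))"

definition NSOP1_like :: "('o, 'a, 'u) aecat \<Rightarrow> 'o set \<Rightarrow> ('o, 'a) indep \<Rightarrow> bool" where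
  "NSOP1_like K B ind \<longleftrightarrow>
     independence_relation K ind \<and> over_base K B ind \<and>
     Invariance K ind \<and> Monotonicity K ind \<and> Transitivity K ind \<and> Symmetry K ind \<and>
     Existence K B ind \<and> Extension K ind \<and> Union_property K ind \<and>
     Club_Local_Character K ind \<and> Independence_Theorem K ind"

section \<open>Sequences\<close>

definition initial_segments ::
  "('o, 'a, 'u) aecat \<Rightarrow> 'u rel \<Rightarrow> 'o \<Rightarrow> ('u \<Rightarrow> 'a) \<Rightarrow> ('u \<Rightarrow> 'o) \<Rightarrow> ('u \<Rightarrow> 'u \<Rightarrow> 'a) \<Rightarrow> ('u \<Rightarrow> 'a) \<Rightarrow> bool" where
  "initial_segments K \<nu> N a D t m \<longleftrightarrow>
     (\<forall>i \<in> Field \<nu>. into K (a i) N) \<and>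
     (\<forall>i \<in> Field \<nu>. \<forall>j \<in> Field \<nu>. Dom K (a i) = Dom K (a j)) \<and>
     diagram (models K) \<nu> D t \<and>
     (\<forall>l. olimit \<nu> l \<longrightarrow> colimit (models K) (Restr \<nu> (underS \<nu> l)) D t (D l) (\<lambda>i. t i l)) \<and>
     cocone (models K) \<nu> D t N m \<and>
     (\<forall>i \<in> Field \<nu>. sub_le K (a i) (m (osuc \<nu> i)))"

definition isi_sequence ::
  "('o, 'a, 'u) aecat \<Rightarrow> 'u rel \<Rightarrow> 'a \<Rightarrow> 'o \<Rightarrow> ('u \<Rightarrow> 'a) \<Rightarrow> bool" where
  "isi_sequence K \<nu> c N a \<longleftrightarrow>
     (\<exists>D t m. initial_segments K \<nu> N a D t m \<and> sub_le K c (m (ozero \<nu>)) \<and>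
        (\<forall>i j. (i, j) \<in> \<nu> \<longrightarrow> gtp_eq K [a i, m i] N [a j, m i] N))"

definition independent_sequence ::
  "('o, 'a, 'u) aecat \<Rightarrow> ('o, 'a) indep \<Rightarrow> 'u rel \<Rightarrow> 'a \<Rightarrow> 'o \<Rightarrow> ('u \<Rightarrow> 'a) \<Rightarrow> bool" where
  "independent_sequence K ind \<nu> c N a \<longleftrightarrow>
     (\<exists>D t m. initial_segments K \<nu> N a D t m \<and> sub_le K c (m (ozero \<nu>)) \<and>
        (\<forall>i \<in> Field \<nu>. ind N (a i) c (m i)))"

section \<open>Dividing and forking\<close>

text \<open>
  \<open>consistent_for K a b c M f N bs I\<close>: \<open>gtp(a, b, c; M)\<close> is consistent for \<open>(bs i)\<close>,
  \<open>i \<in> I\<close>, a sequence in the extension \<open>f : M \<rightarrow> N\<close>.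
\<close>

definition consistent_for ::
  "('o, 'a, 'u) aecat \<Rightarrow> 'a \<Rightarrow> 'a \<Rightarrow> 'a \<Rightarrow> 'o \<Rightarrow> 'a \<Rightarrow> 'o \<Rightarrow> ('u \<Rightarrow> 'a) \<Rightarrow> 'u set \<Rightarrow> bool" where
  "consistent_for K a b c M f N bs I \<longleftrightarrow>
     (\<exists>N' g a'. extension K N g N' \<and> into K a' N' \<and>
        (\<forall>i \<in> I. gtp_eq K [a', g \<cdot>\<^bsub>K\<^esub> bs i, g \<cdot>\<^bsub>K\<^esub> (f \<cdot>\<^bsub>K\<^esub> c)] N' [a, b, c] M))"

text \<open>Dividing witnessed by the sequences in \<open>Seq\<close>, where \<open>Seq \<nu> c N bs\<close> says that \<open>bs\<close> is a
  suitable sequence of length \<open>\<nu>\<close> over \<open>c\<close> in \<open>N\<close>.\<close>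

definition divides_along ::
  "('o, 'a, 'u) aecat \<Rightarrow> ('u rel \<Rightarrow> 'a \<Rightarrow> 'o \<Rightarrow> ('u \<Rightarrow> 'a) \<Rightarrow> bool) \<Rightarrow> 'a \<Rightarrow> 'a \<Rightarrow> 'a \<Rightarrow> 'o \<Rightarrow> bool" where
  "divides_along K Seq a b c M \<longleftrightarrow>
     (\<exists>\<mu>. regular_cardinal (Univ K) \<mu> \<and>
        (\<forall>\<nu>. regular_cardinal (Univ K) \<nu> \<longrightarrow> \<mu> \<le>o \<nu> \<longrightarrow>
           (\<exists>N f bs. extension K M f N \<and> Seq \<nu> (f \<cdot>\<^bsub>K\<^esub> c) N bs \<and>
              (\<forall>i \<in> Field \<nu>. gtp_eq K [bs i, f \<cdot>\<^bsub>K\<^esub> c] N [b, c] M) \<and>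
              (\<exists>\<kappa>. regular_cardinal (Univ K) \<kappa> \<and> \<kappa> <o \<nu> \<and>
                 (\<forall>I \<subseteq> Field \<nu>. |I| =o \<kappa> \<longrightarrow> \<not> consistent_for K a b c M f N bs I)))))"

definition isi_divides :: "('o, 'a, 'u) aecat \<Rightarrow> 'a \<Rightarrow> 'a \<Rightarrow> 'a \<Rightarrow> 'o \<Rightarrow> bool" where
  "isi_divides K a b c M = divides_along K (isi_sequence K) a b c M"

definition isi_forks :: "('o, 'a, 'u) aecat \<Rightarrow> 'a \<Rightarrow> 'a \<Rightarrow> 'a \<Rightarrow> 'o \<Rightarrow> bool" where
  "isi_forks K a b c M \<longleftrightarrow>
     (\<exists>N f (J :: 'u set) as ds. extension K M f N \<and> small (Univ K) J \<and>
        (\<forall>j \<in> J. into K (as j) N \<and> into K (ds j) N \<and> Dom K (as j) = Dom K a \<and>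
           isi_divides K (as j) (ds j) (f \<cdot>\<^bsub>K\<^esub> c) N) \<and>
        (\<forall>N' g a'. extension K N g N' \<longrightarrow> into K a' N' \<longrightarrow>
           gtp_eq K [a', g \<cdot>\<^bsub>K\<^esub> (f \<cdot>\<^bsub>K\<^esub> b), g \<cdot>\<^bsub>K\<^esub> (f \<cdot>\<^bsub>K\<^esub> c)] N'
                    [f \<cdot>\<^bsub>K\<^esub> a, f \<cdot>\<^bsub>K\<^esub> b, f \<cdot>\<^bsub>K\<^esub> c] N \<longrightarrow>
           (\<exists>j \<in> J. gtp_eq K [a', g \<cdot>\<^bsub>K\<^esub> ds j, g \<cdot>\<^bsub>K\<^esub> (f \<cdot>\<^bsub>K\<^esub> c)] N'
                             [as j, ds j, f \<cdot>\<^bsub>K\<^esub> c] N)))"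

definition isi_f_indep :: "('o, 'a, 'u) aecat \<Rightarrow> ('o, 'a) indep" where
  "isi_f_indep K M a c b \<longleftrightarrow>
     into K a M \<and> into K c M \<and> into K b M \<and> \<not> isi_forks K a b c M"

definition long_Kim_divides :: "('o, 'a, 'u) aecat \<Rightarrow> 'a \<Rightarrow> 'a \<Rightarrow> 'a \<Rightarrow> 'o \<Rightarrow> bool" where
  "long_Kim_divides K a b c M = divides_along K (independent_sequence K (isi_f_indep K)) a b c M"

definition lK_indep :: "('o, 'a, 'u) aecat \<Rightarrow> ('o, 'a) indep" where
  "lK_indep K M a c b \<longleftrightarrow>
     into K a M \<and> into K c M \<and> into K b M \<and> \<not> long_Kim_divides K a b c M"

definition existence_axiom :: "('o, 'a, 'u) aecat \<Rightarrow> 'o set \<Rightarrow> bool" where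
  "existence_axiom K B \<longleftrightarrow>
     (\<forall>M a c. into K a M \<longrightarrow> into K c M \<longrightarrow> sub_in K c B \<longrightarrow> isi_f_indep K M a c c)"

end

theory Submission
  imports Defs
begin

text \<open>
  A sequence in the type of \<open>b\<close> over \<open>c\<close> that is independent in the sense of \<open>ind\<close> tests independence:
  if \<open>gtp(a, b, c)\<close> is consistent for \<open>\<kappa>\<close> many terms, realized by \<open>a'\<close>, club local character applied to
  \<open>a'\<close> and the union of the initial segments gives a small submodel of an initial segment over which \<open>a'\<close>
  is independent from the next term, and transitivity brings the base down to \<open>c\<close>. Building such
  sequences as isi-sequences shows that isi-nonforking implies \<open>ind\<close>; hence the sequences in the
  definition of long Kim-dividing, which exist by the existence axiom, are independent in the sense of
  \<open>ind\<close>, and not long Kim-dividing implies \<open>ind\<close>.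

  Conversely, let \<open>a\<close> be independent from \<open>b\<close> over \<open>c\<close>. Since there are only boundedly many Galois types
  over the model \<open>M\<close>, a long independent sequence has many terms of the same type over \<open>M\<close>, hence of the
  same Lascar type over \<open>c\<close>. The independence theorem then produces, by transfinite recursion along
  the initial segments, one realization for all these terms.
\<close>

section \<open>Small sets and regular cardinals\<close>

text \<open>There is no monster model: equality of types means equality in some common extension, so
  every comparison of realizations is an amalgamation, and a recursion along a sequence has to carry
  its realization through limits. The sequences built to test independence start at the model
  \<open>M\<close> itself. Hence the submodel supplied by the club can be taken above
  \<open>M\<close>, so above \<open>c\<close>, as transitivity demands, and the cardinal
  \<open>\<kappa>\<close> is determined by \<open>a\<close> and \<open>M\<close> before the length
  of the sequence is known, as dividing demands. In the converse direction the given sequence has a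
  first segment that contains \<open>c\<close> but perhaps not \<open>M\<close>. Two models
  therefore control Lascar types over \<open>c\<close>: over \<open>M\<close> the terms of the
  sequence are compared, over the first segment the partial realizations. An auxiliary realization
  \<open>s\<close>, independent from the first segment, links the two. The existence axiom gives
  nonforking only over \<open>c\<close> from \<open>c\<close>; to get from there to all of
  \<open>M\<close>, a small set of forking witnesses, one family per type over \<open>M\<close>, is
  amalgamated into a single one.\<close>

lemma card_of_Pow_cong:
  assumes "|A| =o |B|"
  shows "|Pow A| =o |Pow B|"
proof -
  obtain f where "bij_betw f A B" using assms card_of_ordIso by blast
  then have "bij_betw (image f) (Pow A) (Pow B)" by (rule bij_betw_Pow)
  then show ?thesis using card_of_ordIso by blast
qed

locale universe =
  fixes U :: "'u rel"
  assumes U_inaccessible: "inaccessible U"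
begin

lemma U_Card_order: "Card_order U"
  using U_inaccessible by (simp add: inaccessible_def)

lemma U_Cinfinite: "Cinfinite U"
proof -
  have "natLeq \<le>o U" using U_inaccessible by (simp add: inaccessible_def ordLess_imp_ordLeq)
  then show ?thesis using U_Card_order
    by (metis Cinfinite_cong cinfinite_mono natLeq_Cinfinite)
qed

lemma U_regularCard: "regularCard U"
  using U_inaccessible by (simp add: inaccessible_def)

lemma small_subset: "small U Y \<Longrightarrow> X \<subseteq> Y \<Longrightarrow> small U X"
  unfolding small_def using card_of_mono1 ordLeq_ordLess_trans by blast

lemma small_image: "small U X \<Longrightarrow> small U (f ` X)"
  unfolding small_def using card_of_image ordLeq_ordLess_trans by blast

text \<open>Indices of diagrams and of forking families must lie in \<open>'u\<close>; this
  injection is what re-indexes small posets and families there.\<close>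

lemma small_inj:
  assumes "small U X"
  shows "\<exists>f :: 'b \<Rightarrow> 'u. inj_on f X"
proof -
  have "|X| \<le>o U" using assms by (simp add: small_def ordLess_imp_ordLeq)
  also have "U =o |Field U|" using U_Card_order by (simp add: card_of_Field_ordIso ordIso_symmetric)
  finally have "|X| \<le>o |Field U|" .
  then show ?thesis unfolding card_of_ordLeq[symmetric] by blast
qed

lemma small_ordIso: "small U X \<Longrightarrow> |X| =o |Y| \<Longrightarrow> small U Y"
  unfolding small_def using ordIso_ordLess_trans ordIso_symmetric by blast

lemma small_UN:
  assumes "small U I" "\<And>i. i \<in> I \<Longrightarrow> small U (A i)"
  shows "small U (\<Union>i\<in>I. A i)"
  using assms card_of_UNION_ordLess_infinite_Field_regularCard[OF U_regularCard U_Cinfinite]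
  unfolding small_def by blast

lemma small_Sigma:
  assumes "small U I" "\<And>i. i \<in> I \<Longrightarrow> small U (A i)"
  shows "small U (Sigma I A)"
proof -
  have "Sigma I A = (\<Union>i\<in>I. Pair i ` A i)" by auto
  then show ?thesis using assms by (simp add: small_UN small_image)
qed

lemma small_finite: "finite X \<Longrightarrow> small U X"
proof -
  assume "finite X"
  then have "|X| <o U"
    using U_Cinfinite U_Card_order by (intro finite_ordLess_infinite) (auto simp: cinfinite_def card_order_on_def card_of_Well_order card_of_well_order_on Field_card_of)
  then show ?thesis by (simp add: small_def)
qed

lemma small_Un: "small U X \<Longrightarrow> small U Y \<Longrightarrow> small U (X \<union> Y)"
  using small_UN[of "{True, False}" "\<lambda>b. if b then X else Y"] small_finite[of "{True, False}"]
  by (auto simp: Un_commute)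

text \<open>Inaccessibility speaks of sets with elements in \<open>'u\<close> only, hence the
  transport along an injection.\<close>

lemma small_Pow:
  assumes "small U X"
  shows "small U (Pow X)"
proof -
  obtain f :: "'a \<Rightarrow> 'u" where f: "inj_on f X" using small_inj[OF assms] by blast
  have "|X| =o |f ` X|" using f card_of_ordIso inj_on_imp_bij_betw by blast
  moreover have "small U (f ` X)" using assms small_image by blast
  then have "small U (Pow (f ` X))" using U_inaccessible by (simp add: inaccessible_def small_def)
  ultimately show ?thesis using small_ordIso card_of_Pow_cong ordIso_symmetric by blast
qed

lemma regular_cardinalD:
  assumes "regular_cardinal U \<kappa>"
  shows "Cinfinite \<kappa>" "regularCard \<kappa>" "\<kappa> <o U" "Card_order \<kappa>" "Well_order \<kappa>"
  using assms by (auto simp: regular_cardinal_def card_order_on_def)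

lemma regular_small_Field:
  assumes "regular_cardinal U \<kappa>"
  shows "small U (Field \<kappa>)"
  using regular_cardinalD[OF assms] unfolding small_def
  by (meson card_of_Field_ordIso ordIso_ordLess_trans)

text \<open>A successor cardinal is regular, and it stays below \<open>U\<close> because it is at
  most the size of a power set. The summand \<open>range g\<close> makes the set infinite. Since
  \<open>cardSuc |A|\<close> is a relation on \<open>'u set\<close>, it is carried back to
  \<open>'u\<close> along \<open>h\<close>.\<close>

lemma regular_above_small:
  assumes "small U (X :: 'b set)"
  shows "\<exists>\<kappa>. regular_cardinal U \<kappa> \<and> |X| <o \<kappa>"
proof -
  obtain f :: "'b \<Rightarrow> 'u" where f: "inj_on f X" using small_inj[OF assms] by blast
  have "natLeq <o U" using U_inaccessible by (simp add: inaccessible_def)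
  then have "small U (UNIV :: nat set)" unfolding small_def
    by (metis Field_natLeq card_of_Field_ordIso natLeq_Card_order ordIso_ordLess_trans)
  then have smN: "small U (UNIV :: nat set)" .
  then obtain g :: "nat \<Rightarrow> 'u" where g: "inj g" using small_inj by blast
  define A where "A = f ` X \<union> range g"
  have smA: "small U A" unfolding A_def by (intro small_Un small_image assms smN)
  have "infinite A" using g unfolding A_def by (simp add: finite_image_iff)
  then have ci: "Cinfinite |A|" using card_of_Card_order by (auto simp: cinfinite_def Field_card_of)
  let ?s = "cardSuc |A|"
  have "?s \<le>o |Pow A|" by (metis card_of_Card_order card_of_Pow cardSuc_least)
  then have s_lt: "?s <o U" using small_Pow[OF smA] unfolding small_def using ordLeq_ordLess_trans by blast
  have cs: "Cinfinite ?s" "regularCard ?s" using ci Cinfinite_cardSuc regularCard_cardSuc by blast+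
  have s_F: "|Field ?s| =o ?s" using cs(1) card_of_Field_ordIso by blast
  then have "small U (Field ?s)" using s_lt unfolding small_def using ordIso_ordLess_trans by blast
  then obtain h :: "'u set \<Rightarrow> 'u" where h: "inj_on h (Field ?s)" using small_inj by blast
  define \<kappa> where "\<kappa> = |h ` Field ?s|"
  have "|Field ?s| =o \<kappa>" unfolding \<kappa>_def using h card_of_ordIso inj_on_imp_bij_betw by blast
  then have iso: "?s =o \<kappa>" using s_F ordIso_symmetric ordIso_transitive by blast
  have "Cinfinite \<kappa>" using iso cs(1) Cinfinite_cong by blast
  moreover have "regularCard \<kappa>" using regularCard_ordIso[OF iso cs] .
  moreover have "\<kappa> <o U" using iso s_lt ordIso_ordLess_trans ordIso_symmetric by blast
  moreover have "|X| <o \<kappa>"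
  proof -
    have "|X| \<le>o |A|" unfolding A_def using f card_of_ordLeq by blast
    also have "|A| <o ?s" by (simp add: cardSuc_greater card_of_Card_order)
    also have "?s =o \<kappa>" by (rule iso)
    finally show ?thesis .
  qed
  ultimately show ?thesis unfolding regular_cardinal_def by blast
qed

lemma regular_above:
  assumes "small U X" "regular_cardinal U \<kappa>" "regular_cardinal U \<nu>"
  shows "\<exists>\<mu>. regular_cardinal U \<mu> \<and> |X| <o \<mu> \<and> \<kappa> <o \<mu> \<and> \<nu> <o \<mu>"
proof -
  let ?Y = "X <+> (Field \<kappa> <+> Field \<nu>)"
  have eq: "?Y = Inl ` X \<union> (Inr ` (Inl ` Field \<kappa> \<union> Inr ` Field \<nu>))" by auto
  have "small U ?Y" unfolding eq
    by (intro small_Un small_image regular_small_Field assms)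
  then obtain \<mu> where \<mu>: "regular_cardinal U \<mu>" "|?Y| <o \<mu>" using regular_above_small by blast
  have "|X| \<le>o |?Y|" by (rule card_of_Plus1)
  moreover have "|Field \<kappa>| \<le>o |?Y|" "|Field \<nu>| \<le>o |?Y|"
    by (rule ordLeq_transitive[OF _ card_of_Plus2], rule card_of_Plus1 card_of_Plus2)+
  moreover have "\<kappa> \<le>o |Field \<kappa>|" "\<nu> \<le>o |Field \<nu>|"
    using regular_cardinalD(4)[OF assms(2)] regular_cardinalD(4)[OF assms(3)]
      card_of_Field_ordIso ordIso_iff_ordLeq by blast+
  ultimately have "|X| <o \<mu>" "\<kappa> <o \<mu>" "\<nu> <o \<mu>"
    using \<mu>(2) by (meson ordLeq_ordLess_trans)+
  then show ?thesis using \<mu>(1) by blast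
qed

end

text \<open>Cofinal subsets of a regular cardinal have full cardinality, so a smaller set is not
  cofinal; by linearity a point witnessing this is an upper bound.\<close>

lemma regularCard_bounded:
  assumes "Cinfinite \<kappa>" "regularCard \<kappa>" "S \<subseteq> Field \<kappa>" "|S| <o \<kappa>"
  shows "\<exists>u\<in>Field \<kappa>. \<forall>s\<in>S. (s, u) \<in> \<kappa>"
proof -
  have wo: "Well_order \<kappa>" using assms by (simp add: card_order_on_def)
  then interpret wo_rel \<kappa> by unfold_locales
  have "\<not> cofinal S \<kappa>"
    using assms not_ordLess_ordIso unfolding regularCard_def by blast
  then obtain a where a: "a \<in> Field \<kappa>" "\<forall>b\<in>S. a = b \<or> (a, b) \<notin> \<kappa>" unfolding cofinal_def by blast
  have "(s, a) \<in> \<kappa>" if "s \<in> S" for s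
    using a that assms(3) TOTALS REFL by (metis refl_onD subsetD)
  then show ?thesis using a by blast
qed

section \<open>Zero, successors and limits in a well-order without maximum\<close>

context wo_rel
begin

lemma osuc_in:
  assumes "i \<in> Field r" "\<And>i. i \<in> Field r \<Longrightarrow> \<exists>j\<in>Field r. i \<noteq> j \<and> (i, j) \<in> r"
  shows "osuc r i \<in> Field r" "(i, osuc r i) \<in> r" "osuc r i \<noteq> i"
    and "\<And>j. (i, j) \<in> r \<Longrightarrow> i \<noteq> j \<Longrightarrow> (osuc r i, j) \<in> r"
    and "\<And>j. (j, osuc r i) \<in> r \<Longrightarrow> j \<noteq> osuc r i \<Longrightarrow> (j, i) \<in> r"
proof -
  have sub: "{i} \<subseteq> Field r" using assms by simp
  obtain j where "j \<in> Field r" "i \<noteq> j" "(i, j) \<in> r" using assms by blast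
  then have ne: "AboveS {i} \<noteq> {}" by (auto simp: Order_Relation.AboveS_def)
  show 1: "osuc r i \<in> Field r" unfolding osuc_def using suc_inField[OF sub ne] .
  show 2: "(i, osuc r i) \<in> r" and 3: "osuc r i \<noteq> i"
    unfolding osuc_def using suc_greater[OF sub ne, of i] by auto
  show 4: "(osuc r i, j) \<in> r" if "(i, j) \<in> r" "i \<noteq> j" for j
    unfolding osuc_def
  proof (rule suc_least_AboveS)
    show "j \<in> AboveS {i}" using that by (auto simp: Order_Relation.AboveS_def Field_def)
  qed
  show "(j, i) \<in> r" if "(j, osuc r i) \<in> r" "j \<noteq> osuc r i" for j
  proof (rule ccontr)
    assume n: "(j, i) \<notin> r"
    have "j \<in> Field r" using that by (auto simp: Field_def)
    then have "(i, j) \<in> r" "i \<noteq> j" using n TOTALS assms(1) by auto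
    then show False using 4 that ANTISYM by (metis antisymD)
  qed
qed

lemma ozero_in:
  assumes "Field r \<noteq> {}"
  shows "ozero r \<in> Field r" "\<And>i. i \<in> Field r \<Longrightarrow> (ozero r, i) \<in> r"
  unfolding ozero_def using assms minim_in minim_least by auto

lemma cases_zero_suc_limit:
  assumes "j \<in> Field r"
  obtains "j = ozero r" | i where "i \<in> underS j" "j = osuc r i" | "olimit r j"
  using assms unfolding olimit_def by blast

end

text \<open>With a maximum \<open>a\<close> the field would be \<open>under a\<close>, which an
  infinite initial ordinal never is.\<close>

lemma Cinfinite_no_max:
  assumes "Cinfinite r" "i \<in> Field r"
  shows "\<exists>j\<in>Field r. i \<noteq> j \<and> (i, j) \<in> r"
proof -
  have wo: "Well_order r" using assms by (simp add: card_order_on_def)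
  then interpret wo_rel r by unfold_locales
  have "\<not> (\<exists>a. Field r = under a)"
    using Card_order_infinite_not_under assms unfolding cinfinite_def by blast
  then have "\<not> Field r \<subseteq> under i" using under_Field[of r i] by blast
  then obtain j where "j \<in> Field r" "(j, i) \<notin> r" by (auto simp: under_def)
  then show ?thesis using TOTALS assms(2) REFL by (metis refl_onD)
qed

section \<open>Diagrams and presentable objects\<close>

context category
begin

lemma Ident_simps [simp]:
  assumes "X \<in> Obj C"
  shows "Ident C X \<in> Arr C" "Dom C (Ident C X) = X" "Cod C (Ident C X) = X"
  using Ident_hom[OF assms] by (auto simp: hom_def)

lemma Comp_simps [simp]:
  assumes "f \<in> Arr C" "g \<in> Arr C" "Cod C f = Dom C g"
  shows "g \<cdot> f \<in> Arr C" "Dom C (g \<cdot> f) = Dom C f" "Cod C (g \<cdot> f) = Cod C g"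
  using Comp_hom[of f "Dom C f" "Cod C f" g "Cod C g"] assms by (auto simp: hom_def)

lemma assoc [simp]:
  assumes "f \<in> Arr C" "g \<in> Arr C" "h \<in> Arr C" "Cod C f = Dom C g" "Cod C g = Dom C h"
  shows "(h \<cdot> g) \<cdot> f = h \<cdot> (g \<cdot> f)"
  using Comp_assoc[of f "Dom C f" "Cod C f" g "Cod C g" h "Cod C h"] assms by (auto simp: hom_def)

lemma Ident_left [simp]: "f \<in> Arr C \<Longrightarrow> Cod C f = X \<Longrightarrow> Ident C X \<cdot> f = f"
  using Ident_Comp[of f "Dom C f" X] by (auto simp: hom_def)

lemma Ident_right [simp]: "f \<in> Arr C \<Longrightarrow> Dom C f = X \<Longrightarrow> f \<cdot> Ident C X = f"
  using Comp_Ident[of f X "Cod C f"] by (auto simp: hom_def)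

lemma Dom_in [simp]: "f \<in> Arr C \<Longrightarrow> Dom C f \<in> Obj C"
  by (rule Dom_Obj)

lemma Cod_in [simp]: "f \<in> Arr C \<Longrightarrow> Cod C f \<in> Obj C"
  by (rule Cod_Obj)

text \<open>The simplifier nests compositions to the right, after which an equation between
  composites no longer matches inside a longer composite. This lifts it under a further arrow
  \<open>z\<close> in nested form.\<close>

lemma reassoc:
  assumes "x \<cdot> f = y \<cdot> g"
    and "f \<in> Arr C" "g \<in> Arr C" "x \<in> Arr C" "y \<in> Arr C" "z \<in> Arr C"
    and "Cod C f = Dom C x" "Cod C g = Dom C y" "Cod C z = Dom C f" "Cod C z = Dom C g"
  shows "x \<cdot> (f \<cdot> z) = y \<cdot> (g \<cdot> z)"
  by (metis assms assoc)

lemma reassoc1: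
  assumes "x \<cdot> f = y"
    and "f \<in> Arr C" "x \<in> Arr C" "z \<in> Arr C"
    and "Cod C f = Dom C x" "Cod C z = Dom C f"
  shows "x \<cdot> (f \<cdot> z) = y \<cdot> z"
  by (metis assms assoc)

lemma sub_le_Comp: "f \<in> Arr C \<Longrightarrow> g \<in> Arr C \<Longrightarrow> Cod C f = Dom C g \<Longrightarrow> sub_le C (g \<cdot> f) g"
  unfolding sub_le_def by (rule bexI[of _ f]) (auto simp: hom_def)

lemma sub_le_trans:
  assumes "sub_le C x y" "sub_le C y z" "z \<in> Arr C"
  shows "sub_le C x z"
proof -
  obtain u v where u: "u \<in> hom C (Dom C x) (Dom C y)" "y \<cdot> u = x"
    and v: "v \<in> hom C (Dom C y) (Dom C z)" "z \<cdot> v = y"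
    using assms by (auto simp: sub_le_def)
  then have "z \<cdot> (v \<cdot> u) = x" "v \<cdot> u \<in> hom C (Dom C x) (Dom C z)"
    using assms(3) by (auto simp: hom_def reassoc1)
  then show ?thesis unfolding sub_le_def by blast
qed

lemma sub_le_post:
  assumes "sub_le C x y" "y \<in> Arr C" "f \<in> Arr C" "Dom C f = Cod C y"
  shows "sub_le C (f \<cdot> x) (f \<cdot> y)"
proof -
  obtain u where u: "u \<in> hom C (Dom C x) (Dom C y)" "y \<cdot> u = x"
    using assms by (auto simp: sub_le_def)
  then have [simp]: "u \<in> Arr C" "Dom C u = Dom C x" "Cod C u = Dom C y" by (auto simp: hom_def)
  have "x \<in> Arr C" "Cod C x = Cod C y" using u(2) assms by auto
  then show ?thesis unfolding sub_le_def using assms u(2)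
    by (intro bexI[of _ u]) (auto simp: hom_def)
qed

lemma sub_le_Cod:
  assumes "sub_le C x y" "y \<in> Arr C"
  shows "x \<in> Arr C" "Cod C x = Cod C y"
  using assms by (auto simp: sub_le_def hom_def)

lemma sub_eq_post:
  assumes "sub_eq C x y" "y \<in> Arr C" "f \<in> Arr C" "Dom C f = Cod C y"
  shows "sub_eq C (f \<cdot> x) (f \<cdot> y)"
  using assms sub_le_post sub_le_Cod unfolding sub_eq_def by metis

lemma diagramD:
  assumes "diagram C r D t"
  shows "Partial_order r" "\<And>i. i \<in> Field r \<Longrightarrow> D i \<in> Obj C" "\<And>i. i \<in> Field r \<Longrightarrow> t i i = Ident C (D i)"
    "\<And>i j. (i, j) \<in> r \<Longrightarrow> t i j \<in> Arr C" "\<And>i j. (i, j) \<in> r \<Longrightarrow> Dom C (t i j) = D i"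
    "\<And>i j. (i, j) \<in> r \<Longrightarrow> Cod C (t i j) = D j"
    "\<And>i j k. (i, j) \<in> r \<Longrightarrow> (j, k) \<in> r \<Longrightarrow> t j k \<cdot> t i j = t i k"
  using assms by (auto simp: diagram_def hom_def)

lemma coconeD:
  assumes "cocone C r D t X k"
  shows "X \<in> Obj C" "\<And>i. i \<in> Field r \<Longrightarrow> k i \<in> Arr C" "\<And>i. i \<in> Field r \<Longrightarrow> Dom C (k i) = D i"
    "\<And>i. i \<in> Field r \<Longrightarrow> Cod C (k i) = X"
    "\<And>i j. (i, j) \<in> r \<Longrightarrow> k j \<cdot> t i j = k i"
  using assms by (auto simp: cocone_def hom_def)

lemma cocone_post:
  assumes "cocone C r D t X k" "diagram C r D t" "f \<in> Arr C" "Dom C f = X"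
  shows "cocone C r D t (Cod C f) (\<lambda>i. f \<cdot> k i)"
proof -
  have "(f \<cdot> k j) \<cdot> t i j = f \<cdot> k i" if "(i, j) \<in> r" for i j
  proof -
    have "i \<in> Field r" "j \<in> Field r" using that by (auto simp: Field_def)
    then show ?thesis
      using assms(3,4) that coconeD[OF assms(1)] diagramD[OF assms(2)] by simp
  qed
  then show ?thesis using assms(3,4) coconeD[OF assms(1)] unfolding cocone_def by (auto simp: hom_def)
qed

lemma colimit_induced:
  assumes "colimit C r D t X k" "cocone C r D t Y h"
  obtains u where "u \<in> Arr C" "Dom C u = X" "Cod C u = Y" "\<And>i. i \<in> Field r \<Longrightarrow> u \<cdot> k i = h i"
  using assms unfolding colimit_def hom_def by blast

lemma colimit_unique:
  assumes "colimit C r D t X k" "u \<in> Arr C" "Dom C u = X" "v \<in> Arr C" "Dom C v = X" "Cod C v = Cod C u"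
    and "\<And>i. i \<in> Field r \<Longrightarrow> u \<cdot> k i = v \<cdot> k i"
  shows "u = v"
proof -
  have "cocone C r D t (Cod C u) (\<lambda>i. u \<cdot> k i)"
    using assms cocone_post unfolding colimit_def by blast
  then have "\<exists>!w. w \<in> hom C X (Cod C u) \<and> (\<forall>i \<in> Field r. w \<cdot> k i = u \<cdot> k i)"
    using assms(1) unfolding colimit_def by blast
  moreover have "u \<in> hom C X (Cod C u)" "v \<in> hom C X (Cod C u)" using assms by (auto simp: hom_def)
  ultimately show ?thesis using assms(7) by (metis (no_types))
qed

lemma mono_cancel:
  assumes "mono_arrow C f" "g \<in> Arr C" "h \<in> Arr C" "Cod C g = Dom C f" "Cod C h = Dom C f"
    "Dom C h = Dom C g" "f \<cdot> g = f \<cdot> h"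
  shows "g = h"
  using assms unfolding mono_arrow_def hom_def by blast

end

text \<open>The factorization through a stage is automatically unique when all arrows are monic.\<close>

lemma presentableI_mono:
  assumes "category C" "\<And>f. f \<in> Arr C \<Longrightarrow> mono_arrow C f" "X \<in> Obj C"
    and "\<And>r D t Y k f. directed U \<nu> r \<Longrightarrow> colimit C r D t Y k \<Longrightarrow> f \<in> hom C X Y \<Longrightarrow>
      \<exists>i \<in> Field r. \<exists>g \<in> hom C X (D i). k i \<cdot>\<^bsub>C\<^esub> g = f"
  shows "presentable U \<nu> C X"
  unfolding presentable_def
proof (intro conjI allI impI ballI assms(3,4))
  interpret category C by fact
  fix r D t Y k i g h
  assume *: "colimit C r D t Y k" "i \<in> Field r" "g \<in> hom C X (D i)" "h \<in> hom C X (D i)"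
    "k i \<cdot>\<^bsub>C\<^esub> g = k i \<cdot>\<^bsub>C\<^esub> h"
  have c: "cocone C r D t Y k" and "Partial_order r" using *(1) by (auto simp: colimit_def diagram_def)
  have "g = h"
    by (rule mono_cancel[of "k i"]) (use * assms(2) coconeD[OF c] in \<open>auto simp: hom_def\<close>)
  moreover have "(i, i) \<in> r" using \<open>Partial_order r\<close> *(2)
    by (simp add: partial_order_on_def preorder_on_def refl_on_def)
  ultimately show "\<exists>j. (i, j) \<in> r \<and> t i j \<cdot>\<^bsub>C\<^esub> g = t i j \<cdot>\<^bsub>C\<^esub> h" by blast
qed

lemma directed_mono:
  assumes "directed U \<kappa> r" "\<nu> \<le>o \<kappa>"
  shows "directed U \<nu> r"
  using assms unfolding directed_def by (meson ordLess_ordLeq_trans)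

lemma directed_upper:
  assumes "directed U \<nu> r" "S \<subseteq> Field r" "|S| <o \<nu>"
  obtains u where "u \<in> Field r" "\<And>s. s \<in> S \<Longrightarrow> (s, u) \<in> r"
proof -
  have "\<exists>u\<in>Field r. \<forall>s\<in>S. (s, u) \<in> r" using assms by (simp add: directed_def)
  then show thesis using that by blast
qed

lemma presentable_mono:
  assumes "presentable U \<nu> C X" "\<nu> \<le>o \<kappa>"
  shows "presentable U \<kappa> C X"
  using assms directed_mono[OF _ assms(2)] unfolding presentable_def by blast

lemma natLeq_le_Cinfinite: "Cinfinite \<kappa> \<Longrightarrow> natLeq \<le>o \<kappa>"
  using natLeq_ordLeq_cinfinite by blast

text \<open>By regularity. Arrows from a \<open>\<kappa>\<close>-presentable object into the colimit
  of a chain of length \<open>\<kappa>\<close> thus factor through a stage, which is how a small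
  submodel gets into an initial segment.\<close>

lemma (in universe) regular_directed:
  assumes "regular_cardinal U \<kappa>"
  shows "directed U \<kappa> \<kappa>"
proof -
  note k = regular_cardinalD[OF assms]
  then have "Partial_order \<kappa>" by (simp add: order_on_defs)
  then show ?thesis unfolding directed_def
    using regular_small_Field[OF assms] regularCard_bounded[OF k(1,2)] by blast
qed

section \<open>Presentability in accessible categories with monic arrows\<close>

locale mono_accessible = universe U + category C
  for U :: "'u rel" and C :: "('o, 'a, 'm) category_scheme" (structure) +
  assumes acc: "accessible U C"
    and mono: "f \<in> Arr C \<Longrightarrow> mono_arrow C f"
begin

lemma cancel:
  assumes "f \<in> Arr C" "g \<in> Arr C" "h \<in> Arr C" "Cod C g = Dom C f" "Cod C h = Dom C f"
    "Dom C h = Dom C g" "f \<cdot> g = f \<cdot> h"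
  shows "g = h"
  using mono_cancel[OF mono] assms by blast

lemma small_hom: "X \<in> Obj C \<Longrightarrow> Y \<in> Obj C \<Longrightarrow> small U (hom C X Y)"
  using acc unfolding accessible_def by blast

text \<open>The object is a small colimit of presentable ones. If \<open>\<nu>\<close> exceeds the
  size of the index poset, the stages through which the pieces factor have a common upper bound, and
  there the factorizations are glued.\<close>

lemma presentable_exists:
  assumes X: "X \<in> Obj C"
  shows "\<exists>\<nu>. regular_cardinal U \<nu> \<and> presentable U \<nu> C X"
proof -
  obtain \<nu>0 P where \<nu>0: "regular_cardinal U \<nu>0" and P: "\<forall>X \<in> P. presentable U \<nu>0 C X"
    and gen: "\<forall>Y \<in> Obj C. \<exists>r D t k. directed U \<nu>0 r \<and> (\<forall>i \<in> Field r. D i \<in> P) \<and> colimit C r D t Y k"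
    using acc unfolding accessible_def by blast
  obtain r D t k where r: "directed U \<nu>0 r" "\<forall>i \<in> Field r. D i \<in> P" "colimit C r D t X k"
    using gen X by blast
  have sm: "small U (Field r)" using r(1) by (simp add: directed_def)
  obtain \<nu> where \<nu>: "regular_cardinal U \<nu>" "|Field r| <o \<nu>" "\<nu>0 <o \<nu>"
    using regular_above[OF sm \<nu>0 \<nu>0] by blast
  have dia: "diagram C r D t" and coc: "cocone C r D t X k" using r(3) by (auto simp: colimit_def)
  have "presentable U \<nu> C X"
  proof (rule presentableI_mono)
    fix s E v Y l f
    assume s: "directed U \<nu> s" and Y: "colimit C s E v Y l" and f: "f \<in> hom C X Y"
    have diaY: "diagram C s E v" and cocY: "cocone C s E v Y l" using Y by (auto simp: colimit_def)
    have s0: "directed U \<nu>0 s" using s \<nu>(3) directed_mono ordLess_imp_ordLeq by blast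
    have f': "f \<in> Arr C" "Dom C f = X" "Cod C f = Y" using f by (auto simp: hom_def)
    have "\<forall>i\<in>Field r. \<exists>j g. j \<in> Field s \<and> g \<in> hom C (D i) (E j) \<and> l j \<cdot> g = f \<cdot> k i"
    proof
      fix i assume i: "i \<in> Field r"
      have "f \<cdot> k i \<in> hom C (D i) Y" using f' i coconeD[OF coc] by (auto simp: hom_def)
      moreover have "presentable U \<nu>0 C (D i)" using r(2) P i by blast
      ultimately have "\<exists>j \<in> Field s. \<exists>g \<in> hom C (D i) (E j). l j \<cdot> g = f \<cdot> k i"
        using s0 Y unfolding presentable_def by blast
      then show "\<exists>j g. j \<in> Field s \<and> g \<in> hom C (D i) (E j) \<and> l j \<cdot> g = f \<cdot> k i" by blast
    qed
    then obtain j g where jg: "\<And>i. i \<in> Field r \<Longrightarrow> j i \<in> Field s"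
      "\<And>i. i \<in> Field r \<Longrightarrow> g i \<in> hom C (D i) (E (j i))" "\<And>i. i \<in> Field r \<Longrightarrow> l (j i) \<cdot> g i = f \<cdot> k i"
      by metis
    have "|j ` Field r| <o \<nu>" using \<nu>(2) card_of_image ordLeq_ordLess_trans by blast
    moreover have "j ` Field r \<subseteq> Field s" using jg(1) by blast
    ultimately obtain u where u: "u \<in> Field s" "\<And>x. x \<in> j ` Field r \<Longrightarrow> (x, u) \<in> s"
      using directed_upper[OF s] by metis
    from u(2) have u2: "\<And>i. i \<in> Field r \<Longrightarrow> (j i, u) \<in> s" by blast
    define h where "h i = v (j i) u \<cdot> g i" for i
    have h: "h i \<in> Arr C" "Dom C (h i) = D i" "Cod C (h i) = E u" "l u \<cdot> h i = f \<cdot> k i" if i: "i \<in> Field r" for i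
    proof -
      have gi: "g i \<in> Arr C" "Dom C (g i) = D i" "Cod C (g i) = E (j i)" using jg(2)[OF i] by (auto simp: hom_def)
      note d = diagramD[OF diaY] and c = coconeD[OF cocY]
      show "h i \<in> Arr C" "Dom C (h i) = D i" "Cod C (h i) = E u"
        using gi u2[OF i] d by (auto simp: h_def)
      show "l u \<cdot> h i = f \<cdot> k i"
        unfolding h_def using reassoc1[OF c(5)[OF u2[OF i]], of "g i"] gi u i d c jg(1,3)[OF i] by auto
    qed
    have "cocone C r D t (E u) h"
      unfolding cocone_def
    proof (intro conjI allI impI ballI)
      show "E u \<in> Obj C" using u diagramD[OF diaY] by blast
      show "h i \<in> hom C (D i) (E u)" if "i \<in> Field r" for i using h[OF that] by (auto simp: hom_def)
      fix i i' assume ii: "(i, i') \<in> r"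
      then have F: "i \<in> Field r" "i' \<in> Field r" by (auto simp: Field_def)
      note d = diagramD[OF dia]
      have t: "t i i' \<in> Arr C" "Dom C (t i i') = D i" "Cod C (t i i') = D i'" using d ii by auto
      \<comment> \<open>Compatibility of the lifted arrows is checked after composing with the monic
        \<open>l u\<close>, where it becomes that of the cocone \<open>k\<close>.\<close>
      have "l u \<cdot> (h i' \<cdot> t i i') = (f \<cdot> k i') \<cdot> t i i'"
        by (rule reassoc1[OF h(4)]) (use h F t u coconeD[OF cocY] in auto)
      also have "\<dots> = f \<cdot> (k i' \<cdot> t i i')" using h F t f' coconeD[OF coc] by simp
      also have "\<dots> = l u \<cdot> h i" using h F ii coconeD[OF coc] by simp
      finally show "h i' \<cdot> t i i' = h i"
        by (rule cancel[rotated -1]) (use h F t u coconeD[OF cocY] in auto)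
    qed
    then obtain w where w: "w \<in> Arr C" "Dom C w = X" "Cod C w = E u" "\<And>i. i \<in> Field r \<Longrightarrow> w \<cdot> k i = h i"
      using colimit_induced[OF r(3)] by blast
    have "l u \<cdot> w = f"
    proof (rule colimit_unique[OF r(3)])
      show "(l u \<cdot> w) \<cdot> k i = f \<cdot> k i" if "i \<in> Field r" for i
        using that w h u coconeD[OF cocY] coconeD[OF coc] by simp
    qed (use w u f' coconeD[OF cocY] in auto)
    then show "\<exists>i\<in>Field s. \<exists>g\<in>hom C X (E i). l i \<cdot> g = f"
      using u w by (auto simp: hom_def)
  qed (use X mono category_axioms in auto)
  then show ?thesis using \<nu>(1) by blast
qed

end

section \<open>Transfinite construction of diagrams\<close>

lemma diagram_cong:
  assumes "diagram C r D t" "\<And>i. i \<in> Field r \<Longrightarrow> D i = D' i" "\<And>i j. (i, j) \<in> r \<Longrightarrow> t i j = t' i j"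
  shows "diagram C r D' t'"
proof -
  have F: "i \<in> Field r" "j \<in> Field r" if "(i, j) \<in> r" for i j using that by (auto simp: Field_def)
  have "refl_on (Field r) r"
    using assms(1) by (simp add: diagram_def partial_order_on_def preorder_on_def)
  then have R: "(i, i) \<in> r" if "i \<in> Field r" for i using that by (simp add: refl_onD)
  have T: "(i, k) \<in> r" if "(i, j) \<in> r" "(j, k) \<in> r" for i j k
    using assms(1) that unfolding diagram_def partial_order_on_def preorder_on_def by (meson transD)
  show ?thesis
    unfolding diagram_def
  proof (intro conjI allI impI ballI)
    show "Partial_order r" using assms(1) by (simp add: diagram_def)
    show "D' i \<in> Obj C" "t' i i = Ident C (D' i)" if "i \<in> Field r" for i
      using assms(1) assms(2)[OF that] assms(3)[OF R[OF that]] that unfolding diagram_def by auto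
    show "t' i j \<in> hom C (D' i) (D' j)" if "(i, j) \<in> r" for i j
      using assms(1) assms(2)[OF F(1)[OF that]] assms(2)[OF F(2)[OF that]] assms(3)[OF that] that
      unfolding diagram_def by metis
    show "t' j k \<cdot>\<^bsub>C\<^esub> t' i j = t' i k" if "(i, j) \<in> r" "(j, k) \<in> r" for i j k
      using assms(1) assms(3)[OF that(1)] assms(3)[OF that(2)] assms(3)[OF T[OF that]] that
      unfolding diagram_def by metis
  qed
qed

lemma cocone_cong:
  assumes "cocone C r D t X k" "\<And>i. i \<in> Field r \<Longrightarrow> D i = D' i" "\<And>i j. (i, j) \<in> r \<Longrightarrow> t i j = t' i j"
    "\<And>i. i \<in> Field r \<Longrightarrow> k i = k' i"
  shows "cocone C r D' t' X k'"
  using assms FieldI1 FieldI2 unfolding cocone_def by metis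

lemma colimit_cong:
  assumes "colimit C r D t X k" "\<And>i. i \<in> Field r \<Longrightarrow> D i = D' i" "\<And>i j. (i, j) \<in> r \<Longrightarrow> t i j = t' i j"
    "\<And>i. i \<in> Field r \<Longrightarrow> k i = k' i"
  shows "colimit C r D' t' X k'"
proof -
  have "cocone C r D t Y h" if "cocone C r D' t' Y h" for Y h
    by (rule cocone_cong[OF that]) (use assms in auto)
  moreover have "\<exists>!u. u \<in> hom C X Y \<and> (\<forall>i\<in>Field r. u \<cdot>\<^bsub>C\<^esub> k' i = h i)"
    if "\<exists>!u. u \<in> hom C X Y \<and> (\<forall>i\<in>Field r. u \<cdot>\<^bsub>C\<^esub> k i = h i)" for Y h
    using that assms(4) by simp
  moreover have "diagram C r D' t'"
    by (rule diagram_cong[of C r D t]) (use assms in \<open>auto simp: colimit_def\<close>)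
  moreover have "cocone C r D' t' X k'"
    by (rule cocone_cong[of C r D t X k]) (use assms in \<open>auto simp: colimit_def\<close>)
  ultimately show ?thesis
    using assms(1) by (simp add: colimit_def)
qed

lemma Field_Restr_sub:
  assumes "Refl r" "A \<subseteq> Field r"
  shows "Field (Restr r A) = A"
  using assms unfolding Field_def refl_on_def by auto

lemma Partial_order_Restr: "Partial_order r \<Longrightarrow> Partial_order (Restr r A)"
  unfolding partial_order_on_def preorder_on_def refl_on_def trans_def antisym_def Field_def
  by blast

lemma diagram_RestrI:
  assumes "Partial_order r" "A \<subseteq> Field r"
    and "\<And>i. i \<in> A \<Longrightarrow> D i \<in> Obj C" "\<And>i. i \<in> A \<Longrightarrow> t i i = Ident C (D i)"
    and "\<And>i j. i \<in> A \<Longrightarrow> j \<in> A \<Longrightarrow> (i, j) \<in> r \<Longrightarrow> t i j \<in> hom C (D i) (D j)"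
    and "\<And>i j k. i \<in> A \<Longrightarrow> j \<in> A \<Longrightarrow> k \<in> A \<Longrightarrow> (i, j) \<in> r \<Longrightarrow> (j, k) \<in> r \<Longrightarrow>
      t j k \<cdot>\<^bsub>C\<^esub> t i j = t i k"
  shows "diagram C (Restr r A) D t"
proof -
  have "Refl r" using assms(1) by (simp add: partial_order_on_def preorder_on_def)
  then have "Field (Restr r A) = A" using assms(2) Field_Restr_sub by blast
  then show ?thesis
    using assms(3-) Partial_order_Restr[OF assms(1), of A] unfolding diagram_def by auto
qed

lemma diagram_Restr:
  assumes "diagram C r D t" "A \<subseteq> Field r"
  shows "diagram C (Restr r A) D t"
proof -
  have "Refl r" using assms by (simp add: diagram_def partial_order_on_def preorder_on_def)
  then show ?thesis
    using assms Field_Restr_sub[of r A] Partial_order_Restr[of r A] unfolding diagram_def by auto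
qed

lemma cocone_Restr:
  assumes "cocone C r D t X k" "A \<subseteq> Field r" "Refl r"
  shows "cocone C (Restr r A) D t X k"
  using assms Field_Restr_sub[of r A] unfolding cocone_def by auto

text \<open>
  Transfinite construction of a coherent diagram: the diagram below \<open>j\<close> is completed at \<open>j\<close> by
  a chosen cocone over it, so that zero, successors and limits need no distinction.
\<close>

lemma (in category) chain_exists:
  fixes r :: "'u rel" and Good :: "'u \<Rightarrow> ('u \<Rightarrow> 'o) \<Rightarrow> ('u \<Rightarrow> 'u \<Rightarrow> 'a) \<Rightarrow> bool"
  assumes wo: "Well_order r"
    and cong: "\<And>j D t D' t'. j \<in> Field r \<Longrightarrow> \<forall>i\<in>under r j. D i = D' i \<Longrightarrow>
      \<forall>i k. (i, k) \<in> r \<longrightarrow> (k, j) \<in> r \<longrightarrow> t i k = t' i k \<Longrightarrow> Good j D t \<Longrightarrow> Good j D' t'"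
    and step: "\<And>j D t. j \<in> Field r \<Longrightarrow> diagram C (Restr r (underS r j)) D t \<Longrightarrow>
      \<forall>i\<in>underS r j. Good i D t \<Longrightarrow>
      \<exists>X k. cocone C (Restr r (underS r j)) D t X k \<and>
        Good j (D(j := X)) (\<lambda>i i'. if i' = j then if i = j then Ident C X else k i else t i i')"
  shows "\<exists>D t. diagram C r D t \<and> (\<forall>j\<in>Field r. Good j D t)"
proof -
  interpret wo_rel r using wo by unfold_locales
  have po: "Partial_order r" and refl: "Refl r" and lin: "Linear_order r"
    using wo by (auto simp: order_on_defs)
  have tr: "(i, k) \<in> r" if "(i, j) \<in> r" "(j, k) \<in> r" for i j k using TRANS that by (meson transD)
  have asym: "i = j" if "(i, j) \<in> r" "(j, i) \<in> r" for i j using ANTISYM that by (meson antisymD)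
  \<comment> \<open>\<open>T j\<close> holds the object at \<open>j\<close> together with the arrows
    into it. Cutting both off below \<open>j\<close> makes the recursion operator \<open>H\<close>
    admissible.\<close>
  define Dres :: "('u \<Rightarrow> 'o \<times> ('u \<Rightarrow> 'a)) \<Rightarrow> 'u \<Rightarrow> 'u \<Rightarrow> 'o"
    where "Dres T j i = (if i \<in> underS j then fst (T i) else undefined)" for T j i
  define tres :: "('u \<Rightarrow> 'o \<times> ('u \<Rightarrow> 'a)) \<Rightarrow> 'u \<Rightarrow> 'u \<Rightarrow> 'u \<Rightarrow> 'a"
    where "tres T j i i' = (if i' \<in> underS j then snd (T i') i else undefined)" for T j i i'
  define ok where "ok D t j Xk \<longleftrightarrow> cocone C (Restr r (underS j)) D t (fst Xk) (snd Xk) \<and>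
     Good j (D(j := fst Xk))
       (\<lambda>i i'. if i' = j then if i = j then Ident C (fst Xk) else snd Xk i else t i i')"
    for D and t :: "'u \<Rightarrow> 'u \<Rightarrow> 'a" and j and Xk :: "'o \<times> ('u \<Rightarrow> 'a)"
  define H where "H T j = (let Xk = SOME Xk. ok (Dres T j) (tres T j) j Xk in
     (fst Xk, \<lambda>i. if i = j then Ident C (fst Xk) else snd Xk i))" for T j
  have "adm_wo H"
    unfolding adm_wo_def
  proof (intro allI impI)
    fix f g x assume "\<forall>y\<in>underS x. (f y :: 'o \<times> ('u \<Rightarrow> 'a)) = g y"
    then have "Dres f x = Dres g x" "tres f x = tres g x"
      unfolding Dres_def tres_def by (auto simp: fun_eq_iff)
    then show "H f x = H g x" unfolding H_def by simp
  qed
  then have fixp: "worec H = H (worec H)" by (rule worec_fixpoint)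
  define T where "T = worec H"
  have T: "T j = H T j" for j using fixp unfolding T_def by metis
  define D where "D i = fst (T i)" for i
  define t where "t i i' = snd (T i') i" for i i'
  have uS: "i \<in> underS j \<longleftrightarrow> (i, j) \<in> r \<and> i \<noteq> j" for i j by (auto simp: Order_Relation.underS_def)
  have un: "i \<in> under j \<longleftrightarrow> (i, j) \<in> r" for i j by (auto simp: Order_Relation.under_def)
  have F: "i \<in> Field r" "j \<in> Field r" if "(i, j) \<in> r" for i j using that by (auto simp: Field_def)
  have FuS: "Field (Restr r (underS j)) = underS j" for j
    by (rule Field_Restr_sub[OF refl]) (use F uS in blast)
  \<comment> \<open>Both conjuncts go through one induction, since \<open>step\<close> applies at
    \<open>j\<close> only when the diagram and all \<open>Good i\<close> are available below
    \<open>j\<close>.\<close>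
  have Q: "j \<in> Field r \<longrightarrow> diagram C (Restr r (under j)) D t \<and> Good j D t" for j
  proof (induction j rule: well_order_induct)
    case (1 j)
    show ?case
    proof
      assume j: "j \<in> Field r"
      have IH: "diagram C (Restr r (under i)) D t" "Good i D t" if "i \<in> underS j" for i
        using 1 that uS F by blast+
      have Fun: "Field (Restr r (under i)) = under i" for i
        by (rule Field_Restr_sub[OF refl]) (use F un in blast)
      have ii: "(i, i) \<in> r" if "i \<in> Field r" for i using refl that by (simp add: refl_onD)
      have d1: "D i \<in> Obj C" "t i i = Ident C (D i)" if "i \<in> underS j" for i
      proof -
        have "i \<in> Field (Restr r (under i))" using Fun un ii that uS F by blast
        then show "D i \<in> Obj C" "t i i = Ident C (D i)"
          using diagramD(2,3)[OF IH(1)[OF that]] by auto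
      qed
      have d2: "t i k \<in> hom C (D i) (D k)" if "(i, k) \<in> r" "k \<in> underS j" for i k
        using IH(1)[OF that(2)] that ii F un unfolding diagram_def by blast
      have d3: "t k l \<cdot> t i k = t i l" if "(i, k) \<in> r" "(k, l) \<in> r" "l \<in> underS j" for i k l
      proof -
        have "i \<in> under l" "k \<in> under l" "l \<in> under l"
          using tr[OF that(1,2)] that(2) ii F[OF that(2)] un by auto
        then have "(i, k) \<in> Restr r (under l)" "(k, l) \<in> Restr r (under l)"
          using that(1,2) by auto
        then show ?thesis using diagramD(7)[OF IH(1)[OF that(3)]] by blast
      qed
      have dj: "diagram C (Restr r (underS j)) D t"
        by (rule diagram_RestrI[OF po]) (use d1 d2 d3 uS F in auto)
      have tin: "(i, k) \<in> r \<Longrightarrow> k \<in> underS j \<Longrightarrow> i \<in> underS j" for i k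
        using uS tr asym by metis
      have eqs: "\<And>i. i \<in> underS j \<Longrightarrow> D i = Dres T j i" "\<And>i k. k \<in> underS j \<Longrightarrow> t i k = tres T j i k"
        unfolding D_def t_def Dres_def tres_def by auto
      \<comment> \<open>The choice inside \<open>H\<close> refers to the truncated data, so the
        hypotheses of \<open>step\<close> are first moved to them and its conclusions afterwards
        moved back to \<open>D\<close> and \<open>t\<close>.\<close>
      have dj': "diagram C (Restr r (underS j)) (Dres T j) (tres T j)"
        by (rule diagram_cong[OF dj]) (use eqs FuS in auto)
      have "Good i (Dres T j) (tres T j)" if "i \<in> underS j" for i
      proof (rule cong[OF _ _ _ IH(2)[OF that]])
        show "i \<in> Field r" using that uS F by blast
        show "\<forall>k\<in>under i. D k = Dres T j k" using tin[OF _ that] eqs un by blast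
        show "\<forall>k l. (k, l) \<in> r \<longrightarrow> (l, i) \<in> r \<longrightarrow> t k l = tres T j k l" using tin[OF _ that] eqs by blast
      qed
      then obtain X k where "cocone C (Restr r (underS j)) (Dres T j) (tres T j) X k"
        "Good j ((Dres T j)(j := X)) (\<lambda>i i'. if i' = j then if i = j then Ident C X else k i else tres T j i i')"
        using step[OF j dj'] by blast
      then have "ok (Dres T j) (tres T j) j (X, k)" unfolding ok_def fst_conv snd_conv by blast
      then have ok: "ok (Dres T j) (tres T j) j (SOME Xk. ok (Dres T j) (tres T j) j Xk)" by (rule someI)
      define Xk where "Xk = (SOME Xk. ok (Dres T j) (tres T j) j Xk)"
      have ok': "ok (Dres T j) (tres T j) j Xk" using ok unfolding Xk_def .
      have Tj: "D j = fst Xk" "\<And>i. t i j = (if i = j then Ident C (fst Xk) else snd Xk i)"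
        using T[of j] unfolding D_def t_def H_def Xk_def by (simp_all add: Let_def)
      have ok1: "cocone C (Restr r (underS j)) (Dres T j) (tres T j) (fst Xk) (snd Xk)"
        and ok2: "Good j ((Dres T j)(j := fst Xk))
          (\<lambda>i i'. if i' = j then if i = j then Ident C (fst Xk) else snd Xk i else tres T j i i')"
        using ok' unfolding ok_def by blast+
      have coc: "cocone C (Restr r (underS j)) D t (fst Xk) (snd Xk)"
        by (rule cocone_cong[OF ok1]) (use eqs FuS in auto)
      have "Good j D t"
      proof (rule cong[OF j _ _ ok2])
        show "\<forall>i\<in>under j. ((Dres T j)(j := fst Xk)) i = D i" using eqs(1) Tj un uS by auto
        show "\<forall>i k. (i, k) \<in> r \<longrightarrow> (k, j) \<in> r \<longrightarrow> (if k = j then if i = j then Ident C (fst Xk)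
           else snd Xk i else tres T j i k) = t i k"
          using eqs(2) Tj uS by auto
      qed
      moreover have "diagram C (Restr r (under j)) D t"
      proof (rule diagram_RestrI[OF po])
        show "under j \<subseteq> Field r" using un F by blast
        show "D i \<in> Obj C" "t i i = Ident C (D i)" if "i \<in> under j" for i
        proof -
          show "D i \<in> Obj C" using that d1 Tj coconeD(1)[OF coc] uS un by (cases "i = j") auto
          show "t i i = Ident C (D i)" using that d1 Tj uS un by (cases "i = j") auto
        qed
        show "t i k \<in> hom C (D i) (D k)" if "i \<in> under j" "k \<in> under j" "(i, k) \<in> r" for i k
        proof (cases "k = j")
          case True
          then show ?thesis
          proof (cases "i = j")
            case True
            then show ?thesis using \<open>k = j\<close> Tj coconeD(1)[OF coc] Ident_hom by simp
          next
            case False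
            then have "i \<in> underS j" using that uS un by auto
            then show ?thesis using True False Tj coc FuS unfolding cocone_def by simp
          qed
        next
          case False
          then show ?thesis using that d2 uS un by auto
        qed
        show "t k l \<cdot> t i k = t i l" if "i \<in> under j" "k \<in> under j" "l \<in> under j" "(i, k) \<in> r" "(k, l) \<in> r" for i k l
        proof (cases "l = j")
          case True
          have tij: "t i j \<in> hom C (D i) (D j)" if "i \<in> under j" for i
          proof (cases "i = j")
            case True
            then show ?thesis using Tj coconeD(1)[OF coc] Ident_hom by simp
          next
            case False
            then have "i \<in> underS j" using that uS un by auto
            then show ?thesis using False Tj coc FuS unfolding cocone_def by simp
          qed
          show ?thesis
          proof (cases "k = j")
            case kj: True
            have "i \<in> under j" using that by auto
            from tij[OF this] show ?thesis using True kj Tj by (simp add: hom_def)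
          next
            case False
            then have "k \<in> underS j" "i \<in> underS j" using that uS un tin by auto
            moreover from this have "i \<noteq> j" "k \<noteq> j" using uS by auto
            ultimately show ?thesis using True that Tj coconeD(5)[OF coc, of i k] by simp
          qed
        next
          case False
          then show ?thesis using that d3 uS un by auto
        qed
      qed
      ultimately show "diagram C (Restr r (under j)) D t \<and> Good j D t" by blast
    qed
  qed
  have "diagram C r D t"
    unfolding diagram_def
  proof (intro conjI allI impI ballI)
    have Fun: "Field (Restr r (under i)) = under i" for i
      by (rule Field_Restr_sub[OF refl]) (use F un in blast)
    have ii: "(i, i) \<in> r" if "i \<in> Field r" for i using refl that by (simp add: refl_onD)
    show "Partial_order r" by fact
    show "D i \<in> Obj C" "t i i = Ident C (D i)" if "i \<in> Field r" for i
    proof -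
      have a: "i \<in> Field (Restr r (under i))" using Fun un ii that by blast
      have b: "diagram C (Restr r (under i)) D t" using Q that by blast
      show "D i \<in> Obj C" "t i i = Ident C (D i)" using diagramD(2)[OF b a] diagramD(3)[OF b a] .
    qed
    show "t i j \<in> hom C (D i) (D j)" if "(i, j) \<in> r" for i j
      using Q[of j] that F un ii unfolding diagram_def by blast
    show "t j k \<cdot> t i j = t i k" if "(i, j) \<in> r" "(j, k) \<in> r" for i j k
    proof -
      have "i \<in> under k" "j \<in> under k" "k \<in> under k"
        using tr[OF that] that(2) ii F[OF that(2)] un by auto
      then have a: "(i, j) \<in> Restr r (under k)" "(j, k) \<in> Restr r (under k)"
        using that by auto
      have b: "diagram C (Restr r (under k)) D t" using Q that F by blast
      show ?thesis by (rule diagramD(7)[OF b a])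
    qed
  qed
  then show ?thesis using Q by blast
qed

text \<open>A form of the recursion with separate cases: \<open>P\<close> is an invariant of the
  arrows into a stage, \<open>S\<close> a demand on the arrow from a stage to its successor (it also
  sees the arrow from stage zero), \<open>L\<close> a demand on the cocones at limits. The
  congruence assumptions make them depend only on what has been built so far.\<close>

lemma (in category) chain_exists_cases:
  fixes r :: "'u rel"
    and P :: "'u \<Rightarrow> ('u \<Rightarrow> 'a) \<Rightarrow> bool"
    and S :: "'u \<Rightarrow> 'a \<Rightarrow> 'a \<Rightarrow> bool"
    and L :: "'u \<Rightarrow> ('u \<Rightarrow> 'o) \<Rightarrow> ('u \<Rightarrow> 'u \<Rightarrow> 'a) \<Rightarrow> 'o \<Rightarrow> ('u \<Rightarrow> 'a) \<Rightarrow> bool"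
  assumes r: "Cinfinite r"
    and X0: "X0 \<in> Obj C"
    and P_cong: "\<And>j T T'. \<forall>i\<in>under r j. T i = T' i \<Longrightarrow> P j T \<Longrightarrow> P j T'"
    and L_cong: "\<And>l D t X k D' t' k'. olimit r l \<Longrightarrow> \<forall>i\<in>underS r l. D i = D' i \<and> k i = k' i \<Longrightarrow>
      \<forall>i j. (i, j) \<in> r \<longrightarrow> j \<in> underS r l \<longrightarrow> t i j = t' i j \<Longrightarrow> L l D t X k \<Longrightarrow> L l D' t' X k'"
    and zero: "P (ozero r) (\<lambda>i. Ident C X0)"
    and succ: "\<And>p D t. p \<in> Field r \<Longrightarrow> diagram C (Restr r (under r p)) D t \<Longrightarrow> D (ozero r) = X0 \<Longrightarrow>
      P p (\<lambda>i. t i p) \<Longrightarrow>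
      \<exists>f. f \<in> Arr C \<and> Dom C f = D p \<and> S p (t (ozero r) p) f \<and>
        P (osuc r p) (\<lambda>i. if i = osuc r p then Ident C (Cod C f) else f \<cdot> t i p)"
    and lim: "\<And>l D t. olimit r l \<Longrightarrow> diagram C (Restr r (underS r l)) D t \<Longrightarrow> D (ozero r) = X0 \<Longrightarrow>
      \<forall>j\<in>underS r l. P j (\<lambda>i. t i j) \<Longrightarrow>
      \<exists>X k. cocone C (Restr r (underS r l)) D t X k \<and> L l D t X k \<and>
        P l (\<lambda>i. if i = l then Ident C X else k i)"
  shows "\<exists>D t. diagram C r D t \<and> D (ozero r) = X0 \<and> (\<forall>j\<in>Field r. P j (\<lambda>i. t i j)) \<and>
    (\<forall>p\<in>Field r. S p (t (ozero r) p) (t p (osuc r p))) \<and>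
    (\<forall>l. olimit r l \<longrightarrow> L l D t (D l) (\<lambda>i. t i l))"
proof -
  have wo: "Well_order r" using r by (simp add: card_order_on_def)
  then interpret wo_rel r by unfold_locales
  have po: "Partial_order r" and refl: "Refl r" using wo by (auto simp: order_on_defs)
  have tr: "(i, k) \<in> r" if "(i, j) \<in> r" "(j, k) \<in> r" for i j k using TRANS that by (meson transD)
  have asym: "i = j" if "(i, j) \<in> r" "(j, i) \<in> r" for i j using ANTISYM that by (meson antisymD)
  have uS: "i \<in> underS j \<longleftrightarrow> (i, j) \<in> r \<and> i \<noteq> j" for i j by (auto simp: Order_Relation.underS_def)
  have un: "i \<in> under j \<longleftrightarrow> (i, j) \<in> r" for i j by (auto simp: Order_Relation.under_def)
  have F: "i \<in> Field r" "j \<in> Field r" if "(i, j) \<in> r" for i j using that by (auto simp: Field_def)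
  have ne: "Field r \<noteq> {}" using r by (auto simp: cinfinite_def)
  note z = ozero_in[OF ne]
  note sc = osuc_in[OF _ Cinfinite_no_max[OF r]]
  have inj: "p = q" if "p \<in> Field r" "q \<in> Field r" "osuc r p = osuc r q" for p q
    using sc(2,3,5)[OF that(1)] sc(2,3,5)[OF that(2)] that(3) asym by metis
  have snz: "osuc r p \<noteq> ozero r" if "p \<in> Field r" for p using sc(2,3)[OF that] z(2)[OF that] asym by metis
  have nlim: "\<not> olimit r (osuc r p)" if "p \<in> Field r" for p
    using sc(2,3)[OF that] uS unfolding olimit_def by auto
  \<comment> \<open>The clauses for zero, successors and limits exclude one another by
    \<open>snz\<close>, \<open>nlim\<close> and the definition of \<open>olimit\<close>;
    \<open>inj\<close> makes the predecessor unique.\<close>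
  define Good where "Good j D t \<longleftrightarrow> (j = ozero r \<longrightarrow> D j = X0) \<and> P j (\<lambda>i. t i j) \<and>
    (\<forall>p\<in>Field r. j = osuc r p \<longrightarrow> S p (t (ozero r) p) (t p j)) \<and>
    (olimit r j \<longrightarrow> L j D t (D j) (\<lambda>i. t i j))" for j D t
  have "\<exists>D t. diagram C r D t \<and> (\<forall>j\<in>Field r. Good j D t)"
  proof (rule chain_exists[OF wo])
    fix j D t D' t'
    assume j: "j \<in> Field r" and D: "\<forall>i\<in>under j. D i = D' i"
      and t: "\<forall>i k. (i, k) \<in> r \<longrightarrow> (k, j) \<in> r \<longrightarrow> (t i k :: 'a) = t' i k" and G: "Good j D t"
    have jj: "(j, j) \<in> r" using j refl by (simp add: refl_onD)
    show "Good j D' t'"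
      unfolding Good_def
    proof (intro conjI impI ballI)
      show "j = ozero r \<Longrightarrow> D' j = X0" using G D jj un unfolding Good_def by auto
      have "P j (\<lambda>i. t i j)" using G by (simp add: Good_def)
      then show "P j (\<lambda>i. t' i j)"
        by (rule P_cong[rotated]) (use t jj un in auto)
      show "S p (t' (ozero r) p) (t' p j)" if p: "p \<in> Field r" "j = osuc r p" for p
      proof -
        have "t' (ozero r) p = t (ozero r) p" "t' p j = t p j"
          using t z(2)[OF p(1)] sc(2)[OF p(1)] p(2) jj by auto
        then show ?thesis using G p unfolding Good_def by simp
      qed
      assume l: "olimit r j"
      have "L j D t (D j) (\<lambda>i. t i j)" using G l by (simp add: Good_def)
      then have "L j D' t' (D j) (\<lambda>i. t' i j)"
        by (rule L_cong[OF l, rotated 2]) (use D t jj un uS in auto)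
      then show "L j D' t' (D' j) (\<lambda>i. t' i j)" using D jj un by auto
    qed
  next
    fix j D t
    assume j: "j \<in> Field r" and d: "diagram C (Restr r (underS j)) D t"
      and G: "\<forall>i\<in>underS j. Good i D t"
    have FuS: "Field (Restr r (underS j)) = underS j"
      by (rule Field_Restr_sub[OF refl]) (use F uS in blast)
    from j consider "j = ozero r" | p where "p \<in> underS j" "j = osuc r p" | "olimit r j"
      using cases_zero_suc_limit by blast
    then show "\<exists>X k. cocone C (Restr r (underS j)) D t X k \<and>
        Good j (D(j := X)) (\<lambda>i i'. if i' = j then if i = j then Ident C X else k i else t i i')"
    proof cases
      case 1
      have e: "underS j = {}" using 1 z(2) F asym uS by blast
      have "under j = {j}" using 1 z(2) F asym un j refl refl_onD by fastforce
      then have "P j (\<lambda>i. if i = j then Ident C X0 else undefined)"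
        using zero 1 P_cong[of j "\<lambda>i. Ident C X0"] by simp
      moreover have "\<not> olimit r j" using 1 by (simp add: olimit_def)
      moreover have "\<forall>p\<in>Field r. j \<noteq> osuc r p" using 1 snz by metis
      ultimately have "Good j (D(j := X0)) (\<lambda>i i'. if i' = j then if i = j then Ident C X0 else undefined else t i i')"
        using 1 unfolding Good_def by simp
      \<comment> \<open>A cocone over the empty diagram is just an object, hence the arbitrary
        family of arrows.\<close>
      moreover have "cocone C (Restr r (underS j)) D t X0 (\<lambda>_. undefined)"
        using e X0 by (auto simp: cocone_def)
      ultimately show ?thesis by blast
    next
      case 2
      have p: "p \<in> Field r" using 2 uS F by blast
      have us: "underS j = under p"
      proof (intro set_eqI iffI)
        show "i \<in> under p" if "i \<in> underS j" for i
          using sc(5)[OF p, of i] that 2(2) uS un by auto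
        show "i \<in> underS j" if "i \<in> under p" for i
          using sc(2,3)[OF p] tr[of i p] asym[of p i] that 2(2) uS un by auto
      qed
      have z0: "D (ozero r) = X0"
        using G z(1) z(2)[OF p] us un unfolding Good_def by auto
      have "P p (\<lambda>i. t i p)" using G 2 unfolding Good_def by auto
      with succ[OF p, of D t] z0 d us obtain f where f: "f \<in> Arr C" "Dom C f = D p" "S p (t (ozero r) p) f"
        "P (osuc r p) (\<lambda>i. if i = osuc r p then Ident C (Cod C f) else f \<cdot> t i p)" by auto
      have pp: "(p, p) \<in> r" using p refl by (simp add: refl_onD)
      \<comment> \<open>\<open>p\<close> is the greatest index below \<open>j\<close>, so any arrow
        out of \<open>D p\<close> extends to a cocone by composition.\<close>
      have coc: "cocone C (Restr r (underS j)) D t (Cod C f) (\<lambda>i. f \<cdot> t i p)"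
        unfolding cocone_def FuS
      proof (intro conjI allI impI ballI)
        show "Cod C f \<in> Obj C" using f by simp
        show "f \<cdot> t i p \<in> hom C (D i) (Cod C f)" if "i \<in> underS j" for i
        proof -
          have "(i, p) \<in> Restr r (underS j)" using that us un pp by auto
          then show ?thesis using diagramD(4-6)[OF d] f by (auto simp: hom_def)
        qed
        show "(f \<cdot> t i' p) \<cdot> t i i' = f \<cdot> t i p" if "(i, i') \<in> Restr r (underS j)" for i i'
        proof -
          have "(i', p) \<in> Restr r (underS j)" using that us un pp by auto
          then show ?thesis using diagramD(4-7)[OF d] f that by simp
        qed
      qed
      have tpp: "f \<cdot> t p p = f" using diagramD(3)[OF d, of p] f 2 FuS by simp
      have "Good j (D(j := Cod C f))
        (\<lambda>i i'. if i' = j then if i = j then Ident C (Cod C f) else f \<cdot> t i p else t i i')"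
        unfolding Good_def
      proof (intro conjI impI ballI)
        show "j = ozero r \<Longrightarrow> (D(j := Cod C f)) j = X0" using snz[OF p] 2 by simp
        show "P j (\<lambda>i. if j = j then if i = j then Ident C (Cod C f) else f \<cdot> t i p else t i j)"
          using f(4) 2 by simp
        fix q assume q: "q \<in> Field r" "j = osuc r q"
        then have "q = p" using inj p 2 by blast
        moreover have "p \<noteq> j" using 2 uS by auto
        ultimately show "S q (if q = j then if ozero r = j then Ident C (Cod C f) else f \<cdot> t (ozero r) p else t (ozero r) q)
          (if j = j then if q = j then Ident C (Cod C f) else f \<cdot> t q p else t q j)"
          using f(3) tpp by simp
      next
        assume "olimit r j"
        then show "L j (D(j := Cod C f))
          (\<lambda>i i'. if i' = j then if i = j then Ident C (Cod C f) else f \<cdot> t i p else t i i')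
          ((D(j := Cod C f)) j)
          (\<lambda>i. if j = j then if i = j then Ident C (Cod C f) else f \<cdot> t i p else t i j)"
          using nlim[OF p] 2 by simp
      qed
      then show ?thesis using coc by blast
    next
      case 3
      have "ozero r \<in> underS j" using 3 z(2)[OF j] uS unfolding olimit_def by auto
      then have z0: "D (ozero r) = X0" using G unfolding Good_def by auto
      have "\<forall>i\<in>underS j. P i (\<lambda>i'. t i' i)" using G unfolding Good_def by auto
      with lim[OF 3 d] z0 obtain X k where Xk: "cocone C (Restr r (underS j)) D t X k" "L j D t X k"
        "P j (\<lambda>i. if i = j then Ident C X else k i)" by blast
      let ?t = "\<lambda>i i'. if i' = j then if i = j then Ident C X else k i else t i i'"
      have "L j (D(j := X)) ?t ((D(j := X)) j) (\<lambda>i. ?t i j)"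
        using L_cong[OF 3 _ _ Xk(2), of "D(j := X)" "\<lambda>i. ?t i j" ?t] uS by auto
      moreover have "j \<noteq> ozero r" using 3 by (simp add: olimit_def)
      moreover have "\<forall>p\<in>Field r. j \<noteq> osuc r p" using nlim 3 by metis
      ultimately have "Good j (D(j := X)) ?t" using Xk(3) unfolding Good_def by simp
      then show ?thesis using Xk(1) by blast
    qed
  qed
  then obtain D t where "diagram C r D t" and G: "\<forall>j\<in>Field r. Good j D t" by blast
  moreover have "D (ozero r) = X0" using G z(1) by (simp add: Good_def)
  moreover have "L l D t (D l) (\<lambda>i. t i l)" if "olimit r l" for l
    using G that unfolding Good_def olimit_def by blast
  moreover have "S p (t (ozero r) p) (t p (osuc r p))" if "p \<in> Field r" for p
    using G that sc(1) unfolding Good_def by blast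
  moreover have "P j (\<lambda>i. t i j)" if "j \<in> Field r" for j
    using G that unfolding Good_def by blast
  ultimately show ?thesis by blast
qed

section \<open>Galois types and Lascar types\<close>

lemma models_simps [simp]:
  "Obj (models K) = Mod K" "Dom (models K) = Dom K" "Cod (models K) = Cod K"
  "Ident (models K) = Ident K" "Comp (models K) = Comp K"
  "Arr (models K) = {f \<in> Arr K. Dom K f \<in> Mod K \<and> Cod K f \<in> Mod K}"
  by (simp_all add: models_def)

lemma models_cocone:
  assumes "Mod K \<subseteq> Obj K" "\<forall>i\<in>Field r. D i \<in> Mod K"
  shows "cocone (models K) r D t X k \<longleftrightarrow> cocone K r D t X k \<and> X \<in> Mod K"
  using assms unfolding cocone_def by (auto simp: hom_def)

lemma presentable_Obj: "presentable U \<nu> C X \<Longrightarrow> X \<in> Obj C"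
  by (simp add: presentable_def)

locale amalgamation = AECat K for K :: "('o, 'a, 'u) aecat" (structure) +
  assumes inaccessible_Univ: "inaccessible (Univ K)"
    and amalgamation: "amalgamation_property K"

sublocale amalgamation \<subseteq> mono_accessible "Univ K" K
proof unfold_locales
  interpret category K using accessible_C by (simp add: accessible_def)
  show "f \<in> Arr K \<Longrightarrow> Dom K f \<in> Obj K" "f \<in> Arr K \<Longrightarrow> Cod K f \<in> Obj K" for f by simp_all
  show "X \<in> Obj K \<Longrightarrow> Ident K X \<in> hom K X X" for X by (rule Ident_hom)
  show "f \<in> hom K X Y \<Longrightarrow> g \<in> hom K Y Z \<Longrightarrow> g \<cdot> f \<in> hom K X Z" for X Y Z f g by (rule Comp_hom)
  show "f \<in> hom K X Y \<Longrightarrow> f \<cdot> Ident K X = f" "f \<in> hom K X Y \<Longrightarrow> Ident K Y \<cdot> f = f" for X Y f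
    by (rule Comp_Ident Ident_Comp, assumption)+
  show "f \<in> hom K W X \<Longrightarrow> g \<in> hom K X Y \<Longrightarrow> h \<in> hom K Y Z \<Longrightarrow> (h \<cdot> g) \<cdot> f = h \<cdot> (g \<cdot> f)" for W X Y Z f g h
    by (rule Comp_assoc)
qed (use accessible_C inaccessible_Univ all_mono in auto)

text \<open>Arrows monic in \<open>K\<close> stay monic in the full subcategory of models, so all
  facts on presentability and diagrams are available twice, for \<open>K\<close> and for the
  models.\<close>

sublocale amalgamation \<subseteq> M: mono_accessible "Univ K" "models K"
proof (rule mono_accessible.intro)
  show "universe (Univ K)" using inaccessible_Univ by (rule universe.intro)
  show "category (models K)" using accessible_M by (simp add: accessible_def)
  show "mono_accessible_axioms (Univ K) (models K)"
  proof
    show "mono_arrow (models K) f" if "f \<in> Arr (models K)" for f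
    proof -
      have "mono_arrow K f" using that by (simp add: all_mono)
      then show ?thesis using that unfolding mono_arrow_def hom_def by auto
    qed
  qed (rule accessible_M)
qed

section \<open>Calculus of extensions, Galois types and Lascar types\<close>

context amalgamation
begin

lemma Mod_Obj [simp]: "M \<in> Mod K \<Longrightarrow> M \<in> Obj K"
  using Mod_subset by blast

lemma extension_iff:
  "extension K M f N \<longleftrightarrow> M \<in> Mod K \<and> N \<in> Mod K \<and> f \<in> Arr K \<and> Dom K f = M \<and> Cod K f = N"
  by (auto simp: extension_def hom_def)

lemma extensionD:
  assumes "extension K M f N"
  shows "M \<in> Mod K" "N \<in> Mod K" "f \<in> Arr K" "Dom K f = M" "Cod K f = N"
  using assms by (auto simp: extension_def hom_def)

lemma extensionI:
  "f \<in> Arr K \<Longrightarrow> Dom K f = M \<Longrightarrow> Cod K f = N \<Longrightarrow> M \<in> Mod K \<Longrightarrow> N \<in> Mod K \<Longrightarrow> extension K M f N"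
  by (auto simp: extension_def hom_def)

lemma extension_Ident: "M \<in> Mod K \<Longrightarrow> extension K M (Ident K M) M"
  by (simp add: extensionI)

lemma extension_Comp: "extension K M f N \<Longrightarrow> extension K N g P \<Longrightarrow> extension K M (g \<cdot> f) P"
  by (simp add: extension_iff)

lemma into_ext: "into K a M \<Longrightarrow> extension K M f N \<Longrightarrow> into K (f \<cdot> a) N"
  by (auto simp: into_def extension_iff)

lemma extension_into: "extension K M f N \<Longrightarrow> into K f N"
  by (auto simp: into_def extension_iff)

lemma amalgamate:
  assumes "extension K M f1 N1" "extension K M f2 N2"
  obtains N g1 g2 where "extension K N1 g1 N" "extension K N2 g2 N" "g1 \<cdot> f1 = g2 \<cdot> f2"
  using assms amalgamation unfolding amalgamation_property_def by metis

lemma sub_le_into: "sub_le K a b \<Longrightarrow> into K b M \<Longrightarrow> into K a M"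
  using sub_le_Cod unfolding into_def by metis

text \<open>Equal images in \<open>N\<close> already force equal domains, so the definition
  collapses to a pointwise relation, which composes well.\<close>

lemma gtp_iff:
  "gtp_eq K as M as' M' \<longleftrightarrow> (\<exists>N f f'. extension K M f N \<and> extension K M' f' N \<and>
     list_all2 (\<lambda>a a'. into K a M \<and> into K a' M' \<and> f \<cdot> a = f' \<cdot> a') as as')"
    (is "?l \<longleftrightarrow> ?r")
proof
  assume ?l
  then obtain N f f' where N: "extension K M f N" "extension K M' f' N"
    and e: "map (\<lambda>a. f \<cdot> a) as = map (\<lambda>a. f' \<cdot> a) as'"
    and i: "\<forall>a \<in> set as. into K a M" "\<forall>a \<in> set as'. into K a M'"
    unfolding gtp_eq_def by blast
  have "length as = length as'" using e map_eq_imp_length_eq by blast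
  then have "list_all2 (\<lambda>a a'. into K a M \<and> into K a' M' \<and> f \<cdot> a = f' \<cdot> a') as as'"
    using e i by (auto simp: list_all2_conv_all_nth list_eq_iff_nth_eq)
  then show ?r using N by blast
next
  assume ?r
  then obtain N f f' where N: "extension K M f N" "extension K M' f' N"
    and l: "list_all2 (\<lambda>a a'. into K a M \<and> into K a' M' \<and> f \<cdot> a = f' \<cdot> a') as as'" by blast
  have "Dom K a = Dom K a'" if "into K a M" "into K a' M'" "f \<cdot> a = f' \<cdot> a'" for a a'
    using that extensionD[OF N(1)] extensionD[OF N(2)] Comp_simps(2)[of a f] Comp_simps(2)[of a' f']
    by (simp add: into_def)
  then have "list_all2 (\<lambda>a a'. into K a M \<and> into K a' M' \<and> f \<cdot> a = f' \<cdot> a' \<and> Dom K a = Dom K a') as as'"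
    using l by (auto elim!: list_all2_mono)
  then have "map (Dom K) as = map (Dom K) as' \<and> map (\<lambda>a. f \<cdot> a) as = map (\<lambda>a. f' \<cdot> a) as' \<and>
    (\<forall>a \<in> set as. into K a M) \<and> (\<forall>a \<in> set as'. into K a M')"
    by (induction as as' rule: list_all2_induct) auto
  then show ?l using N unfolding gtp_eq_def by blast
qed

lemma gtp_sym: "gtp_eq K as M as' M' \<Longrightarrow> gtp_eq K as' M' as M"
  unfolding gtp_eq_def by metis

lemma gtp_into:
  assumes "gtp_eq K as M as' M'"
  shows "a \<in> set as \<Longrightarrow> into K a M" "a \<in> set as' \<Longrightarrow> into K a M'"
  using assms unfolding gtp_eq_def by auto

text \<open>The two witnessing models are amalgamated over the middle model
  \<open>M'\<close>.\<close>

lemma gtp_trans: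
  assumes "gtp_eq K as M as' M'" "gtp_eq K as' M' as'' M''"
  shows "gtp_eq K as M as'' M''"
proof -
  obtain N f f' where N: "extension K M f N" "extension K M' f' N"
    and l: "list_all2 (\<lambda>a a'. into K a M \<and> into K a' M' \<and> f \<cdot> a = f' \<cdot> a') as as'"
    using assms(1) gtp_iff by blast
  obtain P g g' where P: "extension K M' g P" "extension K M'' g' P"
    and m: "list_all2 (\<lambda>a a'. into K a M' \<and> into K a' M'' \<and> g \<cdot> a = g' \<cdot> a') as' as''"
    using assms(2) gtp_iff by blast
  obtain W x y where W: "extension K N x W" "extension K P y W" "x \<cdot> f' = y \<cdot> g"
    using amalgamate N(2) P(1) by blast
  have "list_all2 (\<lambda>a a'. into K a M \<and> into K a' M'' \<and> (x \<cdot> f) \<cdot> a = (y \<cdot> g') \<cdot> a') as as''"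
    using l m
  proof (rule list_all2_trans[rotated])
    fix a b c
    assume a: "into K a M \<and> into K b M' \<and> f \<cdot> a = f' \<cdot> b" "into K b M' \<and> into K c M'' \<and> g \<cdot> b = g' \<cdot> c"
    have "x \<cdot> (f' \<cdot> b) = y \<cdot> (g \<cdot> b)"
      by (rule reassoc[OF W(3)]) (use a N P W in \<open>auto simp: extension_iff into_def\<close>)
    then show "into K a M \<and> into K c M'' \<and> (x \<cdot> f) \<cdot> a = (y \<cdot> g') \<cdot> c"
      using a extensionD[OF N(1)] extensionD[OF P(2)] extensionD[OF W(1)] extensionD[OF W(2)]
      by (simp add: into_def)
  qed
  then show ?thesis
    using extension_Comp[OF N(1) W(1)] extension_Comp[OF P(2) W(2)] gtp_iff by blast
qed

text \<open>Witnessed by the identity of \<open>N\<close> and by \<open>f\<close>. This is what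
  allows types to be moved freely between a model and its extensions.\<close>

lemma gtp_ext:
  assumes "extension K M f N" "\<forall>a\<in>set as. into K a M"
  shows "gtp_eq K (map (\<lambda>a. f \<cdot> a) as) N as M"
proof -
  have "N \<in> Mod K" using assms by (auto simp: extension_iff)
  then have "extension K N (Ident K N) N" by (rule extension_Ident)
  moreover have "list_all2 (\<lambda>a a'. into K a N \<and> into K a' M \<and> Ident K N \<cdot> a = f \<cdot> a') (map (\<lambda>a. f \<cdot> a) as) as"
    using assms extensionD[OF assms(1)]
    by (auto simp: list_all2_conv_all_nth into_def)
  ultimately show ?thesis using assms(1) gtp_iff by blast
qed

lemma gtp_refl: "M \<in> Mod K \<Longrightarrow> \<forall>a\<in>set as. into K a M \<Longrightarrow> gtp_eq K as M as M"
proof -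
  assume a: "M \<in> Mod K" "\<forall>a\<in>set as. into K a M"
  have "map (\<lambda>a. Ident K M \<cdot> a) as = as" using a by (auto intro!: map_idI simp: into_def)
  then show ?thesis using gtp_ext[OF extension_Ident[OF a(1)] a(2)] by simp
qed

lemma gtp_ext_iff:
  assumes "extension K M f N" "\<forall>a\<in>set as. into K a M"
  shows "gtp_eq K (map (\<lambda>a. f \<cdot> a) as) N as' M' \<longleftrightarrow> gtp_eq K as M as' M'"
  using gtp_ext[OF assms] gtp_trans gtp_sym by blast

lemma gtp_ext2:
  assumes "extension K M f N" "into K a M" "into K b M"
  shows "gtp_eq K [f \<cdot> a, f \<cdot> b] N as' M' \<longleftrightarrow> gtp_eq K [a, b] M as' M'"
  using gtp_ext_iff[OF assms(1), of "[a, b]"] assms by simp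

lemma gtp_ext3:
  assumes "extension K M f N" "into K a M" "into K b M" "into K c M"
  shows "gtp_eq K [f \<cdot> a, f \<cdot> b, f \<cdot> c] N as' M' \<longleftrightarrow> gtp_eq K [a, b, c] M as' M'"
  using gtp_ext_iff[OF assms(1), of "[a, b, c]"] assms by simp

text \<open>Arrows that identify \<open>b\<close> with \<open>b'\<close> identify everything
  factoring through them in the same way. It serves to adjoin \<open>c\<close> to a type over a
  model through which \<open>c\<close> factors.\<close>

lemma gtp_factor:
  assumes "gtp_eq K [a, b] M [a', b'] M'" "u \<in> Arr K" "Cod K u = Dom K b"
  shows "gtp_eq K [a, b, b \<cdot> u] M [a', b', b' \<cdot> u] M'"
proof -
  obtain N f f' where N: "extension K M f N" "extension K M' f' N"
    and i: "into K a M" "into K b M" "into K a' M'" "into K b' M'" "f \<cdot> a = f' \<cdot> a'" "f \<cdot> b = f' \<cdot> b'"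
    using assms(1) by (auto simp: gtp_iff)
  have D: "Dom K b = Dom K b'" using assms(1) by (simp add: gtp_eq_def)
  have "f \<cdot> (b \<cdot> u) = f' \<cdot> (b' \<cdot> u)"
    by (rule reassoc[OF i(6)]) (use i N D assms in \<open>auto simp: extension_iff into_def\<close>)
  moreover have "into K (b \<cdot> u) M" "into K (b' \<cdot> u) M'" using i assms D by (auto simp: into_def)
  ultimately show ?thesis using N i gtp_iff by auto
qed

lemma gtp_Dom: "gtp_eq K as M as' M' \<Longrightarrow> map (Dom K) as = map (Dom K) as'"
  by (simp add: gtp_eq_def)

text \<open>The extension that witnesses the step is amalgamated with \<open>g\<close>, and the
  model over which the types agree is pushed along.\<close>

lemma Lstep_ext:
  assumes L: "Lstep K [c] M [a] [a']" and g: "extension K M g N"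
  shows "Lstep K [g \<cdot> c] N [g \<cdot> a] [g \<cdot> a']"
proof -
  obtain N1 f M0 m0 where i: "into K a M" "into K a' M" "into K c M"
    and N1: "extension K M f N1" "extension K M0 m0 N1" "sub_le K (f \<cdot> c) m0"
      "gtp_eq K [f \<cdot> a, m0] N1 [f \<cdot> a', m0] N1"
    using L unfolding Lstep_def by auto
  obtain W x y where W: "extension K N1 x W" "extension K N y W" "x \<cdot> f = y \<cdot> g"
    using amalgamate N1(1) g by blast
  have eq: "y \<cdot> (g \<cdot> d) = x \<cdot> (f \<cdot> d)" if "into K d M" for d
    by (rule reassoc[OF W(3)[symmetric]]) (use that g N1 W in \<open>auto simp: extension_iff into_def\<close>)
  have "extension K M0 (x \<cdot> m0) W" using N1(2) W(1) by (rule extension_Comp)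
  moreover have "sub_le K (x \<cdot> (f \<cdot> c)) (x \<cdot> m0)"
    by (rule sub_le_post[OF N1(3)]) (use N1 W in \<open>auto simp: extension_iff\<close>)
  moreover have "gtp_eq K [x \<cdot> (f \<cdot> a), x \<cdot> m0] W [x \<cdot> (f \<cdot> a'), x \<cdot> m0] W"
    using gtp_ext2[OF W(1), of _ m0] N1 gtp_sym i into_ext extension_into
    by (metis (no_types, lifting))
  ultimately have "\<exists>N' f' M0 m0. extension K N f' N' \<and> extension K M0 m0 N' \<and> sub_le K (f' \<cdot> (g \<cdot> c)) m0 \<and>
    gtp_eq K [f' \<cdot> (g \<cdot> a), m0] N' [f' \<cdot> (g \<cdot> a'), m0] N'"
    using W(2) eq i by metis
  then show ?thesis unfolding Lstep_def using i g by (auto intro: into_ext)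
qed

lemma Lgtp_ext:
  assumes L: "Lgtp_eq K [c] M [a] [a']" and g: "extension K M g N"
  shows "Lgtp_eq K [g \<cdot> c] N [g \<cdot> a] [g \<cdot> a']"
proof -
  have "\<exists>z. y = [z] \<and> (Lstep K [g \<cdot> c] N)\<^sup>+\<^sup>+ [g \<cdot> a] [g \<cdot> z]" if "(Lstep K [c] M)\<^sup>+\<^sup>+ [a] y" for y
    using that
  proof (induction rule: tranclp_induct)
    case (base y)
    then have "length y = 1" unfolding Lstep_def gtp_eq_def by (auto dest: map_eq_imp_length_eq)
    then obtain z where "y = [z]" by (auto simp: length_Suc_conv)
    then show ?case using base Lstep_ext[OF _ g] by blast
  next
    case (step y z)
    then obtain y0 where y: "y = [y0]" "(Lstep K [g \<cdot> c] N)\<^sup>+\<^sup>+ [g \<cdot> a] [g \<cdot> y0]" by blast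
    have "length z = 1" using step(2) y(1) unfolding Lstep_def gtp_eq_def by (auto dest: map_eq_imp_length_eq)
    then obtain z0 where "z = [z0]" by (auto simp: length_Suc_conv)
    then show ?case using step(2) y Lstep_ext[OF _ g] by (metis tranclp.trancl_into_trancl)
  qed
  then show ?thesis using L unfolding Lgtp_eq_def by blast
qed

lemma Lgtp_trans: "Lgtp_eq K bs M x y \<Longrightarrow> Lgtp_eq K bs M y z \<Longrightarrow> Lgtp_eq K bs M x z"
  unfolding Lgtp_eq_def by (rule tranclp_trans)

text \<open>A single step, with the identity as extension. It is applied to the first initial
  segment and to \<open>M\<close> when realizations are compared.\<close>

lemma Lgtp_model:
  assumes "extension K M0 m0 M" "sub_le K c m0" "gtp_eq K [a, m0] M [a', m0] M"
  shows "Lgtp_eq K [c] M [a] [a']"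
proof -
  have M: "M \<in> Mod K" using assms by (auto simp: extension_iff)
  have i: "into K a M" "into K a' M" "into K m0 M" using gtp_into[OF assms(3)] by auto
  have "into K c M" using sub_le_into assms(2) i(3) by blast
  then have "Lstep K [c] M [a] [a']"
    unfolding Lstep_def using assms i
    by (intro conjI exI[of _ M] exI[of _ "Ident K M"] exI[of _ M0] exI[of _ m0])
       (auto simp: extension_Ident[OF M] into_def)
  then show ?thesis unfolding Lgtp_eq_def by blast
qed

text \<open>Each step fixes a model through which \<open>c\<close> factors and hence fixes
  \<open>c\<close>; so Lascar equality over \<open>c\<close> refines equality of types with
  \<open>c\<close> adjoined.\<close>

lemma Lgtp_pair_gtp:
  assumes "Lgtp_eq K [c] M [a, b] [a', b']"
  shows "gtp_eq K [a, b, c] M [a', b', c] M"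
proof -
  have one: "gtp_eq K (x @ [c]) M (y @ [c]) M" if "Lstep K [c] M x y" for x y
  proof -
    have ex: "\<exists>N f M0 m0. extension K M f N \<and> extension K M0 m0 N \<and> sub_le K (f \<cdot> c) m0 \<and>
      gtp_eq K (map (\<lambda>a. f \<cdot> a) x @ [m0]) N (map (\<lambda>a. f \<cdot> a) y @ [m0]) N"
      and i: "\<forall>a\<in>set x \<union> set y \<union> {c}. into K a M"
      using that by (simp_all add: Lstep_def)
    obtain N f M0 m0 where N: "extension K M f N" "extension K M0 m0 N" "sub_le K (f \<cdot> c) m0"
      "gtp_eq K (map (\<lambda>a. f \<cdot> a) x @ [m0]) N (map (\<lambda>a. f \<cdot> a) y @ [m0]) N"
      using ex by blast
    obtain u where u: "u \<in> hom K (Dom K (f \<cdot> c)) (Dom K m0)" "m0 \<cdot> u = f \<cdot> c"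
      using N(3) unfolding sub_le_def by blast
    obtain P g g' where P: "extension K N g P" "extension K N g' P"
      and l: "list_all2 (\<lambda>a a'. into K a N \<and> into K a' N \<and> g \<cdot> a = g' \<cdot> a')
        (map (\<lambda>a. f \<cdot> a) x @ [m0]) (map (\<lambda>a. f \<cdot> a) y @ [m0])"
      using N(4) gtp_iff by blast
    have len: "length x = length y" using list_all2_lengthD[OF l] by simp
    then have l1: "list_all2 (\<lambda>a a'. into K a N \<and> into K a' N \<and> g \<cdot> a = g' \<cdot> a')
        (map (\<lambda>a. f \<cdot> a) x) (map (\<lambda>a. f \<cdot> a) y)" and l2: "g \<cdot> m0 = g' \<cdot> m0"
      using l by (simp_all add: list_all2_append)
    have "g \<cdot> (m0 \<cdot> u) = g' \<cdot> (m0 \<cdot> u)"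
      by (rule reassoc[OF l2]) (use N P u in \<open>auto simp: extension_iff hom_def\<close>)
    then have "g \<cdot> (f \<cdot> c) = g' \<cdot> (f \<cdot> c)" using u by simp
    moreover have "into K (f \<cdot> c) N" using into_ext[OF _ N(1)] i by simp
    ultimately have "list_all2 (\<lambda>a a'. into K a N \<and> into K a' N \<and> g \<cdot> a = g' \<cdot> a')
       (map (\<lambda>a. f \<cdot> a) (x @ [c])) (map (\<lambda>a. f \<cdot> a) (y @ [c]))"
      using l1 len by (simp add: list_all2_append)
    then have "gtp_eq K (map (\<lambda>a. f \<cdot> a) (x @ [c])) N (map (\<lambda>a. f \<cdot> a) (y @ [c])) N"
      using P gtp_iff by blast
    moreover have x: "\<forall>a\<in>set (x @ [c]). into K a M" and y: "\<forall>a\<in>set (y @ [c]). into K a M"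
      using i by auto
    ultimately show ?thesis
      using gtp_trans[OF gtp_sym[OF gtp_ext[OF N(1) x]] gtp_trans[OF _ gtp_ext[OF N(1) y]]] by simp
  qed
  have "gtp_eq K (x @ [c]) M (y @ [c]) M" if "(Lstep K [c] M)\<^sup>+\<^sup>+ x y" for x y
    using that by (induction rule: tranclp_induct) (use one gtp_trans in blast)+
  from this[of "[a, b]" "[a', b']"] show ?thesis using assms unfolding Lgtp_eq_def by simp
qed

end

section \<open>Small submodels and the number of Galois types\<close>

text \<open>Transport of the universal property along the poset isomorphism \<open>\<psi>\<close>;
  it makes it legitimate to choose one colimit for all diagrams of the same shape.\<close>

lemma colimit_reindex:
  assumes col: "colimit C r' D' t' X k'" and dia: "diagram C r D t"
    and \<psi>: "bij_betw \<psi> (Field r) (Field r')"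
    and rel: "\<And>i j. i \<in> Field r \<Longrightarrow> j \<in> Field r \<Longrightarrow> (i, j) \<in> r \<longleftrightarrow> (\<psi> i, \<psi> j) \<in> r'"
    and D: "\<And>i. i \<in> Field r \<Longrightarrow> D i = D' (\<psi> i)"
    and t: "\<And>i j. (i, j) \<in> r \<Longrightarrow> t i j = t' (\<psi> i) (\<psi> j)"
  shows "colimit C r D t X (\<lambda>i. k' (\<psi> i))"
proof -
  have F: "i \<in> Field r" "j \<in> Field r" if "(i, j) \<in> r" for i j using that by (auto simp: Field_def)
  have F': "i \<in> Field r'" "j \<in> Field r'" if "(i, j) \<in> r'" for i j using that by (auto simp: Field_def)
  have \<psi>F: "\<psi> i \<in> Field r'" if "i \<in> Field r" for i using that bij_betw_imp_surj_on[OF \<psi>] by blast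
  define \<phi> where "\<phi> = inv_into (Field r) \<psi>"
  have \<phi>: "\<phi> j \<in> Field r" "\<psi> (\<phi> j) = j" if "j \<in> Field r'" for j
    using \<psi> that unfolding \<phi>_def bij_betw_def by (auto simp: inv_into_into f_inv_into_f)
  have \<phi>\<psi>: "\<phi> (\<psi> i) = i" if "i \<in> Field r" for i
    using \<psi> that unfolding \<phi>_def bij_betw_def by simp
  have "cocone C r D t X (\<lambda>i. k' (\<psi> i))"
    unfolding cocone_def
  proof (intro conjI ballI allI impI)
    have c: "cocone C r' D' t' X k'" using col by (simp add: colimit_def)
    show "X \<in> Obj C" using c by (simp add: cocone_def)
    show "k' (\<psi> i) \<in> hom C (D i) X" if "i \<in> Field r" for i
      using c \<psi>F[OF that] D[OF that] by (simp add: cocone_def)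
    show "k' (\<psi> j) \<cdot>\<^bsub>C\<^esub> t i j = k' (\<psi> i)" if "(i, j) \<in> r" for i j
      using c t[OF that] that rel[OF F[OF that]] by (simp add: cocone_def)
  qed
  moreover have "\<exists>!u. u \<in> hom C X Y \<and> (\<forall>i\<in>Field r. u \<cdot>\<^bsub>C\<^esub> k' (\<psi> i) = h i)" if h: "cocone C r D t Y h" for Y h
  proof -
    have "cocone C r' D' t' Y (\<lambda>j. h (\<phi> j))"
      unfolding cocone_def
    proof (intro conjI ballI allI impI)
      show "Y \<in> Obj C" using h by (simp add: cocone_def)
      show "h (\<phi> j) \<in> hom C (D' j) Y" if "j \<in> Field r'" for j
        using h D[OF \<phi>(1)[OF that]] \<phi>[OF that] by (auto simp: cocone_def)
      show "h (\<phi> j) \<cdot>\<^bsub>C\<^esub> t' i j = h (\<phi> i)" if "(i, j) \<in> r'" for i j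
      proof -
        have "(\<phi> i, \<phi> j) \<in> r" using that rel[of "\<phi> i" "\<phi> j"] \<phi> F'[OF that] by simp
        moreover from this have "t (\<phi> i) (\<phi> j) = t' i j" using t[of "\<phi> i" "\<phi> j"] \<phi> F'[OF that] by simp
        ultimately show ?thesis using h unfolding cocone_def by metis
      qed
    qed
    then have "\<exists>!u. u \<in> hom C X Y \<and> (\<forall>j\<in>Field r'. u \<cdot>\<^bsub>C\<^esub> k' j = h (\<phi> j))"
      using col unfolding colimit_def by blast
    moreover have "(\<forall>j\<in>Field r'. u \<cdot>\<^bsub>C\<^esub> k' j = h (\<phi> j)) \<longleftrightarrow> (\<forall>i\<in>Field r. u \<cdot>\<^bsub>C\<^esub> k' (\<psi> i) = h i)" for u
      using \<psi>F \<phi> \<phi>\<psi> by metis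
    ultimately show ?thesis by simp
  qed
  ultimately show ?thesis using dia unfolding colimit_def by blast
qed

text \<open>A family of sets ordered by inclusion, carried along \<open>e\<close> because index
  posets of diagrams are relations on \<open>'u\<close>.\<close>

definition inclusion_rel :: "('b set \<Rightarrow> 'u) \<Rightarrow> 'b set set \<Rightarrow> 'u rel" where
  "inclusion_rel e T = {(e S, e S') | S S'. S \<in> T \<and> S' \<in> T \<and> S \<subseteq> S'}"

lemma inclusion_rel:
  assumes "inj_on e T"
  shows "Partial_order (inclusion_rel e T)" "Field (inclusion_rel e T) = e ` T"
    "\<And>S S'. S \<in> T \<Longrightarrow> S' \<in> T \<Longrightarrow> (e S, e S') \<in> inclusion_rel e T \<longleftrightarrow> S \<subseteq> S'"
proof -
  show F: "Field (inclusion_rel e T) = e ` T" unfolding inclusion_rel_def Field_def by auto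
  show i: "(e S, e S') \<in> inclusion_rel e T \<longleftrightarrow> S \<subseteq> S'" if "S \<in> T" "S' \<in> T" for S S'
    using that assms unfolding inclusion_rel_def by (auto dest: inj_onD)
  have "refl_on (e ` T) (inclusion_rel e T)"
    by (rule refl_onI) (auto simp: i inclusion_rel_def)
  moreover have "trans (inclusion_rel e T)"
  proof (rule transI)
    fix x y z assume "(x, y) \<in> inclusion_rel e T" "(y, z) \<in> inclusion_rel e T"
    then obtain A B B' C where "x = e A" "y = e B" "y = e B'" "z = e C" "A \<in> T" "B \<in> T" "B' \<in> T" "C \<in> T"
      "A \<subseteq> B" "B' \<subseteq> C" unfolding inclusion_rel_def by auto
    moreover then have "B = B'" using assms by (auto dest: inj_onD)
    ultimately show "(x, z) \<in> inclusion_rel e T" unfolding inclusion_rel_def by auto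
  qed
  moreover have "antisym (inclusion_rel e T)"
  proof (rule antisymI)
    fix x y assume a: "(x, y) \<in> inclusion_rel e T" "(y, x) \<in> inclusion_rel e T"
    then obtain A B where "x = e A" "y = e B" "A \<in> T" "B \<in> T" unfolding inclusion_rel_def by auto
    then show "x = y" using a i by auto
  qed
  ultimately show "Partial_order (inclusion_rel e T)"
    unfolding partial_order_on_def preorder_on_def F by (auto simp: inclusion_rel_def)
qed

text \<open>Universal properties provide the arrows between the partial colimits. A cocone over
  these restricts to one over \<open>r\<close>, and directedness of \<open>T\<close> makes the
  restriction well defined. The gain is that \<open>T\<close> may be far more directed than
  \<open>r\<close>.\<close>

lemma (in category) colimit_of_subcolimits:
  fixes r :: "'u rel"
  assumes N: "colimit C r D t N k" and e: "inj_on e T"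
    and sub: "\<And>S. S \<in> T \<Longrightarrow> S \<subseteq> Field r"
    and Y: "\<And>S. S \<in> T \<Longrightarrow> colimit C (Restr r S) D t (Y S) (\<kappa> S)"
    and dir: "\<And>S S'. S \<in> T \<Longrightarrow> S' \<in> T \<Longrightarrow> \<exists>S''\<in>T. S \<subseteq> S'' \<and> S' \<subseteq> S''"
    and cov: "\<And>i. i \<in> Field r \<Longrightarrow> \<exists>S\<in>T. i \<in> S"
  shows "\<exists>u v. colimit C (inclusion_rel e T) (\<lambda>x. Y (inv_into T e x)) u N v"
proof -
  let ?R = "inclusion_rel e T"
  note R = inclusion_rel[OF e]
  have diaN: "diagram C r D t" and cocN: "cocone C r D t N k" using N by (auto simp: colimit_def)
  have refl: "Refl r" using diaN by (simp add: diagram_def partial_order_on_def preorder_on_def)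
  have FS: "Field (Restr r S) = S" if "S \<in> T" for S using Field_Restr_sub[OF refl sub[OF that]] .
  have cocY: "cocone C (Restr r S) D t (Y S) (\<kappa> S)" if "S \<in> T" for S using Y[OF that] by (simp add: colimit_def)
  note cY = coconeD[OF cocY, unfolded FS]
  have cY': "\<kappa> S i \<in> Arr C" "Dom C (\<kappa> S i) = D i" "Cod C (\<kappa> S i) = Y S" if "S \<in> T" "i \<in> S" for S i
    using cY(2-4)[OF that(1)] FS[OF that(1)] that by auto
  have up: "\<exists>u. u \<in> Arr C \<and> Dom C u = Y S \<and> Cod C u = X \<and> (\<forall>i\<in>S. u \<cdot> \<kappa> S i = h i)"
    if S: "S \<in> T" and h: "cocone C (Restr r S) D t X h" for S X h
    using colimit_induced[OF Y[OF S] h] FS[OF S] by metis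
  have uni: "u = v" if "S \<in> T" "u \<in> Arr C" "v \<in> Arr C" "Dom C u = Y S" "Dom C v = Y S" "Cod C v = Cod C u"
     "\<And>i. i \<in> S \<Longrightarrow> u \<cdot> \<kappa> S i = v \<cdot> \<kappa> S i" for S u v
    by (rule colimit_unique[OF Y[OF that(1)]]) (use that FS[OF that(1)] in auto)
  have "\<exists>u. u \<in> Arr C \<and> Dom C u = Y S \<and> Cod C u = Y S' \<and> (\<forall>i\<in>S. u \<cdot> \<kappa> S i = \<kappa> S' i)"
    if "S \<in> T" "S' \<in> T" "S \<subseteq> S'" for S S'
  proof (rule up[OF that(1)])
    have "cocone C (Restr (Restr r S') S) D t (Y S') (\<kappa> S')"
      by (rule cocone_Restr[OF cocY[OF that(2)]])
        (use that FS[OF that(2)] refl sub[OF that(2)] in \<open>auto simp: refl_on_def\<close>)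
    moreover have "Restr (Restr r S') S = Restr r S" using that by auto
    ultimately show "cocone C (Restr r S) D t (Y S') (\<kappa> S')" by simp
  qed
  then obtain u where u: "\<And>S S'. S \<in> T \<Longrightarrow> S' \<in> T \<Longrightarrow> S \<subseteq> S' \<Longrightarrow> u S S' \<in> Arr C \<and>
      Dom C (u S S') = Y S \<and> Cod C (u S S') = Y S' \<and> (\<forall>i\<in>S. u S S' \<cdot> \<kappa> S i = \<kappa> S' i)" by metis
  have "\<exists>v. v \<in> Arr C \<and> Dom C v = Y S \<and> Cod C v = N \<and> (\<forall>i\<in>S. v \<cdot> \<kappa> S i = k i)" if "S \<in> T" for S
    by (rule up[OF that]) (rule cocone_Restr[OF cocN sub[OF that] refl])
  then obtain v where v: "\<And>S. S \<in> T \<Longrightarrow> v S \<in> Arr C \<and> Dom C (v S) = Y S \<and> Cod C (v S) = N \<and>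
      (\<forall>i\<in>S. v S \<cdot> \<kappa> S i = k i)" by metis
  have YO: "Y S \<in> Obj C" if "S \<in> T" for S using cY(1)[OF that] .
  have uid: "u S S = Ident C (Y S)" if "S \<in> T" for S
    by (rule uni[OF that]) (use u[OF that that] YO[OF that] cY'[OF that] in auto)
  have ucomp: "u S' S'' \<cdot> u S S' = u S S''" if "S \<in> T" "S' \<in> T" "S'' \<in> T" "S \<subseteq> S'" "S' \<subseteq> S''" for S S' S''
  proof (rule uni[OF that(1)])
    note u1 = u[OF that(1,2,4)] and u2 = u[OF that(2,3,5)] and u3 = u[OF that(1,3)]
    show "(u S' S'' \<cdot> u S S') \<cdot> \<kappa> S i = u S S'' \<cdot> \<kappa> S i" if i: "i \<in> S" for i
      using u1 u2 u3 i \<open>S \<subseteq> S'\<close> \<open>S' \<subseteq> S''\<close> cY'[OF \<open>S \<in> T\<close> i] by auto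
  qed (use u[OF that(1,2,4)] u[OF that(2,3,5)] u[OF that(1,3)] that in auto)
  have vcomp: "v S' \<cdot> u S S' = v S" if "S \<in> T" "S' \<in> T" "S \<subseteq> S'" for S S'
  proof (rule uni[OF that(1)])
    show "(v S' \<cdot> u S S') \<cdot> \<kappa> S i = v S \<cdot> \<kappa> S i" if i: "i \<in> S" for i
      using u[OF \<open>S \<in> T\<close> \<open>S' \<in> T\<close> \<open>S \<subseteq> S'\<close>] v[OF \<open>S \<in> T\<close>] v[OF \<open>S' \<in> T\<close>] i \<open>S \<subseteq> S'\<close> cY'[OF \<open>S \<in> T\<close> i] by auto
  qed (use u[OF that] v that in auto)
  define d where "d = inv_into T e"
  have de: "d (e S) = S" if "S \<in> T" for S using that e by (simp add: d_def)
  have elim: "\<exists>S S'. S \<in> T \<and> S' \<in> T \<and> S \<subseteq> S' \<and> x = e S \<and> y = e S'" if "(x, y) \<in> ?R" for x y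
    using that unfolding inclusion_rel_def by blast
  have dia: "diagram C ?R (\<lambda>x. Y (d x)) (\<lambda>x y. u (d x) (d y))"
    unfolding diagram_def
  proof (intro conjI ballI allI impI)
    show "Partial_order ?R" by (rule R(1))
    show "Y (d x) \<in> Obj C" "u (d x) (d x) = Ident C (Y (d x))" if "x \<in> Field ?R" for x
      using that R(2) de YO uid by auto
    show "u (d x) (d y) \<in> hom C (Y (d x)) (Y (d y))" if "(x, y) \<in> ?R" for x y
      using elim[OF that] de u unfolding hom_def by auto
    show "u (d y) (d z) \<cdot> u (d x) (d y) = u (d x) (d z)" if xy: "(x, y) \<in> ?R" "(y, z) \<in> ?R" for x y z
    proof -
      obtain S S' where 1: "S \<in> T" "S' \<in> T" "S \<subseteq> S'" "x = e S" "y = e S'" using elim[OF xy(1)] by blast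
      obtain S1 S'' where 2: "S1 \<in> T" "S'' \<in> T" "S1 \<subseteq> S''" "y = e S1" "z = e S''" using elim[OF xy(2)] by blast
      have "S1 = S'" using 1 2 e by (auto dest: inj_onD)
      then show ?thesis using ucomp[of S S' S''] 1 2 de by simp
    qed
  qed
  have coc: "cocone C ?R (\<lambda>x. Y (d x)) (\<lambda>x y. u (d x) (d y)) N (\<lambda>x. v (d x))"
    unfolding cocone_def
  proof (intro conjI ballI allI impI)
    show "N \<in> Obj C" using coconeD(1)[OF cocN] .
    show "v (d x) \<in> hom C (Y (d x)) N" if "x \<in> Field ?R" for x
      using that R(2) de v unfolding hom_def by auto
    show "v (d y) \<cdot> u (d x) (d y) = v (d x)" if "(x, y) \<in> ?R" for x y
      using elim[OF that] de vcomp by auto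
  qed
  have "\<exists>!w. w \<in> hom C N Z \<and> (\<forall>x\<in>Field ?R. w \<cdot> v (d x) = h x)"
    if Z: "cocone C ?R (\<lambda>x. Y (d x)) (\<lambda>x y. u (d x) (d y)) Z h" for Z h
  proof -
    have h: "h (e S) \<in> Arr C" "Dom C (h (e S)) = Y S" "Cod C (h (e S)) = Z" if "S \<in> T" for S
      using coconeD(2-4)[OF Z, of "e S"] R(2) de[OF that] that by auto
    have hu: "h (e S') \<cdot> u S S' = h (e S)" if "S \<in> T" "S' \<in> T" "S \<subseteq> S'" for S S'
      using coconeD(5)[OF Z, of "e S" "e S'"] R(3)[OF that(1,2)] de that by auto
    \<comment> \<open>The component at \<open>i\<close> does not depend on the member of
      \<open>T\<close> containing \<open>i\<close>: two members are compared inside a common upper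
      bound.\<close>
    have "\<exists>g. \<forall>S\<in>T. i \<in> S \<longrightarrow> h (e S) \<cdot> \<kappa> S i = g" if "i \<in> Field r" for i
    proof -
      have "h (e S) \<cdot> \<kappa> S i = h (e S') \<cdot> \<kappa> S' i" if S: "S \<in> T" "S' \<in> T" "i \<in> S" "i \<in> S'" for S S'
      proof -
        obtain S'' where S'': "S'' \<in> T" "S \<subseteq> S''" "S' \<subseteq> S''" using dir S by blast
        have "h (e S) \<cdot> \<kappa> S i = h (e S'') \<cdot> \<kappa> S'' i" if "S \<in> T" "S \<subseteq> S''" "i \<in> S" for S
        proof -
          have us: "u S S'' \<in> Arr C" "Dom C (u S S'') = Y S" "Cod C (u S S'') = Y S''"
            "u S S'' \<cdot> \<kappa> S i = \<kappa> S'' i" using u[OF that(1) S''(1) that(2)] that(3) by auto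
          have "h (e S'') \<cdot> (u S S'' \<cdot> \<kappa> S i) = h (e S) \<cdot> \<kappa> S i"
            by (rule reassoc1[OF hu[OF that(1) S''(1) that(2)]]) (use us h[OF S''(1)] cY'[OF that(1,3)] in auto)
          then show ?thesis using us by simp
        qed
        then show ?thesis using S S'' by metis
      qed
      then show ?thesis by metis
    qed
    then obtain g where g: "\<And>i S. i \<in> Field r \<Longrightarrow> S \<in> T \<Longrightarrow> i \<in> S \<Longrightarrow> h (e S) \<cdot> \<kappa> S i = g i" by metis
    have "cocone C r D t Z g"
      unfolding cocone_def
    proof (intro conjI ballI allI impI)
      show "Z \<in> Obj C" using coconeD(1)[OF Z] .
      show "g i \<in> hom C (D i) Z" if i: "i \<in> Field r" for i
      proof -
        obtain S where S: "S \<in> T" "i \<in> S" using cov i by blast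
        then show ?thesis using g[OF i S, symmetric] h[OF S(1)] cY'[OF S] by (auto simp: hom_def)
      qed
      show "g j \<cdot> t i j = g i" if ij: "(i, j) \<in> r" for i j
      proof -
        have F: "i \<in> Field r" "j \<in> Field r" using ij by (auto simp: Field_def)
        obtain S1 S2 where "S1 \<in> T" "i \<in> S1" "S2 \<in> T" "j \<in> S2" using cov F by blast
        then obtain S where S: "S \<in> T" "i \<in> S" "j \<in> S" using dir by blast
        have "(h (e S) \<cdot> \<kappa> S j) \<cdot> t i j = h (e S) \<cdot> (\<kappa> S j \<cdot> t i j)"
          using h[OF S(1)] cY'[OF S(1,3)] diagramD(4-6)[OF diaN ij] by simp
        also have "\<kappa> S j \<cdot> t i j = \<kappa> S i" using cY(5)[OF S(1), of i j] ij S by simp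
        finally show ?thesis using g[OF F(2) S(1,3)] g[OF F(1) S(1,2)] by simp
      qed
    qed
    then obtain w where w: "w \<in> Arr C" "Dom C w = N" "Cod C w = Z" "\<And>i. i \<in> Field r \<Longrightarrow> w \<cdot> k i = g i"
      using colimit_induced[OF N] by blast
    have wv: "w \<cdot> v S = h (e S)" if S: "S \<in> T" for S
    proof (rule uni[OF S])
      show "(w \<cdot> v S) \<cdot> \<kappa> S i = h (e S) \<cdot> \<kappa> S i" if i: "i \<in> S" for i
        using v[OF S] w i cY'[OF S i] g[OF _ S i] sub[OF S] by auto
    qed (use v[OF S] w h[OF S] in auto)
    have "w' = w" if w': "w' \<in> hom C N Z" "\<forall>x\<in>Field ?R. w' \<cdot> v (d x) = h x" for w'
    proof (rule colimit_unique[OF N])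
      show "w' \<cdot> k i = w \<cdot> k i" if i: "i \<in> Field r" for i
      proof -
        obtain S where S: "S \<in> T" "i \<in> S" using cov i by blast
        have "w' \<cdot> v S = w \<cdot> v S" using w'(2) R(2) de S wv by auto
        then have "w' \<cdot> (v S \<cdot> \<kappa> S i) = w \<cdot> (v S \<cdot> \<kappa> S i)"
          by (rule reassoc) (use v[OF S(1)] w w' cY'[OF S] in \<open>auto simp: hom_def\<close>)
        then show ?thesis using v[OF S(1)] S(2) by simp
      qed
    qed (use w w' in \<open>auto simp: hom_def\<close>)
    moreover have "w \<in> hom C N Z" "\<forall>x\<in>Field ?R. w \<cdot> v (d x) = h x"
      using w wv R(2) de by (auto simp: hom_def)
    ultimately show ?thesis by blast
  qed
  then have "colimit C ?R (\<lambda>x. Y (d x)) (\<lambda>x y. u (d x) (d y)) N (\<lambda>x. v (d x))"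
    using dia coc unfolding colimit_def by blast
  then show ?thesis unfolding d_def by blast
qed

text \<open>
  Transporting the index poset into a fixed set makes the possible small diagrams over a small set of
  objects form a small set.
\<close>

definition diagram_code ::
  "('u \<Rightarrow> 'u) \<Rightarrow> 'u rel \<Rightarrow> ('u \<Rightarrow> 'o) \<Rightarrow> ('u \<Rightarrow> 'u \<Rightarrow> 'a) \<Rightarrow> 'u rel \<times> ('u \<times> 'o) set \<times> (('u \<times> 'u) \<times> 'a) set" where
  "diagram_code \<phi> r D t =
     ({(\<phi> i, \<phi> j) | i j. (i, j) \<in> r}, {(\<phi> i, D i) | i. i \<in> Field r}, {((\<phi> i, \<phi> j), t i j) | i j. (i, j) \<in> r})"

text \<open>Matching indices with equal codes gives \<open>\<psi>\<close>, an isomorphism of index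
  posets that carries one diagram to the other, so the colimit is transported.\<close>

lemma diagram_code_colimit:
  assumes code: "diagram_code \<phi> r D t = diagram_code \<phi>' r' D' t'"
    and \<phi>: "inj_on \<phi> (Field r)" and \<phi>': "inj_on \<phi>' (Field r')"
    and dia: "diagram C r D t" and col: "colimit C r' D' t' X k'"
  shows "\<exists>k. colimit C r D t X k"
proof -
  have c1: "{(\<phi> i, \<phi> j) | i j. (i, j) \<in> r} = {(\<phi>' i, \<phi>' j) | i j. (i, j) \<in> r'}"
    and c2: "{(\<phi> i, D i) | i. i \<in> Field r} = {(\<phi>' i, D' i) | i. i \<in> Field r'}"
    and c3: "{((\<phi> i, \<phi> j), t i j) | i j. (i, j) \<in> r} = {((\<phi>' i, \<phi>' j), t' i j) | i j. (i, j) \<in> r'}"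
    using code by (simp_all add: diagram_code_def)
  have F: "i \<in> Field r" "j \<in> Field r" if "(i, j) \<in> r" for i j using that by (auto simp: Field_def)
  have F': "i \<in> Field r'" "j \<in> Field r'" if "(i, j) \<in> r'" for i j using that by (auto simp: Field_def)
  define \<psi> where "\<psi> i = inv_into (Field r') \<phi>' (\<phi> i)" for i
  have ex: "\<psi> i \<in> Field r' \<and> \<phi>' (\<psi> i) = \<phi> i \<and> D' (\<psi> i) = D i" if "i \<in> Field r" for i
  proof -
    have "(\<phi> i, D i) \<in> {(\<phi>' i, D' i) | i. i \<in> Field r'}" unfolding c2[symmetric] using that by blast
    then obtain i' where "i' \<in> Field r'" "\<phi> i = \<phi>' i'" "D i = D' i'" by auto
    then show ?thesis using \<phi>' by (simp add: \<psi>_def)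
  qed
  have bwd: "i' = \<psi> i" if "i' \<in> Field r'" "i \<in> Field r" "\<phi>' i' = \<phi> i" for i i'
    using that ex \<phi>' by (metis inj_onD)
  show ?thesis
  proof (rule exI, rule colimit_reindex[OF col dia])
    show "bij_betw \<psi> (Field r) (Field r')"
      unfolding bij_betw_def
    proof (intro conjI subset_antisym subsetI)
      show "inj_on \<psi> (Field r)" by (rule inj_onI) (metis ex \<phi> inj_onD)
      show "x \<in> Field r'" if "x \<in> \<psi> ` Field r" for x using that ex by auto
      fix x assume x: "x \<in> Field r'"
      have "(\<phi>' x, D' x) \<in> {(\<phi> i, D i) | i. i \<in> Field r}" unfolding c2 using x by blast
      then obtain i where i: "i \<in> Field r" "\<phi>' x = \<phi> i" by auto
      then show "x \<in> \<psi> ` Field r" using bwd[OF x i] by auto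
    qed
    show "(i, j) \<in> r \<longleftrightarrow> (\<psi> i, \<psi> j) \<in> r'" if ij: "i \<in> Field r" "j \<in> Field r" for i j
    proof
      assume "(i, j) \<in> r"
      then have "(\<phi> i, \<phi> j) \<in> {(\<phi>' i, \<phi>' j) | i j. (i, j) \<in> r'}" unfolding c1[symmetric] by blast
      then obtain a b where "(a, b) \<in> r'" "\<phi>' a = \<phi> i" "\<phi>' b = \<phi> j" by auto
      then show "(\<psi> i, \<psi> j) \<in> r'" using bwd[of a i] bwd[of b j] F'[of a b] ij by auto
    next
      assume "(\<psi> i, \<psi> j) \<in> r'"
      then have "(\<phi>' (\<psi> i), \<phi>' (\<psi> j)) \<in> {(\<phi> i, \<phi> j) | i j. (i, j) \<in> r}" unfolding c1 by blast
      then obtain a b where "(a, b) \<in> r" "\<phi> a = \<phi> i" "\<phi> b = \<phi> j" using ex ij by auto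
      then show "(i, j) \<in> r" using inj_onD[OF \<phi>, of a i] inj_onD[OF \<phi>, of b j] F[of a b] ij by auto
    qed
    show "D i = D' (\<psi> i)" if "i \<in> Field r" for i using ex[OF that] by simp
    show "t i j = t' (\<psi> i) (\<psi> j)" if ij: "(i, j) \<in> r" for i j
    proof -
      have "((\<phi> i, \<phi> j), t i j) \<in> {((\<phi>' i, \<phi>' j), t' i j) | i j. (i, j) \<in> r'}"
        unfolding c3[symmetric] using ij by blast
      then obtain a b where "(a, b) \<in> r'" "\<phi>' a = \<phi> i" "\<phi>' b = \<phi> j" "t i j = t' a b" by auto
      then show ?thesis using bwd[of a i] bwd[of b j] F'[of a b] F[OF ij] by auto
    qed
  qed
qed

text \<open>Index posets range over all relations on \<open>'u\<close>, but the codes with indices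
  in \<open>Field \<beta>\<close> and arrows between members of \<open>P\<close> form a small set.
  One colimit object chosen per code serves every diagram with that code.\<close>

lemma (in mono_accessible) small_diagram_colimits:
  assumes P: "small U P" "P \<subseteq> Obj C" and \<beta>: "regular_cardinal U \<beta>"
  shows "\<exists>Q. small U Q \<and> Q \<subseteq> Obj C \<and> (\<forall>(r :: 'u rel) D t Y l. |Field r| <o \<beta> \<longrightarrow> D ` Field r \<subseteq> P \<longrightarrow>
    colimit C r D t Y l \<longrightarrow> (\<exists>X\<in>Q. \<exists>k. colimit C r D t X k))"
proof -
  define H where "H = (\<Union>X\<in>P. \<Union>Y\<in>P. hom C X Y)"
  have smF: "small U (Field \<beta>)" using regular_small_Field[OF \<beta>] .
  have smH: "small U H" unfolding H_def using small_UN small_hom P by (meson subsetD)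
  define CS where "CS = Pow (Field \<beta> \<times> Field \<beta>) \<times> Pow (Field \<beta> \<times> P) \<times> Pow ((Field \<beta> \<times> Field \<beta>) \<times> H)"
  have smCS: "small U CS"
    unfolding CS_def by (intro small_Sigma small_Pow smF smH P(1))
  define good where "good c X \<longleftrightarrow> (\<exists>(r :: 'u rel) D t \<phi> k. inj_on \<phi> (Field r) \<and> diagram_code \<phi> r D t = c \<and>
    colimit C r D t X k)" for c X
  define Q where "Q = (\<lambda>c. SOME X. good c X) ` {c \<in> CS. \<exists>X. good c X}"
  have "small U Q" unfolding Q_def by (rule small_image, rule small_subset[OF smCS]) auto
  moreover have "Q \<subseteq> Obj C"
  proof
    fix X assume "X \<in> Q"
    then obtain c where "\<exists>Y. good c Y" "X = (SOME Y. good c Y)" unfolding Q_def by blast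
    then have "good c X" using someI_ex[of "good c"] by simp
    then show "X \<in> Obj C" unfolding good_def colimit_def cocone_def by blast
  qed
  moreover have "\<exists>X\<in>Q. \<exists>k. colimit C r D t X k"
    if r: "|Field r| <o \<beta>" "D ` Field r \<subseteq> P" "colimit C r D t Y l" for r :: "'u rel" and D t Y l
  proof -
    have "|Field r| \<le>o \<beta>" using r(1) ordLess_imp_ordLeq by blast
    also have "\<beta> =o |Field \<beta>|" using regular_cardinalD(4)[OF \<beta>] card_of_Field_ordIso ordIso_symmetric by blast
    finally have "|Field r| \<le>o |Field \<beta>|" .
    then obtain \<phi> where \<phi>: "inj_on \<phi> (Field r)" "\<phi> ` Field r \<subseteq> Field \<beta>"
      unfolding card_of_ordLeq[symmetric] by blast
    have F: "i \<in> Field r" "j \<in> Field r" if "(i, j) \<in> r" for i j using that by (auto simp: Field_def)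
    have dia: "diagram C r D t" using r(3) by (simp add: colimit_def)
    have tH: "t i j \<in> H" if "(i, j) \<in> r" for i j
    proof -
      have "t i j \<in> hom C (D i) (D j)" using dia that by (simp add: diagram_def)
      moreover have "D i \<in> P" "D j \<in> P" using F[OF that] r(2) by auto
      ultimately show ?thesis unfolding H_def by blast
    qed
    let ?c = "diagram_code \<phi> r D t"
    have "?c \<in> CS" unfolding CS_def diagram_code_def using F \<phi>(2) r(2) tH by auto
    moreover have "good ?c Y" unfolding good_def using \<phi> r(3) by blast
    ultimately have "(SOME X. good ?c X) \<in> Q" "good ?c (SOME X. good ?c X)"
      unfolding Q_def by (blast, metis someI)
    then obtain X where X: "X \<in> Q" "good ?c X" by blast
    then obtain r' :: "'u rel" and D' t' \<phi>' k where "inj_on \<phi>' (Field r')" "diagram_code \<phi>' r' D' t' = ?c"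
      "colimit C r' D' t' X k" unfolding good_def by blast
    then show ?thesis using diagram_code_colimit[OF _ \<phi>(1) _ dia] X(1) by metis
  qed
  ultimately show ?thesis by blast
qed

text \<open>Chosen upper bounds of pairs are added countably often. Uncountability of
  \<open>\<beta>\<close> keeps the union of the countably many steps below
  \<open>\<beta>\<close>.\<close>

lemma directed_closure:
  assumes r: "\<forall>i\<in>Field r. \<forall>j\<in>Field r. \<exists>u\<in>Field r. (i, u) \<in> r \<and> (j, u) \<in> r"
    and \<beta>: "Cinfinite \<beta>" "regularCard \<beta>" "natLeq <o \<beta>" and S: "S \<subseteq> Field r" "|S| <o \<beta>"
  shows "\<exists>S'. S \<subseteq> S' \<and> S' \<subseteq> Field r \<and> |S'| <o \<beta> \<and> (\<forall>i\<in>S'. \<forall>j\<in>S'. \<exists>u\<in>S'. (i, u) \<in> r \<and> (j, u) \<in> r)"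
proof -
  obtain ub where ub: "\<And>i j. i \<in> Field r \<Longrightarrow> j \<in> Field r \<Longrightarrow> ub i j \<in> Field r \<and> (i, ub i j) \<in> r \<and> (j, ub i j) \<in> r"
    using r by metis
  define A where "A n = ((\<lambda>X. X \<union> case_prod ub ` (X \<times> X)) ^^ n) S" for n
  have A0: "A 0 = S" and AS: "A (Suc n) = A n \<union> case_prod ub ` (A n \<times> A n)" for n by (simp_all add: A_def)
  have inf: "infinite (Field \<beta>)" and co: "Card_order \<beta>" using \<beta>(1) by (auto simp: cinfinite_def)
  have sub: "A n \<subseteq> Field r" for n 
  proof (induction n)
    case (Suc n)
    then have "ub i j \<in> Field r" if "i \<in> A n" "j \<in> A n" for i j using ub that by blast
    then show ?case using Suc unfolding AS by auto
  qed (simp add: A0 S(1))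
  have card: "|A n| <o \<beta>" for n
  proof (induction n)
    case 0
    then show ?case using S by (simp add: A0)
  next
    case (Suc n)
    have "A n \<times> A n = (\<Union>x\<in>A n. Pair x ` A n)" by auto
    moreover have "|\<Union>x\<in>A n. Pair x ` A n| <o \<beta>"
      by (rule card_of_UNION_ordLess_infinite_Field_regularCard[OF \<beta>(2,1) Suc])
        (use Suc card_of_image ordLeq_ordLess_trans in blast)
    ultimately have "|A n \<times> A n| <o \<beta>" by simp
    then have "|case_prod ub ` (A n \<times> A n)| <o \<beta>" using card_of_image ordLeq_ordLess_trans by blast
    then show ?case unfolding AS by (rule card_of_Un_ordLess_infinite_Field[OF inf co Suc])
  qed
  have "|UNIV :: nat set| <o \<beta>"
    using \<beta>(3) by (metis Field_natLeq card_of_Field_ordIso natLeq_Card_order ordIso_ordLess_trans)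
  then have "|\<Union>n\<in>UNIV. A n| <o \<beta>"
    by (rule card_of_UNION_ordLess_infinite_Field_regularCard[OF \<beta>(2,1)]) (use card in blast)
  moreover have mono: "A m \<subseteq> A n" if "m \<le> n" for m n
    using that by (rule lift_Suc_mono_le[rotated]) (auto simp: AS)
  have "\<exists>u\<in>\<Union>n. A n. (i, u) \<in> r \<and> (j, u) \<in> r" if "i \<in> (\<Union>n. A n)" "j \<in> (\<Union>n. A n)" for i j
  proof -
    obtain m n where mn: "i \<in> A m" "j \<in> A n" using \<open>i \<in> (\<Union>n. A n)\<close> \<open>j \<in> (\<Union>n. A n)\<close> by blast
    then have "i \<in> A (max m n)" "j \<in> A (max m n)" using mono by (meson max.cobounded1 max.cobounded2 subsetD)+
    then have "ub i j \<in> A (Suc (max m n))" unfolding AS by auto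
    moreover have "(i, ub i j) \<in> r \<and> (j, ub i j) \<in> r" using ub mn sub by blast
    ultimately show ?thesis by blast
  qed
  moreover have "S \<subseteq> (\<Union>n. A n)" using A0 by blast
  moreover have "(\<Union>n. A n) \<subseteq> Field r" using sub by blast
  ultimately show ?thesis by (intro exI[of _ "\<Union>n. A n"]) blast
qed

lemma directed_natLeqI:
  assumes "Partial_order r" "small U (Field r)" "Field r \<noteq> {}"
    and "\<forall>i\<in>Field r. \<forall>j\<in>Field r. \<exists>u\<in>Field r. (i, u) \<in> r \<and> (j, u) \<in> r"
  shows "directed U natLeq r"
proof -
  have "\<exists>u\<in>Field r. \<forall>s\<in>S. (s, u) \<in> r" if "finite S" "S \<subseteq> Field r" for S
    using that
  proof (induction S)
    case empty
    then show ?case using assms(3) by blast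
  next
    case (insert x S)
    then obtain u where u: "u \<in> Field r" "\<forall>s\<in>S. (s, u) \<in> r" by blast
    obtain w where w: "w \<in> Field r" "(x, w) \<in> r" "(u, w) \<in> r" using assms(4) insert u by blast
    have "trans r" using assms(1) by (simp add: partial_order_on_def preorder_on_def)
    then have "\<forall>s\<in>insert x S. (s, w) \<in> r" using u(2) w(2,3) transD[of r] by blast
    then show ?case using w(1) by blast
  qed
  moreover have "finite S" if "|S| <o natLeq" for S :: "'a set" using that finite_iff_ordLess_natLeq by blast
  ultimately show ?thesis using assms(1,2) unfolding directed_def by blast
qed

lemma directed_pair:
  assumes "directed U \<nu> r" "natLeq \<le>o \<nu>" "i \<in> Field r" "j \<in> Field r"
  shows "\<exists>u\<in>Field r. (i, u) \<in> r \<and> (j, u) \<in> r"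
proof -
  have "|{i, j}| <o natLeq" using finite_iff_ordLess_natLeq by auto
  then have "|{i, j}| <o \<nu>" using assms(2) ordLess_ordLeq_trans by blast
  moreover have "{i, j} \<subseteq> Field r" using assms by simp
  ultimately obtain u where "u \<in> Field r" "\<And>s. s \<in> {i, j} \<Longrightarrow> (s, u) \<in> r"
    using directed_upper[OF assms(1)] by metis
  then show ?thesis by blast
qed

lemma directed_nonempty:
  assumes "directed U \<nu> r" "natLeq \<le>o \<nu>"
  shows "Field r \<noteq> {}"
proof -
  have "|{} :: 'a set| <o natLeq" using finite_iff_ordLess_natLeq by auto
  then have "|{} :: 'a set| <o \<nu>" using assms(2) ordLess_ordLeq_trans by blast
  then obtain u where "u \<in> Field r" using directed_upper[OF assms(1), of "{}"] by auto
  then show ?thesis by blast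
qed

text \<open>Two strict steps are taken to gain uncountability: \<open>\<beta>0\<close> is infinite,
  and \<open>\<beta>\<close> lies strictly above it.\<close>

lemma (in universe) regular_uncountable:
  assumes "regular_cardinal U \<kappa>" "regular_cardinal U \<nu>" "regular_cardinal U \<mu>"
  shows "\<exists>\<beta>. regular_cardinal U \<beta> \<and> natLeq <o \<beta> \<and> \<kappa> <o \<beta> \<and> \<nu> <o \<beta> \<and> \<mu> <o \<beta>"
proof -
  obtain \<beta>0 where b0: "regular_cardinal U \<beta>0" "\<kappa> <o \<beta>0" "\<nu> <o \<beta>0"
    using regular_above[OF small_finite[of "{} :: 'u set"] assms(1,2)] by auto
  then obtain \<beta> where b: "regular_cardinal U \<beta>" "\<beta>0 <o \<beta>" "\<mu> <o \<beta>"
    using regular_above[OF small_finite[of "{} :: 'u set"] b0(1) assms(3)] by auto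
  have "natLeq \<le>o \<beta>0" using natLeq_le_Cinfinite regular_cardinalD(1)[OF b0(1)] .
  then have "natLeq <o \<beta>" using b(2) ordLeq_ordLess_trans by blast
  moreover have "\<kappa> <o \<beta>" "\<nu> <o \<beta>" using ordLess_transitive[OF _ b(2)] b0(2,3) by auto
  ultimately show ?thesis using b(1,3) by blast
qed

text \<open>
  A downward Loewenheim-Skolem property: arrows into an arbitrary model factor through the
  colimit of a small directed part of a diagram presenting that model.
\<close>

lemma (in amalgamation) small_submodels:
  assumes X: "X1 \<in> Obj K" "X2 \<in> Obj K"
  shows "\<exists>Q. small (Univ K) Q \<and> Q \<subseteq> Mod K \<and> (\<forall>N x1 x2. N \<in> Mod K \<longrightarrow> x1 \<in> hom K X1 N \<longrightarrow> x2 \<in> hom K X2 N \<longrightarrow>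
    (\<exists>N0\<in>Q. \<exists>n\<in>hom K N0 N. \<exists>y1\<in>hom K X1 N0. \<exists>y2\<in>hom K X2 N0. n \<cdot> y1 = x1 \<and> n \<cdot> y2 = x2))"
proof -
  let ?U = "Univ K"
  obtain \<nu>0 P where \<nu>0: "regular_cardinal ?U \<nu>0" and smP: "small ?U P"
    and P: "\<forall>X \<in> P. presentable ?U \<nu>0 (models K) X"
    and gen: "\<forall>Y \<in> Mod K. \<exists>r D t k. directed ?U \<nu>0 r \<and> (\<forall>i \<in> Field r. D i \<in> P) \<and> colimit (models K) r D t Y k"
    using M.acc unfolding accessible_def by auto
  obtain \<nu>1 where \<nu>1: "regular_cardinal ?U \<nu>1" "presentable ?U \<nu>1 K X1" using presentable_exists X by blast
  obtain \<nu>2 where \<nu>2: "regular_cardinal ?U \<nu>2" "presentable ?U \<nu>2 K X2" using presentable_exists X by blast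
  \<comment> \<open>Above the presentability ranks of \<open>X1\<close> and \<open>X2\<close>, and
    uncountable so that directed closures stay below \<open>\<beta>\<close>.\<close>
  obtain \<beta> where \<beta>: "regular_cardinal ?U \<beta>" "natLeq <o \<beta>" "\<nu>1 <o \<beta>" "\<nu>2 <o \<beta>"
    using regular_uncountable[OF \<nu>0 \<nu>1(1) \<nu>2(1)] by blast
  note b = regular_cardinalD[OF \<beta>(1)]
  have pres: "presentable ?U \<beta> K X1" "presentable ?U \<beta> K X2"
    using presentable_mono[OF \<nu>1(2) ordLess_imp_ordLeq[OF \<beta>(3)]]
      presentable_mono[OF \<nu>2(2) ordLess_imp_ordLeq[OF \<beta>(4)]] .
  have PM: "P \<subseteq> Obj (models K)" using presentable_Obj[of ?U \<nu>0 "models K"] P by blast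
  obtain Q where smQ: "small ?U Q" and QM: "Q \<subseteq> Obj (models K)"
    and Q: "\<And>(r :: 'u rel) D t Y l. |Field r| <o \<beta> \<Longrightarrow> D ` Field r \<subseteq> P \<Longrightarrow>
      colimit (models K) r D t Y l \<Longrightarrow> \<exists>X\<in>Q. \<exists>k. colimit (models K) r D t X k"
    using M.small_diagram_colimits[OF smP PM \<beta>(1)] by blast
  have "\<exists>N0\<in>Q. \<exists>n\<in>hom K N0 N. \<exists>y1\<in>hom K X1 N0. \<exists>y2\<in>hom K X2 N0. n \<cdot> y1 = x1 \<and> n \<cdot> y2 = x2"
    if N: "N \<in> Mod K" and x1: "x1 \<in> hom K X1 N" and x2: "x2 \<in> hom K X2 N" for N x1 x2
  proof -
    obtain r D t k where r: "directed ?U \<nu>0 r" "\<forall>i \<in> Field r. D i \<in> P" "colimit (models K) r D t N k"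
      using gen N by blast
    have nl: "natLeq \<le>o \<nu>0" using natLeq_le_Cinfinite regular_cardinalD(1)[OF \<nu>0] .
    have dia: "diagram (models K) r D t" using r(3) by (simp add: colimit_def)
    have po: "Partial_order r" and smr: "small ?U (Field r)" using r(1) by (simp_all add: directed_def)
    have refl: "Refl r" using po by (simp add: partial_order_on_def preorder_on_def)
    have pairs: "\<forall>i\<in>Field r. \<forall>j\<in>Field r. \<exists>u\<in>Field r. (i, u) \<in> r \<and> (j, u) \<in> r"
      using directed_pair[OF r(1) nl] by blast
    obtain i0 where i0: "i0 \<in> Field r" using directed_nonempty[OF r(1) nl] by blast
    \<comment> \<open>Directed parts of size below \<open>\<beta>\<close>: directed, so that they
      have colimits among the models; of size below \<open>\<beta>\<close>, so that these colimits
      may be taken in the fixed small set \<open>Q\<close>.\<close>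
    define T where "T = {S. S \<subseteq> Field r \<and> S \<noteq> {} \<and> |S| <o \<beta> \<and> (\<forall>i\<in>S. \<forall>j\<in>S. \<exists>u\<in>S. (i, u) \<in> r \<and> (j, u) \<in> r)}"
    have smT: "small ?U T"
      using small_Pow[OF smr] by (rule small_subset) (auto simp: T_def)
    then obtain e :: "'u set \<Rightarrow> 'u" where e: "inj_on e T" using small_inj by blast
    have close: "\<exists>S'\<in>T. S \<subseteq> S'" if "S \<subseteq> Field r" "|S| <o \<beta>" for S
    proof -
      have "|{i0}| <o \<beta>" using \<beta>(2) by (meson finite.intros finite_iff_ordLess_natLeq ordLess_transitive)
      then have "|insert i0 S| <o \<beta>" 
        using card_of_Un_ordLess_infinite_Field[of \<beta> "{i0}" S] b(1) that(2) by (simp add: cinfinite_def)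
      moreover have "insert i0 S \<subseteq> Field r" using that i0 by simp
      ultimately obtain S' where "insert i0 S \<subseteq> S'" "S' \<subseteq> Field r" "|S'| <o \<beta>"
        "\<forall>i\<in>S'. \<forall>j\<in>S'. \<exists>u\<in>S'. (i, u) \<in> r \<and> (j, u) \<in> r"
        using directed_closure[OF pairs b(1,2) \<beta>(2), of "insert i0 S"] by meson
      then have "S' \<in> T" "S \<subseteq> S'" unfolding T_def by auto
      then show ?thesis by blast
    qed
    have TF: "S \<subseteq> Field r" "|S| <o \<beta>" if "S \<in> T" for S using that by (auto simp: T_def)
    have "\<exists>Y\<in>Q. \<exists>\<kappa>. colimit (models K) (Restr r S) D t Y \<kappa>" if S: "S \<in> T" for S
    proof -
      have F: "Field (Restr r S) = S" using Field_Restr_sub[OF refl TF(1)[OF S]] .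
      have "directed ?U natLeq (Restr r S)"
        by (rule directed_natLeqI[OF Partial_order_Restr[OF po]], unfold F)
          (use S small_subset[OF smr] in \<open>auto simp: T_def\<close>)
      then obtain Y l where "colimit (models K) (Restr r S) D t Y l"
        using M_directed_colimits diagram_Restr[OF dia TF(1)[OF S]] unfolding has_directed_colimits_def by blast
      then show ?thesis using Q[of "Restr r S" D t Y l] F TF[OF S] r(2) by auto
    qed
    then obtain Y \<kappa> where Y: "\<And>S. S \<in> T \<Longrightarrow> Y S \<in> Q" "\<And>S. S \<in> T \<Longrightarrow> colimit (models K) (Restr r S) D t (Y S) (\<kappa> S)"
      by metis
    let ?R = "inclusion_rel e T"
    note R = inclusion_rel[OF e]
    have "\<exists>u v. colimit (models K) ?R (\<lambda>x. Y (inv_into T e x)) u N v"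
    proof (rule M.colimit_of_subcolimits[OF r(3) e TF(1) Y(2)])
      show "\<exists>S''\<in>T. S \<subseteq> S'' \<and> S' \<subseteq> S''" if "S \<in> T" "S' \<in> T" for S S'
        using close[of "S \<union> S'"] TF[OF that(1)] TF[OF that(2)] card_of_Un_ordLess_infinite_Field[of \<beta> S S'] b(1)
        by (auto simp: cinfinite_def)
      show "\<exists>S\<in>T. i \<in> S" if "i \<in> Field r" for i
      proof -
        have "|{i}| <o \<beta>" using \<beta>(2) by (meson finite.intros finite_iff_ordLess_natLeq ordLess_transitive)
        then show ?thesis using close[of "{i}"] that by auto
      qed
    qed
    then obtain u v where col: "colimit (models K) ?R (\<lambda>x. Y (inv_into T e x)) u N v" by blast
    \<comment> \<open>Fewer than \<open>\<beta>\<close> members have a union of size below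
      \<open>\<beta>\<close> by regularity, and \<open>close\<close> puts it into one member of
      \<open>T\<close>.\<close>
    have dirR: "directed ?U \<beta> ?R"
      unfolding directed_def
    proof (intro conjI allI impI)
      show "Partial_order ?R" by (rule R(1))
      show "small ?U (Field ?R)" unfolding R(2) using smT by (rule small_image)
      fix A assume A: "A \<subseteq> Field ?R" "|A| <o \<beta>"
      define d where "d = inv_into T e"
      have dA: "d x \<in> T" "e (d x) = x" if "x \<in> A" for x
        using that A(1) R(2) unfolding d_def by (auto intro: inv_into_into f_inv_into_f)
      have "|\<Union>x\<in>A. d x| <o \<beta>"
        by (rule card_of_UNION_ordLess_infinite_Field_regularCard[OF b(2,1) A(2)]) (use dA TF in auto)
      moreover have "(\<Union>x\<in>A. d x) \<subseteq> Field r" using dA TF by blast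
      ultimately obtain S where S: "S \<in> T" "(\<Union>x\<in>A. d x) \<subseteq> S" using close by blast
      have "(x, e S) \<in> ?R" if "x \<in> A" for x
        using R(3)[OF dA(1)[OF that] S(1)] S(2) that dA(2)[OF that] by auto
      then show "\<exists>u\<in>Field ?R. \<forall>s\<in>A. (s, u) \<in> ?R" using S(1) R(2) by blast
    qed
    have nlb: "natLeq \<le>o \<beta>" using \<beta>(2) ordLess_imp_ordLeq by blast
    \<comment> \<open>\<open>X1\<close> and \<open>X2\<close> are presentable with respect to
      \<open>K\<close>, so the colimit has to be one in \<open>K\<close> as well.\<close>
    have colK: "colimit K ?R (\<lambda>x. Y (inv_into T e x)) u N v"
      by (rule M_preserves[OF directed_mono[OF dirR nlb] col])
    have diaK: "diagram K ?R (\<lambda>x. Y (inv_into T e x)) u" and cocK: "cocone K ?R (\<lambda>x. Y (inv_into T e x)) u N v"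
      using colK by (simp_all add: colimit_def)
    obtain i y1 where i: "i \<in> Field ?R" "y1 \<in> hom K X1 (Y (inv_into T e i))" "v i \<cdot> y1 = x1"
      using pres(1) dirR colK x1 unfolding presentable_def by blast
    obtain j y2 where j: "j \<in> Field ?R" "y2 \<in> hom K X2 (Y (inv_into T e j))" "v j \<cdot> y2 = x2"
      using pres(2) dirR colK x2 unfolding presentable_def by blast
    obtain l where l: "l \<in> Field ?R" "(i, l) \<in> ?R" "(j, l) \<in> ?R"
      using directed_pair[OF dirR nlb i(1) j(1)] by blast
    have "inv_into T e l \<in> T" using l(1) R(2) by (auto intro: inv_into_into)
    then have "Y (inv_into T e l) \<in> Q" by (rule Y(1))
    moreover have "v l \<in> hom K (Y (inv_into T e l)) N" using cocK l(1) by (simp add: cocone_def)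
    moreover have "u i l \<cdot> y1 \<in> hom K X1 (Y (inv_into T e l))"
      using i(2) diagramD(4-6)[OF diaK l(2)] by (auto simp: hom_def)
    moreover have "u j l \<cdot> y2 \<in> hom K X2 (Y (inv_into T e l))"
      using j(2) diagramD(4-6)[OF diaK l(3)] by (auto simp: hom_def)
    moreover have "v l \<cdot> (u i l \<cdot> y1) = x1"
      using reassoc1[OF coconeD(5)[OF cocK l(2)], of y1] i(2,3) diagramD(4-6)[OF diaK l(2)]
        coconeD(2-4)[OF cocK l(1)] by (auto simp: hom_def)
    moreover have "v l \<cdot> (u j l \<cdot> y2) = x2"
      using reassoc1[OF coconeD(5)[OF cocK l(3)], of y2] j(2,3) diagramD(4-6)[OF diaK l(3)]
        coconeD(2-4)[OF cocK l(1)] by (auto simp: hom_def)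
    ultimately show ?thesis by blast
  qed
  then show ?thesis using smQ QM by auto
qed

text \<open>A pair \<open>[x, f]\<close> stands for the type of \<open>x\<close> over
  \<open>M\<close>. It is already realized in some member of \<open>Q\<close>, and the members of
  \<open>Q\<close> admit only a small set of such pairs.\<close>

lemma (in amalgamation) small_types:
  assumes X: "X \<in> Obj K" and M: "M \<in> Mod K"
  shows "\<exists>T. small (Univ K) T \<and> (\<forall>(N, x, f)\<in>T. into K x N \<and> extension K M f N) \<and>
    (\<forall>N x f. into K x N \<longrightarrow> Dom K x = X \<longrightarrow> extension K M f N \<longrightarrow>
      (\<exists>(N', x', f')\<in>T. gtp_eq K [x, f] N [x', f'] N'))"
proof -
  obtain Q where Q: "small (Univ K) Q" "Q \<subseteq> Mod K"
    and fac: "\<And>N x1 x2. N \<in> Mod K \<Longrightarrow> x1 \<in> hom K X N \<Longrightarrow> x2 \<in> hom K M N \<Longrightarrow>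
    \<exists>N0\<in>Q. \<exists>n\<in>hom K N0 N. \<exists>y1\<in>hom K X N0. \<exists>y2\<in>hom K M N0. n \<cdot> y1 = x1 \<and> n \<cdot> y2 = x2"
    using small_submodels[OF X Mod_Obj[OF M]] by blast
  define T where "T = (SIGMA N : Q. hom K X N \<times> hom K M N)"
  have "small (Univ K) T"
    unfolding T_def using Q X M by (intro small_Sigma small_hom) auto
  moreover have "\<forall>(N, x, f)\<in>T. into K x N \<and> extension K M f N"
    using Q(2) M by (auto simp: T_def into_def hom_def extension_iff)
  moreover have "\<exists>(N', x', f')\<in>T. gtp_eq K [x, f] N [x', f'] N'"
    if "into K x N" "Dom K x = X" "extension K M f N" for N x f
  proof -
    have "N \<in> Mod K" "x \<in> hom K X N" "f \<in> hom K M N" using that by (auto simp: into_def hom_def extension_iff)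
    from fac[OF this] obtain N0 n y1 y2 where N0: "N0 \<in> Q" "n \<in> hom K N0 N" "y1 \<in> hom K X N0" "y2 \<in> hom K M N0"
      "n \<cdot> y1 = x" "n \<cdot> y2 = f" by blast
    have "extension K N0 n N" "into K y1 N0" "into K y2 N0"
      using N0 Q(2) \<open>N \<in> Mod K\<close> by (auto simp: extension_def into_def hom_def)
    from gtp_ext[OF this(1), of "[y1, y2]"] this(2,3) have "gtp_eq K [x, f] N [y1, y2] N0" using N0 by simp
    then show ?thesis using N0 unfolding T_def by blast
  qed
  ultimately show ?thesis by blast
qed

section \<open>Chains of models\<close>

lemma underS_nonempty_limit: "Well_order r \<Longrightarrow> olimit r l \<Longrightarrow> ozero r \<in> underS r l"
proof -
  assume wo: "Well_order r" and l: "olimit r l"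
  then interpret wo_rel r by unfold_locales
  have "l \<in> Field r" "l \<noteq> ozero r" using l by (auto simp: olimit_def)
  then show ?thesis using ozero_in[of] by (auto simp: Order_Relation.underS_def)
qed

context universe
begin

lemma directed_Restr:
  assumes "Well_order r" "small U (Field r)" "A \<subseteq> Field r" "A \<noteq> {}"
  shows "directed U natLeq (Restr r A)"
proof -
  interpret wo_rel r using assms(1) by unfold_locales
  have refl: "Refl r" and po: "Partial_order r" using assms(1) by (auto simp: order_on_defs)
  have F: "Field (Restr r A) = A" using Field_Restr_sub[OF refl assms(3)] .
  show ?thesis
  proof (rule directed_natLeqI[OF Partial_order_Restr[OF po]], unfold F)
    show "small U A" using assms small_subset by blast
    show "\<forall>i\<in>A. \<forall>j\<in>A. \<exists>u\<in>A. (i, u) \<in> Restr r A \<and> (j, u) \<in> Restr r A"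
    proof (intro ballI)
      fix i j assume ij: "i \<in> A" "j \<in> A"
      then have "(i, i) \<in> r" "(j, j) \<in> r" "(i, j) \<in> r \<or> (j, i) \<in> r"
        using refl TOTALS assms(3) by (auto simp: refl_on_def)
      then show "\<exists>u\<in>A. (i, u) \<in> Restr r A \<and> (j, u) \<in> Restr r A" using ij by blast
    qed
  qed fact
qed

lemma directed_underS:
  assumes "regular_cardinal U \<nu>" "olimit \<nu> l"
  shows "directed U natLeq (Restr \<nu> (underS \<nu> l))"
proof (rule directed_Restr)
  show "underS \<nu> l \<subseteq> Field \<nu>" by (auto simp: underS_def Field_def)
  show "underS \<nu> l \<noteq> {}"
    using underS_nonempty_limit[OF regular_cardinalD(5)[OF assms(1)] assms(2)] by blast
qed (rule regular_cardinalD(5)[OF assms(1)] regular_small_Field[OF assms(1)])+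

lemma directed_regular:
  assumes "regular_cardinal U \<nu>"
  shows "directed U natLeq \<nu>"
  by (rule directed_mono[OF regular_directed[OF assms] natLeq_le_Cinfinite[OF regular_cardinalD(1)[OF assms]]])

end

lemma (in wo_rel) Field_Restr_underS: "Field (Restr r (underS l)) = underS l"
  by (rule Field_Restr_sub[OF REFL]) (auto simp: Order_Relation.underS_def Field_def)

locale ordinal = universe U for U :: "'u rel" +
  fixes \<nu> :: "'u rel"
  assumes regular: "regular_cardinal U \<nu>"
begin

sublocale wo_rel \<nu>
  using regular_cardinalD(5)[OF regular] by unfold_locales

lemma Cinf: "Cinfinite \<nu>"
  using regular_cardinalD(1)[OF regular] .

lemma Field_ne: "Field \<nu> \<noteq> {}"
  using Cinf by (auto simp: cinfinite_def)

lemma zero_in [simp]: "ozero \<nu> \<in> Field \<nu>" and zero_le [simp]: "i \<in> Field \<nu> \<Longrightarrow> (ozero \<nu>, i) \<in> \<nu>"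
  using ozero_in[OF Field_ne] by auto

lemma suc_in [simp]: "i \<in> Field \<nu> \<Longrightarrow> osuc \<nu> i \<in> Field \<nu>"
  and le_suc [simp]: "i \<in> Field \<nu> \<Longrightarrow> (i, osuc \<nu> i) \<in> \<nu>"
  and suc_ne: "i \<in> Field \<nu> \<Longrightarrow> osuc \<nu> i \<noteq> i"
  and suc_le: "i \<in> Field \<nu> \<Longrightarrow> (i, j) \<in> \<nu> \<Longrightarrow> i \<noteq> j \<Longrightarrow> (osuc \<nu> i, j) \<in> \<nu>"
  and le_of_le_suc: "i \<in> Field \<nu> \<Longrightarrow> (j, osuc \<nu> i) \<in> \<nu> \<Longrightarrow> j \<noteq> osuc \<nu> i \<Longrightarrow> (j, i) \<in> \<nu>"
  using osuc_in[OF _ Cinfinite_no_max[OF Cinf]] by blast+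

lemma le_refl [simp]: "i \<in> Field \<nu> \<Longrightarrow> (i, i) \<in> \<nu>"
  using REFL by (simp add: refl_on_def)

lemma le_antisym: "(i, j) \<in> \<nu> \<Longrightarrow> (j, i) \<in> \<nu> \<Longrightarrow> i = j"
  using ANTISYM by (rule antisymD)

lemma le_Field: "(i, j) \<in> \<nu> \<Longrightarrow> i \<in> Field \<nu>" "(i, j) \<in> \<nu> \<Longrightarrow> j \<in> Field \<nu>"
  by (auto simp: Field_def)

end

section \<open>Chains of models and amalgamation of small families\<close>

context amalgamation
begin

lemma models_colimit_exists:
  assumes "directed (Univ K) natLeq r" "diagram (models K) r D t"
  obtains X k where "colimit (models K) r D t X k"
  using M_directed_colimits assms unfolding has_directed_colimits_def by blast

text \<open>The recursion with a trivial invariant and with colimits at limits. The step sees only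
  the arrow \<open>x\<close> from the first model to the current one, which suffices for tasks
  stated over \<open>M\<close>.\<close>

lemma models_chain:
  assumes \<nu>: "regular_cardinal (Univ K) \<nu>" and M: "M \<in> Mod K"
    and step: "\<And>p x N. p \<in> Field \<nu> \<Longrightarrow> extension K M x N \<Longrightarrow> \<exists>f N'. extension K N f N' \<and> S p x f"
  shows "\<exists>D t W m. diagram (models K) \<nu> D t \<and> D (ozero \<nu>) = M \<and>
    (\<forall>l. olimit \<nu> l \<longrightarrow> colimit (models K) (Restr \<nu> (underS \<nu> l)) D t (D l) (\<lambda>i. t i l)) \<and>
    cocone (models K) \<nu> D t W m \<and> (\<forall>p\<in>Field \<nu>. S p (t (ozero \<nu>) p) (t p (osuc \<nu> p)))"
proof -
  interpret \<nu>: ordinal "Univ K" \<nu> using \<nu> by unfold_locales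
  let ?L = "\<lambda>l D t X k. colimit (models K) (Restr \<nu> (underS \<nu> l)) D t X k"
  note FR = \<nu>.Field_Restr_underS
  have "\<exists>D t. diagram (models K) \<nu> D t \<and> D (ozero \<nu>) = M \<and> (\<forall>j\<in>Field \<nu>. True) \<and>
    (\<forall>p\<in>Field \<nu>. S p (t (ozero \<nu>) p) (t p (osuc \<nu> p))) \<and>
    (\<forall>l. olimit \<nu> l \<longrightarrow> ?L l D t (D l) (\<lambda>i. t i l))"
  proof (rule M.chain_exists_cases[where P = "\<lambda>_ _. True", OF \<nu>.Cinf])
    show "M \<in> Obj (models K)" using M by simp
    show "?L l D' t' X k'" if "\<forall>i\<in>underS \<nu> l. D i = D' i \<and> k i = k' i"
      "\<forall>i j. (i, j) \<in> \<nu> \<longrightarrow> j \<in> underS \<nu> l \<longrightarrow> t i j = t' i j" "?L l D t X k" for l D t X k D' t' k'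
      by (rule colimit_cong[OF that(3)]) (use that FR in auto)
    show "\<exists>f. f \<in> Arr (models K) \<and> Dom (models K) f = D p \<and> S p (t (ozero \<nu>) p) f \<and> True"
      if p: "p \<in> Field \<nu>" and d: "diagram (models K) (Restr \<nu> (under \<nu> p)) D t" "D (ozero \<nu>) = M" for p D t
    proof -
      have "(ozero \<nu>, p) \<in> Restr \<nu> (under \<nu> p)" using p by (simp add: under_def)
      from M.diagramD(4-6)[OF d(1) this] have "extension K M (t (ozero \<nu>) p) (D p)"
        using d(2) by (auto simp: extension_iff)
      from step[OF p this] show ?thesis by (auto simp: extension_iff)
    qed
    show "\<exists>X k. cocone (models K) (Restr \<nu> (underS \<nu> l)) D t X k \<and> ?L l D t X k \<and> True"
      if "olimit \<nu> l" "diagram (models K) (Restr \<nu> (underS \<nu> l)) D t" for l D t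
      using models_colimit_exists[OF directed_underS[OF \<nu> that(1)] that(2)] by (metis colimit_def)
  qed auto
  then obtain D t where Dt: "diagram (models K) \<nu> D t" "D (ozero \<nu>) = M"
    "\<forall>p\<in>Field \<nu>. S p (t (ozero \<nu>) p) (t p (osuc \<nu> p))" "\<forall>l. olimit \<nu> l \<longrightarrow> ?L l D t (D l) (\<lambda>i. t i l)" by blast
  obtain W m where "colimit (models K) \<nu> D t W m"
    using models_colimit_exists[OF directed_regular[OF \<nu>] Dt(1)] by blast
  then have "cocone (models K) \<nu> D t W m" by (simp add: colimit_def)
  then show ?thesis using Dt by blast
qed

lemma models_diagram_ext:
  assumes "diagram (models K) r D t" "(i, j) \<in> r"
  shows "extension K (D i) (t i j) (D j)"
  using M.diagramD(4-6)[OF assms] by (auto simp: extension_iff)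

lemma models_cocone_ext:
  assumes "cocone (models K) r D t W m" "i \<in> Field r"
  shows "extension K (D i) (m i) W"
  using M.coconeD(1-4)[OF assms(1)] assms(2) by (auto simp: extension_iff)

text \<open>The members are amalgamated one after the other along a chain of regular length at least
  the size of \<open>T\<close>; everything commutes over \<open>M\<close>, the first model of the
  chain.\<close>

lemma amalgamate_family:
  assumes T: "small (Univ K) T" and M: "M \<in> Mod K" and f: "\<And>p. p \<in> T \<Longrightarrow> extension K M (f p) (N p)"
  shows "\<exists>W w g. extension K M w W \<and> (\<forall>p\<in>T. extension K (N p) (g p) W \<and> g p \<cdot> f p = w)"
proof -
  obtain \<nu> where \<nu>: "regular_cardinal (Univ K) \<nu>" "|T| <o \<nu>" using regular_above_small[OF T] by blast
  interpret \<nu>: ordinal "Univ K" \<nu> using \<nu> by unfold_locales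
  have "|T| \<le>o \<nu>" using \<nu>(2) ordLess_imp_ordLeq by blast
  also have "\<nu> =o |Field \<nu>|" using regular_cardinalD(4)[OF \<nu>(1)] card_of_Field_ordIso ordIso_symmetric by blast
  finally have "|T| \<le>o |Field \<nu>|" .
  then obtain e where e: "inj_on e T" "e ` T \<subseteq> Field \<nu>" unfolding card_of_ordLeq[symmetric] by blast
  \<comment> \<open>Stage \<open>e q\<close> takes care of \<open>q\<close>; stages outside the
    range of \<open>e\<close> do nothing.\<close>
  let ?S = "\<lambda>p x y. \<forall>q\<in>T. e q = p \<longrightarrow> (\<exists>g. extension K (N q) g (Cod K y) \<and> g \<cdot> f q = y \<cdot> x)"
  have "\<exists>y N'. extension K N1 y N' \<and> ?S p x y" if x: "extension K M x N1" for p x N1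
  proof (cases "\<exists>q\<in>T. e q = p")
    case True
    then obtain q where q: "q \<in> T" "e q = p" by blast
    obtain N' y g where a: "extension K N1 y N'" "extension K (N q) g N'" "y \<cdot> x = g \<cdot> f q"
      using amalgamate[OF x f[OF q(1)]] by blast
    have "q' = q" if "q' \<in> T" "e q' = p" for q' using that q e(1) by (auto dest: inj_onD)
    then have "?S p x y" using a by (auto simp: extension_iff)
    then show ?thesis using a by blast
  next
    case False
    moreover have "extension K N1 (Ident K N1) N1" using x extension_Ident by (simp add: extension_iff)
    ultimately show ?thesis by blast
  qed
  from models_chain[OF \<nu>(1) M, of ?S, OF this]
  obtain D t W m where d: "diagram (models K) \<nu> D t" "D (ozero \<nu>) = M" "cocone (models K) \<nu> D t W m"
    and S: "\<And>p. p \<in> Field \<nu> \<Longrightarrow> ?S p (t (ozero \<nu>) p) (t p (osuc \<nu> p))" by blast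
  have w: "extension K M (m (ozero \<nu>)) W" using models_cocone_ext[OF d(3), of "ozero \<nu>"] d(2) by simp
  have "\<exists>g. extension K (N q) g W \<and> g \<cdot> f q = m (ozero \<nu>)" if q: "q \<in> T" for q
  proof -
    have p: "e q \<in> Field \<nu>" using e(2) q by auto
    let ?p = "e q" and ?z = "ozero \<nu>"
    have t1: "extension K M (t ?z ?p) (D ?p)" using models_diagram_ext[OF d(1), of ?z ?p] p d(2) by simp
    have t2: "extension K (D ?p) (t ?p (osuc \<nu> ?p)) (D (osuc \<nu> ?p))" using models_diagram_ext[OF d(1)] p by simp
    have m2: "extension K (D (osuc \<nu> ?p)) (m (osuc \<nu> ?p)) W" using models_cocone_ext[OF d(3)] p by simp
    obtain g where g: "extension K (N q) g (D (osuc \<nu> ?p))" "g \<cdot> f q = t ?p (osuc \<nu> ?p) \<cdot> t ?z ?p"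
      using S[OF p] q t2 by (auto simp: extension_iff)
    have "m (osuc \<nu> ?p) \<cdot> (t ?p (osuc \<nu> ?p) \<cdot> t ?z ?p) = m ?p \<cdot> t ?z ?p"
      by (rule reassoc1) (use t1 t2 m2 M.coconeD(5)[OF d(3)] p in \<open>auto simp: extension_iff\<close>)
    also have "\<dots> = m ?z" using M.coconeD(5)[OF d(3), of ?z ?p] p by simp
    finally have "(m (osuc \<nu> ?p) \<cdot> g) \<cdot> f q = m ?z"
      using g m2 f[OF q] by (simp add: extension_iff)
    then show ?thesis using extension_Comp[OF g(1) m2] by blast
  qed
  then show ?thesis using w by metis
qed

lemma sub_in_ext:
  assumes "sub_in K c B" "into K c M" "extension K M f N"
  shows "sub_in K (f \<cdot> c) B"
proof -
  obtain c' where c': "sub_eq K c c'" "Dom K c' \<in> B" using assms(1) unfolding sub_in_def by blast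
  have i: "c' \<in> Arr K" "Cod K c' = M" using c'(1) assms(2) sub_le_Cod[of c' c] unfolding sub_eq_def into_def by auto
  then have "sub_eq K (f \<cdot> c) (f \<cdot> c')" using sub_eq_post[OF c'(1)] assms(3) by (simp add: extension_iff)
  moreover have "Dom K (f \<cdot> c') \<in> B" using i assms(3) c'(2) by (simp add: extension_iff)
  ultimately show ?thesis unfolding sub_in_def by blast
qed

section \<open>Isi-dividing and isi-forking\<close>

lemma initial_segments_ext:
  assumes i: "initial_segments K \<nu> N a D t m" and f: "extension K N f P" and \<nu>: "regular_cardinal (Univ K) \<nu>"
  shows "initial_segments K \<nu> P (\<lambda>i. f \<cdot> a i) D t (\<lambda>i. f \<cdot> m i)"
proof -
  interpret \<nu>: ordinal "Univ K" \<nu> using \<nu> by unfold_locales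
  have c: "cocone (models K) \<nu> D t N m" and d: "diagram (models K) \<nu> D t" and
    a: "\<And>i. i \<in> Field \<nu> \<Longrightarrow> into K (a i) N" "\<And>i. i \<in> Field \<nu> \<Longrightarrow> sub_le K (a i) (m (osuc \<nu> i))"
    using i by (auto simp: initial_segments_def)
  have "cocone (models K) \<nu> D t P (\<lambda>i. f \<cdot> m i)"
    using M.cocone_post[OF c d, of f] f by (simp add: extension_iff)
  moreover have "sub_le K (f \<cdot> a i) (f \<cdot> m (osuc \<nu> i))" if "i \<in> Field \<nu>" for i
    using sub_le_post[OF a(2)[OF that]] models_cocone_ext[OF c, of "osuc \<nu> i"] that f by (simp add: extension_iff)
  moreover have "into K (f \<cdot> a i) P" if "i \<in> Field \<nu>" for i using into_ext[OF a(1)[OF that] f] .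
  moreover have "Dom K (f \<cdot> a i) = Dom K (a i)" if "i \<in> Field \<nu>" for i
    using a(1)[OF that] f by (simp add: extension_iff into_def)
  ultimately show ?thesis using i unfolding initial_segments_def by metis
qed

lemma isi_sequence_ext:
  assumes s: "isi_sequence K \<nu> c N a" and f: "extension K N f P" and \<nu>: "regular_cardinal (Univ K) \<nu>"
  shows "isi_sequence K \<nu> (f \<cdot> c) P (\<lambda>i. f \<cdot> a i)"
proof -
  interpret \<nu>: ordinal "Univ K" \<nu> using \<nu> by unfold_locales
  obtain D t m where i: "initial_segments K \<nu> N a D t m" and c: "sub_le K c (m (ozero \<nu>))"
    and g: "\<And>i j. (i, j) \<in> \<nu> \<Longrightarrow> gtp_eq K [a i, m i] N [a j, m i] N"
    using s unfolding isi_sequence_def by blast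
  have co: "cocone (models K) \<nu> D t N m" using i by (auto simp: initial_segments_def)
  have "sub_le K (f \<cdot> c) (f \<cdot> m (ozero \<nu>))"
    using sub_le_post[OF c] models_cocone_ext[OF co, of "ozero \<nu>"] f by (simp add: extension_iff)
  moreover have "gtp_eq K [f \<cdot> a i, f \<cdot> m i] P [f \<cdot> a j, f \<cdot> m i] P" if "(i, j) \<in> \<nu>" for i j
  proof -
    have "into K (a i) N" "into K (a j) N" "into K (m i) N" using gtp_into[OF g[OF that]] by auto
    then show ?thesis using g[OF that] gtp_ext2[OF f] gtp_sym by meson
  qed
  ultimately show ?thesis using initial_segments_ext[OF i f \<nu>] unfolding isi_sequence_def by blast
qed

lemma ext_assoc:
  assumes "extension K M f N" "extension K N g P" "into K a M"
  shows "(g \<cdot> f) \<cdot> a = g \<cdot> (f \<cdot> a)"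
  using assms by (simp add: extension_iff into_def)

text \<open>The extensions carrying the sequences are amalgamated with \<open>N\<close> over
  \<open>M\<close>; a realization above the amalgam is also one for the original sequence. It allows
  dividing witnesses from different models to be collected in one extension.\<close>

lemma isi_divides_ext:
  assumes d: "isi_divides K a b c M" and f: "extension K M f N" and i: "into K a M" "into K b M" "into K c M"
  shows "isi_divides K (f \<cdot> a) (f \<cdot> b) (f \<cdot> c) N"
proof -
  obtain \<mu> where \<mu>: "regular_cardinal (Univ K) \<mu>"
    and H: "\<And>\<nu>. regular_cardinal (Univ K) \<nu> \<Longrightarrow> \<mu> \<le>o \<nu> \<Longrightarrow>
           \<exists>N f bs. extension K M f N \<and> isi_sequence K \<nu> (f \<cdot> c) N bs \<and>
              (\<forall>i \<in> Field \<nu>. gtp_eq K [bs i, f \<cdot> c] N [b, c] M) \<and>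
              (\<exists>\<kappa>. regular_cardinal (Univ K) \<kappa> \<and> \<kappa> <o \<nu> \<and>
                 (\<forall>I \<subseteq> Field \<nu>. |I| =o \<kappa> \<longrightarrow> \<not> consistent_for K a b c M f N bs I))"
    using d unfolding isi_divides_def divides_along_def by blast
  have "\<exists>W y bs. extension K N y W \<and> isi_sequence K \<nu> (y \<cdot> (f \<cdot> c)) W bs \<and>
              (\<forall>i \<in> Field \<nu>. gtp_eq K [bs i, y \<cdot> (f \<cdot> c)] W [f \<cdot> b, f \<cdot> c] N) \<and>
              (\<exists>\<kappa>. regular_cardinal (Univ K) \<kappa> \<and> \<kappa> <o \<nu> \<and>
                 (\<forall>I \<subseteq> Field \<nu>. |I| =o \<kappa> \<longrightarrow> \<not> consistent_for K (f \<cdot> a) (f \<cdot> b) (f \<cdot> c) N y W bs I))"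
    if \<nu>: "regular_cardinal (Univ K) \<nu>" "\<mu> \<le>o \<nu>" for \<nu>
  proof -
    obtain N1 f1 bs \<kappa> where N1: "extension K M f1 N1" "isi_sequence K \<nu> (f1 \<cdot> c) N1 bs"
      and g0: "\<forall>i\<in>Field \<nu>. gtp_eq K [bs i, f1 \<cdot> c] N1 [b, c] M"
      and \<kappa>: "regular_cardinal (Univ K) \<kappa>" "\<kappa> <o \<nu>"
      and n0: "\<forall>I \<subseteq> Field \<nu>. |I| =o \<kappa> \<longrightarrow> \<not> consistent_for K a b c M f1 N1 bs I"
      using H[OF \<nu>] by (elim exE conjE) (rule that)
    have g: "\<And>i. i \<in> Field \<nu> \<Longrightarrow> gtp_eq K [bs i, f1 \<cdot> c] N1 [b, c] M" using g0 by blast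
    have n: "\<And>I. I \<subseteq> Field \<nu> \<Longrightarrow> |I| =o \<kappa> \<Longrightarrow> \<not> consistent_for K a b c M f1 N1 bs I"
      using n0 by blast
    obtain W x y where W: "extension K N1 x W" "extension K N y W" "x \<cdot> f1 = y \<cdot> f"
      using amalgamate[OF N1(1) f] by blast
    have eq: "y \<cdot> (f \<cdot> d) = x \<cdot> (f1 \<cdot> d)" if "into K d M" for d
      by (rule reassoc[OF W(3)[symmetric]]) (use that f N1 W in \<open>auto simp: extension_iff into_def\<close>)
    have "isi_sequence K \<nu> (y \<cdot> (f \<cdot> c)) W (\<lambda>i. x \<cdot> bs i)"
      using isi_sequence_ext[OF N1(2) W(1) \<nu>(1)] eq[OF i(3)] by simp
    moreover have "gtp_eq K [x \<cdot> bs j, y \<cdot> (f \<cdot> c)] W [f \<cdot> b, f \<cdot> c] N" if j: "j \<in> Field \<nu>" for j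
    proof -
      have "gtp_eq K [x \<cdot> bs j, x \<cdot> (f1 \<cdot> c)] W [b, c] M"
        using g[OF j] gtp_into[OF g[OF j]] gtp_ext2[OF W(1)] by simp
      moreover have "gtp_eq K [b, c] M [f \<cdot> b, f \<cdot> c] N" using gtp_ext[OF f, of "[b, c]"] gtp_sym i by simp
      ultimately show ?thesis using gtp_trans eq[OF i(3)] by simp
    qed
    moreover have "\<not> consistent_for K (f \<cdot> a) (f \<cdot> b) (f \<cdot> c) N y W (\<lambda>i. x \<cdot> bs i) I"
      if I: "I \<subseteq> Field \<nu>" "|I| =o \<kappa>" for I
    proof
      assume "consistent_for K (f \<cdot> a) (f \<cdot> b) (f \<cdot> c) N y W (\<lambda>i. x \<cdot> bs i) I"
      then obtain N' h a' where h: "extension K W h N'" "into K a' N'"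
        "\<And>j. j \<in> I \<Longrightarrow> gtp_eq K [a', h \<cdot> (x \<cdot> bs j), h \<cdot> (y \<cdot> (f \<cdot> c))] N' [f \<cdot> a, f \<cdot> b, f \<cdot> c] N"
        unfolding consistent_for_def by blast
      have "gtp_eq K [a', (h \<cdot> x) \<cdot> bs j, (h \<cdot> x) \<cdot> (f1 \<cdot> c)] N' [a, b, c] M" if j: "j \<in> I" for j
      proof -
        have bj: "into K (bs j) N1" "into K (f1 \<cdot> c) N1"
          using gtp_into[OF g] j I(1) into_ext[OF i(3) N1(1)] by auto
        have "gtp_eq K [f \<cdot> a, f \<cdot> b, f \<cdot> c] N [a, b, c] M" using gtp_ext[OF f, of "[a, b, c]"] i by simp
        with h(3)[OF j] have "gtp_eq K [a', h \<cdot> (x \<cdot> bs j), h \<cdot> (y \<cdot> (f \<cdot> c))] N' [a, b, c] M"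
          using gtp_trans by blast
        then show ?thesis using ext_assoc[OF W(1) h(1)] bj eq[OF i(3)] by simp
      qed
      then have "consistent_for K a b c M f1 N1 bs I"
        using extension_Comp[OF W(1) h(1)] h(2) unfolding consistent_for_def by blast
      then show False using n[OF I] by blast
    qed
    ultimately show ?thesis using W(2) \<kappa> by blast
  qed
  then show ?thesis using \<mu> unfolding isi_divides_def divides_along_def by blast
qed

text \<open>Composing with \<open>f\<close> turns extensions of \<open>N\<close> into extensions of
  \<open>M\<close>, so a forking witness above \<open>N\<close> is one above
  \<open>M\<close>.\<close>

lemma isi_f_indep_ext:
  assumes d: "isi_f_indep K M a c b" and f: "extension K M f N"
  shows "isi_f_indep K N (f \<cdot> a) (f \<cdot> c) (f \<cdot> b)"
proof -
  have i: "into K a M" "into K c M" "into K b M" and nf: "\<not> isi_forks K a b c M"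
    using d by (auto simp: isi_f_indep_def)
  have "\<not> isi_forks K (f \<cdot> a) (f \<cdot> b) (f \<cdot> c) N"
  proof
    assume "isi_forks K (f \<cdot> a) (f \<cdot> b) (f \<cdot> c) N"
    then obtain N1 f1 and J :: "'u set" and as ds where N1: "extension K N f1 N1" "small (Univ K) J"
      "\<And>j. j \<in> J \<Longrightarrow> into K (as j) N1 \<and> into K (ds j) N1 \<and> Dom K (as j) = Dom K (f \<cdot> a) \<and>
           isi_divides K (as j) (ds j) (f1 \<cdot> (f \<cdot> c)) N1"
      "\<And>N' g a'. extension K N1 g N' \<Longrightarrow> into K a' N' \<Longrightarrow>
           gtp_eq K [a', g \<cdot> (f1 \<cdot> (f \<cdot> b)), g \<cdot> (f1 \<cdot> (f \<cdot> c))] N'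
                    [f1 \<cdot> (f \<cdot> a), f1 \<cdot> (f \<cdot> b), f1 \<cdot> (f \<cdot> c)] N1 \<Longrightarrow>
           (\<exists>j \<in> J. gtp_eq K [a', g \<cdot> ds j, g \<cdot> (f1 \<cdot> (f \<cdot> c))] N' [as j, ds j, f1 \<cdot> (f \<cdot> c)] N1)"
      unfolding isi_forks_def by blast
    have "Dom K (f \<cdot> a) = Dom K a" using i f by (simp add: extension_iff into_def)
    then have "isi_forks K a b c M"
      unfolding isi_forks_def
      using extension_Comp[OF f N1(1)] N1(2-4) ext_assoc[OF f N1(1)] i
      by (intro exI[of _ N1] exI[of _ "f1 \<cdot> f"] exI[of _ J] exI[of _ as] exI[of _ ds]) simp
    then show False using nf by blast
  qed
  then show ?thesis using i into_ext[OF _ f] by (simp add: isi_f_indep_def)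
qed

text \<open>
  Otherwise every type over \<open>M\<close> extending \<open>gtp(a, c)\<close> isi-forks. There are only a small number of such
  types, so their forking witnesses can be amalgamated into one for \<open>gtp(a, c)\<close>.
\<close>

lemma isi_f_indep_extension:
  assumes ac: "isi_f_indep K M a c c"
  shows "\<exists>N f a'. extension K M f N \<and> into K a' N \<and> gtp_eq K [a', f \<cdot> c] N [a, c] M \<and> isi_f_indep K N a' (f \<cdot> c) f"
proof (rule ccontr)
  assume neg: "\<not> ?thesis"
  have i: "into K a M" "into K c M" and nf: "\<not> isi_forks K a c c M" using ac by (auto simp: isi_f_indep_def)
  have M: "M \<in> Mod K" using i by (simp add: into_def)
  have Da: "Dom K a \<in> Obj K" using i by (simp add: into_def)
  obtain T where T: "small (Univ K) T"
    and cov: "\<And>N x f. into K x N \<Longrightarrow> Dom K x = Dom K a \<Longrightarrow> extension K M f N \<Longrightarrow>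
      \<exists>(N', x', f')\<in>T. gtp_eq K [x, f] N [x', f'] N'"
    using small_types[OF Da M] by blast
  \<comment> \<open>Representatives of the types over \<open>M\<close> that extend
    \<open>gtp(a, c; M)\<close>. By the assumption \<open>neg\<close> each of them forks over
    \<open>c\<close>.\<close>
  define R where "R = {p \<in> T. case p of (N, x, f) \<Rightarrow> extension K M f N \<and> into K x N \<and> gtp_eq K [x, f \<cdot> c] N [a, c] M}"
  define wit where "wit p N' g (J :: 'u set) as ds \<longleftrightarrow> (case p of (N, x, f) \<Rightarrow> extension K N g N' \<and> small (Univ K) J \<and>
      (\<forall>j \<in> J. into K (as j) N' \<and> into K (ds j) N' \<and> Dom K (as j) = Dom K x \<and>
           isi_divides K (as j) (ds j) (g \<cdot> (f \<cdot> c)) N') \<and>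
      (\<forall>N'' h a'. extension K N' h N'' \<longrightarrow> into K a' N'' \<longrightarrow>
           gtp_eq K [a', h \<cdot> (g \<cdot> f), h \<cdot> (g \<cdot> (f \<cdot> c))] N'' [g \<cdot> x, g \<cdot> f, g \<cdot> (f \<cdot> c)] N' \<longrightarrow>
           (\<exists>j \<in> J. gtp_eq K [a', h \<cdot> ds j, h \<cdot> (g \<cdot> (f \<cdot> c))] N'' [as j, ds j, g \<cdot> (f \<cdot> c)] N')))"
    for p N' g J and as ds :: "'u \<Rightarrow> 'a"
  have "\<forall>p\<in>R. \<exists>N' g J as ds. wit p N' g J as ds"
  proof
    fix p assume "p \<in> R"
    then obtain N x f where p: "p = (N, x, f)" "extension K M f N" "into K x N" "gtp_eq K [x, f \<cdot> c] N [a, c] M"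
      unfolding R_def by blast
    have "\<not> isi_f_indep K N x (f \<cdot> c) f" using neg p by blast
    then have "isi_forks K x f (f \<cdot> c) N"
      using p into_ext[OF i(2) p(2)] extension_into[OF p(2)] by (simp add: isi_f_indep_def)
    then show "\<exists>N' g J as ds. wit p N' g J as ds"
      unfolding wit_def p(1) isi_forks_def prod.case .
  qed
  then obtain N' g J as ds where "\<forall>p\<in>R. wit p (N' p) (g p) (J p) (as p) (ds p)" by metis
  then have W: "extension K N (g (N, x, f)) (N' (N, x, f))" "small (Univ K) (J (N, x, f))"
      "\<And>j. j \<in> J (N, x, f) \<Longrightarrow> into K (as (N, x, f) j) (N' (N, x, f)) \<and> into K (ds (N, x, f) j) (N' (N, x, f)) \<and>
           Dom K (as (N, x, f) j) = Dom K x \<and>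
           isi_divides K (as (N, x, f) j) (ds (N, x, f) j) (g (N, x, f) \<cdot> (f \<cdot> c)) (N' (N, x, f))"
      "\<And>N'' h a'. extension K (N' (N, x, f)) h N'' \<Longrightarrow> into K a' N'' \<Longrightarrow>
           gtp_eq K [a', h \<cdot> (g (N, x, f) \<cdot> f), h \<cdot> (g (N, x, f) \<cdot> (f \<cdot> c))] N''
             [g (N, x, f) \<cdot> x, g (N, x, f) \<cdot> f, g (N, x, f) \<cdot> (f \<cdot> c)] (N' (N, x, f)) \<Longrightarrow>
           \<exists>j \<in> J (N, x, f). gtp_eq K [a', h \<cdot> ds (N, x, f) j, h \<cdot> (g (N, x, f) \<cdot> (f \<cdot> c))] N''
             [as (N, x, f) j, ds (N, x, f) j, g (N, x, f) \<cdot> (f \<cdot> c)] (N' (N, x, f))"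
    if "(N, x, f) \<in> R" for N x f
    using that unfolding wit_def by (blast, blast, blast, blast)
  have smR: "small (Univ K) R" using T by (rule small_subset) (auto simp: R_def)
  have R: "extension K M f N" "into K x N" "gtp_eq K [x, f \<cdot> c] N [a, c] M" if "(N, x, f) \<in> R" for N x f
    using that by (auto simp: R_def)
  have Rx: "Dom K x = Dom K a" if "(N, x, f) \<in> R" for N x f using gtp_Dom[OF R(3)[OF that]] by simp
  define ff where "ff p = (case p of (N, x, f) \<Rightarrow> g p \<cdot> f)" for p
  have ff: "extension K M (ff p) (N' p)" if "p \<in> R" for p
    using extension_Comp[OF R(1) W(1)] that unfolding ff_def by (cases p) auto
  obtain V w v where V: "extension K M w V" "\<And>p. p \<in> R \<Longrightarrow> extension K (N' p) (v p) V"
    "\<And>p. p \<in> R \<Longrightarrow> v p \<cdot> ff p = w"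
    using amalgamate_family[OF smR M, of ff N'] ff by metis
  \<comment> \<open>The combined family is indexed by a type together with an index of its own
    forking family; \<open>e\<close> codes such pairs in \<open>'u\<close>, as
    \<open>isi_forks\<close> requires.\<close>
  define JJ where "JJ = (SIGMA p : R. J p)"
  have "small (Univ K) JJ" unfolding JJ_def using W(2) by (intro small_Sigma smR) auto
  then obtain e :: "('o \<times> 'a \<times> 'a) \<times> 'u \<Rightarrow> 'u" where e: "inj_on e JJ" using small_inj by blast
  define d where "d = inv_into JJ e"
  have de: "d (e q) = q" if "q \<in> JJ" for q using that e by (simp add: d_def)
  define as' where "as' j = v (fst (d j)) \<cdot> as (fst (d j)) (snd (d j))" for j
  define ds' where "ds' j = v (fst (d j)) \<cdot> ds (fst (d j)) (snd (d j))" for j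
  have vgc: "v (N, x, f) \<cdot> (g (N, x, f) \<cdot> (f \<cdot> c)) = w \<cdot> c" if p: "(N, x, f) \<in> R" for N x f
  proof -
    have e: "extension K M f N" "extension K N (g (N, x, f)) (N' (N, x, f))" "extension K (N' (N, x, f)) (v (N, x, f)) V"
      using R(1)[OF p] W(1)[OF p] V(2)[OF p] .
    have "w \<cdot> c = (v (N, x, f) \<cdot> (g (N, x, f) \<cdot> f)) \<cdot> c" using V(3)[OF p] by (simp add: ff_def)
    then show ?thesis using e i(2) by (simp add: extension_iff into_def)
  qed
  have "isi_forks K a c c M"
    unfolding isi_forks_def
  proof (rule exI[of _ V], rule exI[of _ w], rule exI[of _ "e ` JJ"], rule exI[of _ as'], rule exI[of _ ds'],
      intro conjI ballI allI impI)
    show "extension K M w V" by (rule V(1))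
    show "small (Univ K) (e ` JJ)" by (rule small_image) fact
    fix k assume "k \<in> e ` JJ"
    then obtain N x f j where k: "k = e ((N, x, f), j)" and p: "(N, x, f) \<in> R" and j: "j \<in> J (N, x, f)"
      unfolding JJ_def by auto
    have dk: "d k = ((N, x, f), j)" using de[of "((N, x, f), j)"] p j by (simp add: k JJ_def)
    note Wp = W(3)[OF p j] and vp = V(2)[OF p]
    show "into K (as' k) V" "into K (ds' k) V" using Wp into_ext[OF _ vp] by (auto simp: as'_def ds'_def dk)
    show "Dom K (as' k) = Dom K a" using Wp vp Rx[OF p] by (simp add: as'_def dk into_def extension_iff)
    have "into K (g (N, x, f) \<cdot> (f \<cdot> c)) (N' (N, x, f))"
      by (rule into_ext[OF into_ext[OF i(2) R(1)[OF p]] W(1)[OF p]])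
    then show "isi_divides K (as' k) (ds' k) (w \<cdot> c) V"
      using isi_divides_ext[OF _ vp, of "as (N, x, f) j" "ds (N, x, f) j" "g (N, x, f) \<cdot> (f \<cdot> c)"] Wp vgc[OF p]
      by (simp add: as'_def ds'_def dk)
  next
    fix P h a'
    assume h: "extension K V h P" and a': "into K a' P"
      and tp: "gtp_eq K [a', h \<cdot> (w \<cdot> c), h \<cdot> (w \<cdot> c)] P [w \<cdot> a, w \<cdot> c, w \<cdot> c] V"
    have hw: "extension K M (h \<cdot> w) P" by (rule extension_Comp[OF V(1) h])
    have hwc: "(h \<cdot> w) \<cdot> c = h \<cdot> (w \<cdot> c)" using ext_assoc[OF V(1) h i(2)] .
    have Da': "Dom K a' = Dom K a" using gtp_Dom[OF tp] i V(1) by (simp add: into_def extension_iff)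
    \<comment> \<open>Any realization of \<open>gtp(a, c; M)\<close> above \<open>V\<close> has some
      type over \<open>M\<close>. Its representative lies in \<open>R\<close>, and the forking
      family attached to it supplies the member that is needed.\<close>
    obtain N x f where p: "(N, x, f) \<in> T" "gtp_eq K [a', h \<cdot> w] P [x, f] N" using cov[OF a' Da' hw] by blast
    have c: "c \<in> Arr K" "Cod K c = M" using i by (auto simp: into_def)
    have Dhw: "Dom K (h \<cdot> w) = M" using hw by (simp add: extension_iff)
    have fM: "Dom K f = M" using gtp_Dom[OF p(2)] Dhw by simp
    have fN: "extension K M f N" using gtp_into(2)[OF p(2), of f] fM M by (simp add: into_def extension_iff)
    have g3: "gtp_eq K [a', h \<cdot> w, (h \<cdot> w) \<cdot> c] P [x, f, f \<cdot> c] N"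
      using gtp_factor[OF p(2) c(1)] Dhw c(2) by simp
    have "gtp_eq K [a', h \<cdot> (w \<cdot> c)] P [w \<cdot> a, w \<cdot> c] V" using tp by (auto simp: gtp_iff)
    then have "gtp_eq K [a', h \<cdot> (w \<cdot> c)] P [a, c] M"
      using gtp_ext2[OF V(1) i] gtp_sym by meson
    moreover have "gtp_eq K [a', h \<cdot> (w \<cdot> c)] P [x, f \<cdot> c] N" using g3 hwc by (auto simp: gtp_iff)
    ultimately have "gtp_eq K [x, f \<cdot> c] N [a, c] M" using gtp_sym gtp_trans by blast
    moreover have xN: "into K x N" using gtp_into(2)[OF p(2), of x] by simp
    ultimately have pR: "(N, x, f) \<in> R" using p(1) fN unfolding R_def by simp
    let ?p = "(N, x, f)"
    note vp = V(2)[OF pR] and gp = W(1)[OF pR]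
    have hv: "extension K (N' ?p) (h \<cdot> v ?p) P" by (rule extension_Comp[OF vp h])
    have ig: "into K (g ?p \<cdot> f) (N' ?p)" "into K (g ?p \<cdot> (f \<cdot> c)) (N' ?p)"
      using into_ext[OF extension_into[OF fN] gp] into_ext[OF into_ext[OF i(2) fN] gp] by auto
    have e1: "(h \<cdot> v ?p) \<cdot> (g ?p \<cdot> f) = h \<cdot> w" using V(3)[OF pR] ext_assoc[OF vp h ig(1)] by (simp add: ff_def)
    have e2: "(h \<cdot> v ?p) \<cdot> (g ?p \<cdot> (f \<cdot> c)) = h \<cdot> (w \<cdot> c)" using vgc[OF pR] ext_assoc[OF vp h ig(2)] by simp
    have "gtp_eq K [x, f, f \<cdot> c] N [g ?p \<cdot> x, g ?p \<cdot> f, g ?p \<cdot> (f \<cdot> c)] (N' ?p)"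
      using gtp_ext[OF gp, of "[x, f, f \<cdot> c]"] xN extension_into[OF fN] into_ext[OF i(2) fN] gtp_sym by simp
    then have "gtp_eq K [a', h \<cdot> w, h \<cdot> (w \<cdot> c)] P [g ?p \<cdot> x, g ?p \<cdot> f, g ?p \<cdot> (f \<cdot> c)] (N' ?p)"
      using gtp_trans[OF g3] hwc by simp
    then obtain j where j: "j \<in> J ?p" "gtp_eq K [a', (h \<cdot> v ?p) \<cdot> ds ?p j, (h \<cdot> v ?p) \<cdot> (g ?p \<cdot> (f \<cdot> c))] P
             [as ?p j, ds ?p j, g ?p \<cdot> (f \<cdot> c)] (N' ?p)"
      using W(4)[OF pR hv a'] e1 e2 by metis
    have q: "(?p, j) \<in> JJ" using pR j(1) by (simp add: JJ_def)
    have eqs: "as' (e (?p, j)) = v ?p \<cdot> as ?p j" "ds' (e (?p, j)) = v ?p \<cdot> ds ?p j"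
      using de[OF q] by (simp_all add: as'_def ds'_def)
    have ia: "into K (as ?p j) (N' ?p)" "into K (ds ?p j) (N' ?p)" using W(3)[OF pR j(1)] by auto
    have "gtp_eq K [as ?p j, ds ?p j, g ?p \<cdot> (f \<cdot> c)] (N' ?p) [v ?p \<cdot> as ?p j, v ?p \<cdot> ds ?p j, w \<cdot> c] V"
      using gtp_ext[OF vp, of "[as ?p j, ds ?p j, g ?p \<cdot> (f \<cdot> c)]"] ia ig(2) gtp_sym vgc[OF pR] by simp
    then have "gtp_eq K [a', h \<cdot> (v ?p \<cdot> ds ?p j), h \<cdot> (w \<cdot> c)] P [v ?p \<cdot> as ?p j, v ?p \<cdot> ds ?p j, w \<cdot> c] V"
      using gtp_trans[OF j(2)] e2 ext_assoc[OF vp h ia(2)] by simp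
    then have "gtp_eq K [a', h \<cdot> ds' (e (?p, j)), h \<cdot> (w \<cdot> c)] P [as' (e (?p, j)), ds' (e (?p, j)), w \<cdot> c] V"
      using eqs by simp
    then show "\<exists>k\<in>e ` JJ. gtp_eq K [a', h \<cdot> ds' k, h \<cdot> (w \<cdot> c)] P [as' k, ds' k, w \<cdot> c] V" using q by blast
  qed
  then show False using nf by simp
qed

text \<open>At each stage the existence axiom gives nonforking from \<open>c\<close>, and the
  extension lemma gives a copy of \<open>b\<close> that is nonforking from the whole stage; the
  model containing this copy is the next segment. The chain begins at \<open>M\<close>, as the test
  for independence expects.\<close>

lemma isi_f_independent_sequence_exists:
  assumes ex: "existence_axiom K B" and b: "into K b M" and c: "into K c M" and cB: "sub_in K c B"
    and \<nu>: "regular_cardinal (Univ K) \<nu>"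
  shows "\<exists>N f bs D t m. extension K M f N \<and> initial_segments K \<nu> N bs D t m \<and> D (ozero \<nu>) = M \<and> m (ozero \<nu>) = f \<and>
    (\<forall>i\<in>Field \<nu>. isi_f_indep K N (bs i) (f \<cdot> c) (m i) \<and> gtp_eq K [bs i, f \<cdot> c] N [b, c] M)"
proof -
  interpret \<nu>: ordinal "Univ K" \<nu> using \<nu> by unfold_locales
  have M: "M \<in> Mod K" using b by (simp add: into_def)
  let ?S = "\<lambda>(p :: 'u) x y. \<exists>b'. into K b' (Cod K y) \<and> gtp_eq K [b', (y \<cdot> x) \<cdot> c] (Cod K y) [b, c] M \<and>
    isi_f_indep K (Cod K y) b' ((y \<cdot> x) \<cdot> c) y"
  have "\<exists>y N'. extension K N y N' \<and> ?S p x y" if x: "extension K M x N" for p :: 'u and x N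
  proof -
    have "isi_f_indep K N (x \<cdot> b) (x \<cdot> c) (x \<cdot> c)"
      using ex into_ext[OF b x] into_ext[OF c x] sub_in_ext[OF cB c x] unfolding existence_axiom_def by blast
    from isi_f_indep_extension[OF this] obtain N' y b' where y: "extension K N y N'" "into K b' N'"
      "gtp_eq K [b', y \<cdot> (x \<cdot> c)] N' [x \<cdot> b, x \<cdot> c] N" "isi_f_indep K N' b' (y \<cdot> (x \<cdot> c)) y" by blast
    have "gtp_eq K [x \<cdot> b, x \<cdot> c] N [b, c] M" using gtp_ext[OF x, of "[b, c]"] b c by simp
    then have "gtp_eq K [b', y \<cdot> (x \<cdot> c)] N' [b, c] M" using gtp_trans y(3) by blast
    moreover have "Cod K y = N'" using y(1) by (simp add: extension_iff)
    ultimately have "?S p x y" using y ext_assoc[OF x y(1) c] by auto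
    then show ?thesis using y(1) by blast
  qed
  from models_chain[OF \<nu> M, of ?S, OF this]
  obtain D t W m where d: "diagram (models K) \<nu> D t" "D (ozero \<nu>) = M" "cocone (models K) \<nu> D t W m"
    and lim: "\<forall>l. olimit \<nu> l \<longrightarrow> colimit (models K) (Restr \<nu> (underS \<nu> l)) D t (D l) (\<lambda>i. t i l)"
    and S: "\<And>p. p \<in> Field \<nu> \<Longrightarrow> ?S p (t (ozero \<nu>) p) (t p (osuc \<nu> p))" by blast
  let ?z = "ozero \<nu>"
  have f: "extension K M (m ?z) W" using models_cocone_ext[OF d(3), of ?z] d(2) by simp
  have "\<exists>b'. into K b' (D (osuc \<nu> p)) \<and> gtp_eq K [b', t ?z (osuc \<nu> p) \<cdot> c] (D (osuc \<nu> p)) [b, c] M \<and>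
    isi_f_indep K (D (osuc \<nu> p)) b' (t ?z (osuc \<nu> p) \<cdot> c) (t p (osuc \<nu> p))" if p: "p \<in> Field \<nu>" for p
  proof -
    have "Cod K (t p (osuc \<nu> p)) = D (osuc \<nu> p)" using M.diagramD(6)[OF d(1), of p "osuc \<nu> p"] p by simp
    moreover have "t p (osuc \<nu> p) \<cdot> t ?z p = t ?z (osuc \<nu> p)" using M.diagramD(7)[OF d(1), of ?z p] p by simp
    ultimately show ?thesis using S[OF p] by simp
  qed
  then obtain b' where b': "\<And>p. p \<in> Field \<nu> \<Longrightarrow> into K (b' p) (D (osuc \<nu> p))"
    "\<And>p. p \<in> Field \<nu> \<Longrightarrow> gtp_eq K [b' p, t ?z (osuc \<nu> p) \<cdot> c] (D (osuc \<nu> p)) [b, c] M"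
    "\<And>p. p \<in> Field \<nu> \<Longrightarrow> isi_f_indep K (D (osuc \<nu> p)) (b' p) (t ?z (osuc \<nu> p) \<cdot> c) (t p (osuc \<nu> p))" by metis
  define bs where "bs p = m (osuc \<nu> p) \<cdot> b' p" for p
  have main: "into K (bs p) W \<and> Dom K (bs p) = Dom K b \<and> sub_le K (bs p) (m (osuc \<nu> p)) \<and>
      isi_f_indep K W (bs p) (m ?z \<cdot> c) (m p) \<and> gtp_eq K [bs p, m ?z \<cdot> c] W [b, c] M" if p: "p \<in> Field \<nu>" for p
  proof -
    have ms: "extension K (D (osuc \<nu> p)) (m (osuc \<nu> p)) W" using models_cocone_ext[OF d(3)] p by simp
    have t0: "extension K M (t ?z (osuc \<nu> p)) (D (osuc \<nu> p))"
      using models_diagram_ext[OF d(1), of ?z "osuc \<nu> p"] p d(2) by simp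
    have mc: "m (osuc \<nu> p) \<cdot> (t ?z (osuc \<nu> p) \<cdot> c) = m ?z \<cdot> c"
      by (rule reassoc1) (use ms t0 c M.coconeD(5)[OF d(3), of ?z] p in \<open>auto simp: extension_iff into_def\<close>)
    have mp: "m (osuc \<nu> p) \<cdot> t p (osuc \<nu> p) = m p" using M.coconeD(5)[OF d(3), of p] p by simp
    have "into K (bs p) W" unfolding bs_def by (rule into_ext[OF b'(1)[OF p] ms])
    moreover have "Dom K (bs p) = Dom K b"
      using gtp_Dom[OF b'(2)[OF p]] b'(1)[OF p] ms by (simp add: bs_def extension_iff into_def)
    moreover have "sub_le K (bs p) (m (osuc \<nu> p))"
      unfolding bs_def by (rule sub_le_Comp) (use b'(1)[OF p] ms in \<open>auto simp: extension_iff into_def\<close>)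
    moreover have "isi_f_indep K W (bs p) (m ?z \<cdot> c) (m p)"
      using isi_f_indep_ext[OF b'(3)[OF p] ms] by (simp add: bs_def mc mp)
    moreover have "gtp_eq K [bs p, m ?z \<cdot> c] W [b, c] M"
      using gtp_ext2[OF ms b'(1)[OF p] into_ext[OF c t0]] b'(2)[OF p] by (simp add: bs_def mc)
    ultimately show ?thesis by blast
  qed
  have "initial_segments K \<nu> W bs D t m"
    unfolding initial_segments_def using main d lim by simp
  then show ?thesis using f d(2) main by blast
qed

text \<open>The family whose sole member is the pair \<open>a\<close>, \<open>b\<close> works, with
  the identity as extension.\<close>

lemma isi_divides_imp_forks:
  assumes d: "isi_divides K a b c M" and i: "into K a M" "into K b M" "into K c M"
  shows "isi_forks K a b c M"
proof -
  have M: "M \<in> Mod K" using i by (simp add: into_def)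
  have id: "Ident K M \<cdot> a = a" "Ident K M \<cdot> b = b" "Ident K M \<cdot> c = c" using i by (auto simp: into_def)
  obtain j :: 'u where True by blast
  have sm: "small (Univ K) {j}" by (rule small_finite) simp
  show ?thesis
    unfolding isi_forks_def
    by (rule exI[of _ M], rule exI[of _ "Ident K M"], rule exI[of _ "{j}"], rule exI[of _ "\<lambda>_. a"],
        rule exI[of _ "\<lambda>_. b"]) (use i d sm extension_Ident[OF M] in \<open>auto simp: id\<close>)
qed

text \<open>Every step restricts to first components; tracking the length keeps \<open>hd\<close>
  meaningful along the transitive closure.\<close>

lemma Lgtp_fst:
  assumes "Lgtp_eq K [c] M [a, b] [a', b']"
  shows "Lgtp_eq K [c] M [a] [a']"
proof -
  have one: "length y = length x \<and> (x \<noteq> [] \<longrightarrow> Lstep K [c] M [hd x] [hd y])" if L: "Lstep K [c] M x y" for x y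
  proof -
    have len: "length y = length x" using L unfolding Lstep_def gtp_eq_def by (auto dest: map_eq_imp_length_eq)
    moreover have "Lstep K [c] M [hd x] [hd y]" if ne: "x \<noteq> []"
    proof -
      obtain x0 xs where x: "x = x0 # xs" using ne by (cases x) auto
      obtain y0 ys where y: "y = y0 # ys" using len x by (cases y) auto
      have ex: "\<exists>N f M0 m0. extension K M f N \<and> extension K M0 m0 N \<and> sub_le K (f \<cdot> c) m0 \<and>
        gtp_eq K (map (\<lambda>a. f \<cdot> a) (x0 # xs) @ [m0]) N (map (\<lambda>a. f \<cdot> a) (y0 # ys) @ [m0]) N"
        and i: "into K x0 M" "into K y0 M" "into K c M"
        using L unfolding x y by (simp_all add: Lstep_def)
      obtain N f M0 m0 where N: "extension K M f N" "extension K M0 m0 N" "sub_le K (f \<cdot> c) m0"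
        "gtp_eq K (map (\<lambda>a. f \<cdot> a) (x0 # xs) @ [m0]) N (map (\<lambda>a. f \<cdot> a) (y0 # ys) @ [m0]) N"
        using ex by blast
      have "length xs = length ys" using len x y by simp
      then have "gtp_eq K [f \<cdot> x0, m0] N [f \<cdot> y0, m0] N"
        using N(4) unfolding gtp_iff by (auto simp: list_all2_append)
      then have "\<exists>N f M0 m0. extension K M f N \<and> extension K M0 m0 N \<and> sub_le K (f \<cdot> c) m0 \<and>
        gtp_eq K [f \<cdot> x0, m0] N [f \<cdot> y0, m0] N" using N(1-3) by blast
      then show ?thesis unfolding x y Lstep_def using i by simp
    qed
    ultimately show ?thesis by blast
  qed
  have "length y = length x \<and> (x \<noteq> [] \<longrightarrow> (Lstep K [c] M)\<^sup>+\<^sup>+ [hd x] [hd y])"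
    if "(Lstep K [c] M)\<^sup>+\<^sup>+ x y" for x y
    using that
  proof (induction rule: tranclp_induct)
    case (base y)
    then show ?case using one by blast
  next
    case (step y z)
    then have "length z = length x" using one[of y z] by simp
    moreover have "(Lstep K [c] M)\<^sup>+\<^sup>+ [hd x] [hd z]" if ne: "x \<noteq> []"
    proof -
      have "y \<noteq> []" using step.IH ne by auto
      then have "Lstep K [c] M [hd y] [hd z]" using one[OF step.hyps(2)] by blast
      then show ?thesis using step.IH ne by (meson tranclp.trancl_into_trancl)
    qed
    ultimately show ?case by blast
  qed
  from this[of "[a, b]" "[a', b']"] show ?thesis using assms by (simp add: Lgtp_eq_def)
qed

text \<open>\<open>M\<close> itself serves as the model through which \<open>c\<close>
  factors.\<close>

lemma Lgtp_refl:
  assumes "into K a M" "into K c M"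
  shows "Lgtp_eq K [c] M [a] [a]"
proof (rule Lgtp_model)
  have M: "M \<in> Mod K" using assms by (simp add: into_def)
  then show "extension K M (Ident K M) M" by (rule extension_Ident)
  show "sub_le K c (Ident K M)" using sub_le_Comp[of c "Ident K M"] assms by (simp add: into_def)
  show "gtp_eq K [a, Ident K M] M [a, Ident K M] M"
    using gtp_refl[OF M] assms extension_into[OF extension_Ident[OF M]] by simp
qed

end

section \<open>NSOP1-like independence relations\<close>

locale nsop1 = amalgamation K for K :: "('o, 'a, 'u) aecat" (structure) +
  fixes B :: "'o set" and ind :: "('o, 'a) indep"
  assumes nsop1: "NSOP1_like K B ind"
begin

lemma ind_into: "ind M a c b \<Longrightarrow> into K a M" "ind M a c b \<Longrightarrow> into K c M" "ind M a c b \<Longrightarrow> into K b M"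
  using nsop1 unfolding NSOP1_like_def independence_relation_def by blast+

lemma ind_invariant: "ind M a c b \<Longrightarrow> gtp_eq K [a, b, c] M [a', b', c'] M' \<Longrightarrow> ind M' a' c' b'"
  using nsop1 unfolding NSOP1_like_def Invariance_def by blast

lemma ind_sym: "ind M a c b \<Longrightarrow> ind M b c a"
  using nsop1 unfolding NSOP1_like_def Symmetry_def by blast

lemma ind_mono: "ind M a c b \<Longrightarrow> sub_le K a' a \<Longrightarrow> ind M a' c b"
  using nsop1 sub_le_into ind_into unfolding NSOP1_like_def Monotonicity_def by blast

lemma ind_mono_right: "ind M a c b \<Longrightarrow> sub_le K b' b \<Longrightarrow> ind M a c b'"
  using ind_mono ind_sym by blast

lemma ind_trans: "ind M a b c \<Longrightarrow> ind M a c d \<Longrightarrow> sub_le K b c \<Longrightarrow> ind M a b d"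
  using nsop1 unfolding NSOP1_like_def Transitivity_def by blast

lemma ind_base: "into K a M \<Longrightarrow> into K c M \<Longrightarrow> sub_in K c B \<Longrightarrow> ind M a c c"
  using nsop1 unfolding NSOP1_like_def Existence_def by blast

lemma ind_sub_in: "ind M a c b \<Longrightarrow> sub_in K c B"
  using nsop1 unfolding NSOP1_like_def over_base_def by blast

lemma ind_extend:
  assumes "ind M a c b" "into K b' M" "sub_le K b b'"
  obtains N f a' where "extension K M f N" "into K a' N" "gtp_eq K [a', f \<cdot> b, f \<cdot> c] N [a, b, c] M"
    "ind N a' (f \<cdot> c) (f \<cdot> b')"
  using nsop1 assms unfolding NSOP1_like_def Extension_def by metis

lemma ind_ext:
  assumes "ind M a c b" "extension K M f N"
  shows "ind N (f \<cdot> a) (f \<cdot> c) (f \<cdot> b)"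
proof -
  have "gtp_eq K [f \<cdot> a, f \<cdot> b, f \<cdot> c] N [a, b, c] M"
    using gtp_ext[OF assms(2), of "[a, b, c]"] ind_into[OF assms(1)] by simp
  then show ?thesis using ind_invariant[OF assms(1)] gtp_sym by blast
qed

lemma ind_union:
  assumes "directed (Univ K) natLeq r" "M \<in> Mod K" "cocone K r D t M bs" "colimit K r D t X k"
    "b \<in> hom K X M" "\<And>i. i \<in> Field r \<Longrightarrow> b \<cdot> k i = bs i" "\<And>i. i \<in> Field r \<Longrightarrow> ind M a c (bs i)"
  shows "ind M a c b"
proof -
  have "Union_property K ind" using nsop1 by (simp add: NSOP1_like_def)
  then show ?thesis using assms unfolding Union_property_def by blast
qed

lemma independence_theorem:
  assumes "ind M a c b" "ind M a' c b'" "ind M b c b'" "Lgtp_eq K [c] M [a] [a']"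
  obtains N f s where "extension K M f N" "into K s N"
           "Lgtp_eq K [f \<cdot> c] N [s, f \<cdot> b] [f \<cdot> a, f \<cdot> b]"
           "Lgtp_eq K [f \<cdot> c] N [s, f \<cdot> b'] [f \<cdot> a', f \<cdot> b']"
           "ind N s (f \<cdot> c) f"
proof -
  have "Independence_Theorem K ind" using nsop1 by (simp add: NSOP1_like_def)
  then show ?thesis using assms that unfolding Independence_Theorem_def by blast
qed

text \<open>
  Reindex the given large set of indices by \<open>\<kappa>\<close> and let \<open>Z\<close> be the union of the corresponding
  initial segments. Local character provides a small \<open>M0 \<le> Z\<close> over which the realization \<open>a'\<close> is
  independent from \<open>Z\<close>; being \<open>\<kappa>\<close>-presentable, \<open>M0\<close> lies in some initial segment.
\<close>

lemma consistent_imp_ind: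
  assumes a: "into K a M"
  shows "\<exists>\<kappa>. regular_cardinal (Univ K) \<kappa> \<and> (\<forall>\<nu> N f bs D t m I b c. regular_cardinal (Univ K) \<nu> \<longrightarrow>
    into K b M \<longrightarrow> into K c M \<longrightarrow>
    extension K M f N \<longrightarrow> initial_segments K \<nu> N bs D t m \<longrightarrow> D (ozero \<nu>) = M \<longrightarrow> m (ozero \<nu>) = f \<longrightarrow>
    (\<forall>i\<in>Field \<nu>. ind N (bs i) (f \<cdot> c) (m i)) \<longrightarrow> I \<subseteq> Field \<nu> \<longrightarrow> |I| =o \<kappa> \<longrightarrow>
    consistent_for K a b c M f N bs I \<longrightarrow> ind M a c b)"
proof -
  let ?U = "Univ K"
  have M: "M \<in> Mod K" using a by (simp add: into_def)
  obtain \<nu>a where \<nu>a: "regular_cardinal ?U \<nu>a" "presentable ?U \<nu>a K (Dom K a)"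
    using presentable_exists[of "Dom K a"] a by (auto simp: into_def)
  obtain \<nu>m where \<nu>m: "regular_cardinal ?U \<nu>m" "presentable ?U \<nu>m (models K) M"
    using M.presentable_exists[of M] M by auto
  have "Club_Local_Character K ind" using nsop1 by (simp add: NSOP1_like_def)
  then obtain \<upsilon> where \<upsilon>: "regular_cardinal ?U \<upsilon>"
    and lc0: "\<forall>\<kappa>. regular_cardinal ?U \<kappa> \<longrightarrow> \<upsilon> \<le>o \<kappa> \<longrightarrow>
      (\<forall>N a M m. into K a N \<longrightarrow> presentable ?U \<nu>a K (Dom K a) \<longrightarrow> extension K M m N \<longrightarrow>
        (\<exists>F. club K \<kappa> M F \<and> (\<forall>m0 \<in> F. ind N a (m \<cdot> m0) m)))"
    using \<nu>a(1) unfolding Club_Local_Character_def by (elim allE impE) (assumption, elim exE conjE, rule that)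
  note lc = lc0[rule_format]
  \<comment> \<open>Large enough for local character at the presentability rank of
    \<open>Dom K a\<close>, and for \<open>M\<close> to be a \<open>\<kappa>\<close>-presentable
    submodel. Both depend on \<open>a\<close> and \<open>M\<close> alone.\<close>
  obtain \<kappa> where \<kappa>: "regular_cardinal ?U \<kappa>" "\<upsilon> <o \<kappa>" "\<nu>m <o \<kappa>"
    using regular_above[OF small_finite[of "{} :: 'u set"] \<upsilon> \<nu>m(1)] by auto
  have presM: "presentable ?U \<kappa> (models K) M"
    using presentable_mono[OF \<nu>m(2) ordLess_imp_ordLeq[OF \<kappa>(3)]] .
  have "ind M a c b"
    if \<nu>: "regular_cardinal ?U \<nu>" and b: "into K b M" and c: "into K c M" and f: "extension K M f N"
    and ini: "initial_segments K \<nu> N bs D t m" and D0: "D (ozero \<nu>) = M" and m0: "m (ozero \<nu>) = f"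
    and in0: "\<forall>i\<in>Field \<nu>. ind N (bs i) (f \<cdot> c) (m i)" and I: "I \<subseteq> Field \<nu>" "|I| =o \<kappa>"
    and con: "consistent_for K a b c M f N bs I"
    for \<nu> N f bs D t m I b c
  proof -
    interpret \<nu>: ordinal ?U \<nu> using \<nu> by unfold_locales
    interpret \<kappa>: ordinal ?U \<kappa> using \<kappa>(1) by unfold_locales
    obtain N' g a' where g: "extension K N g N'" and a': "into K a' N'"
      and tp: "\<And>i. i \<in> I \<Longrightarrow> gtp_eq K [a', g \<cdot> bs i, g \<cdot> (f \<cdot> c)] N' [a, b, c] M"
      using con unfolding consistent_for_def by blast
    have dia: "diagram (models K) \<nu> D t" and coc: "cocone (models K) \<nu> D t N m"
      and bsm: "\<And>i. i \<in> Field \<nu> \<Longrightarrow> sub_le K (bs i) (m (osuc \<nu> i))"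
      using ini by (auto simp: initial_segments_def)
    have wo: "Well_order \<nu>" using regular_cardinalD(5)[OF \<nu>] .
    \<comment> \<open>A cardinal is the shortest well-order on its set, so \<open>I\<close>, ordered
      by \<open>\<nu>\<close>, has order type at least \<open>\<kappa>\<close>, and
      \<open>\<kappa>\<close> embeds into it.\<close>
    have woI: "well_order_on I (Restr \<nu> I)" using Well_order_Restr[OF wo] Field_Restr_sub[OF \<nu>.REFL I(1)] by metis
    then have "|I| \<le>o Restr \<nu> I" by (rule card_of_least)
    then have "\<kappa> \<le>o Restr \<nu> I" using I(2) ordIso_ordLeq_trans ordIso_symmetric by blast
    then obtain e where e: "embed \<kappa> (Restr \<nu> I) e" unfolding ordLeq_def by blast
    have wok: "Well_order \<kappa>" using regular_cardinalD(5)[OF \<kappa>(1)] .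
    have eI: "e i \<in> I" if "i \<in> Field \<kappa>" for i
      using embed_Field[OF e] that Field_Restr_sub[OF \<nu>.REFL I(1)] by blast
    have ele: "(e i, e j) \<in> \<nu>" if "(i, j) \<in> \<kappa>" for i j
      using embed_compat[OF e] that unfolding compat_def by blast
    have einj: "inj_on e (Field \<kappa>)" using embed_inj_on[OF wok e] .
    have eF: "e i \<in> Field \<nu>" if "i \<in> Field \<kappa>" for i using eI[OF that] I(1) by blast
    let ?D = "\<lambda>i. D (e i)" and ?t = "\<lambda>i j. t (e i) (e j)"
    have dia': "diagram (models K) \<kappa> ?D ?t"
      unfolding diagram_def
    proof (intro conjI ballI allI impI)
      show "Partial_order \<kappa>" using wok by (simp add: order_on_defs)
      show "?D i \<in> Obj (models K)" "?t i i = Ident (models K) (?D i)" if "i \<in> Field \<kappa>" for i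
        using M.diagramD(2,3)[OF dia] eF[OF that] by blast+
      show "?t i j \<in> hom (models K) (?D i) (?D j)" if "(i, j) \<in> \<kappa>" for i j
        using dia ele[OF that] unfolding diagram_def by blast
      show "?t j k \<cdot>\<^bsub>models K\<^esub> ?t i j = ?t i k" if "(i, j) \<in> \<kappa>" "(j, k) \<in> \<kappa>" for i j k
        using M.diagramD(7)[OF dia ele[OF that(1)] ele[OF that(2)]] .
    qed
    obtain Z k where Z: "colimit (models K) \<kappa> ?D ?t Z k"
      using models_colimit_exists[OF directed_regular[OF \<kappa>(1)] dia'] .
    have cocZ: "cocone (models K) \<kappa> ?D ?t Z k" using Z by (simp add: colimit_def)
    have "cocone (models K) \<nu> D t N' (\<lambda>i. g \<cdot> m i)"
      using M.cocone_post[OF coc dia, of g] g by (simp add: extension_iff)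
    then have "cocone (models K) \<kappa> ?D ?t N' (\<lambda>i. g \<cdot> m (e i))"
      using eF ele unfolding cocone_def by auto
    then obtain z where z0: "z \<in> Arr (models K)" "Dom (models K) z = Z" "Cod (models K) z = N'"
      "\<And>i. i \<in> Field \<kappa> \<Longrightarrow> z \<cdot>\<^bsub>models K\<^esub> k i = g \<cdot> m (e i)"
      by (rule M.colimit_induced[OF Z]) blast
    then have z: "extension K Z z N'" and zk: "\<And>i. i \<in> Field \<kappa> \<Longrightarrow> z \<cdot> k i = g \<cdot> m (e i)"
      by (auto simp: extension_iff)
    obtain i0 where i0: "i0 \<in> Field \<kappa>" using \<kappa>.Field_ne by blast
    have Da': "Dom K a' = Dom K a" using gtp_Dom[OF tp[OF eI[OF i0]]] by simp
    obtain F where F: "club K \<kappa> Z F" and indF: "\<And>m0. m0 \<in> F \<Longrightarrow> ind N' a' (z \<cdot> m0) z"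
      using lc[OF \<kappa>(1) ordLess_imp_ordLeq[OF \<kappa>(2)] a' _ z] \<nu>a(2) Da' by auto
    let ?o = "ozero \<nu>"
    define mm where "mm = k i0 \<cdot> t ?o (e i0)"
    have t0: "extension K M (t ?o (e i0)) (D (e i0))"
      using models_diagram_ext[OF dia, of ?o "e i0"] D0 eF[OF i0] by simp
    have kext: "extension K (D (e i)) (k i) Z" if "i \<in> Field \<kappa>" for i
      using models_cocone_ext[OF cocZ that] .
    have mext: "extension K (D i) (m i) N" if "i \<in> Field \<nu>" for i
      using models_cocone_ext[OF coc that] .
    have mm: "extension K M mm Z" unfolding mm_def by (rule extension_Comp[OF t0 kext[OF i0]])
    have zmm: "z \<cdot> mm = g \<cdot> f"
    proof -
      have "z \<cdot> mm = (z \<cdot> k i0) \<cdot> t ?o (e i0)"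
        using z t0 kext[OF i0] by (simp add: mm_def extension_iff)
      also have "\<dots> = g \<cdot> (m (e i0) \<cdot> t ?o (e i0))"
        using zk[OF i0] g t0 mext[OF eF[OF i0]] by (simp add: extension_iff)
      also have "m (e i0) \<cdot> t ?o (e i0) = f"
        using M.coconeD(5)[OF coc, of ?o "e i0"] m0 eF[OF i0] by simp
      finally show ?thesis .
    qed
    \<comment> \<open>\<open>M\<close> is itself a small submodel of \<open>Z\<close>, so the club
      has a member \<open>n0\<close> above it. Thus \<open>c\<close> factors through
      \<open>n0\<close>, which the final use of transitivity requires.\<close>
    have "mm \<in> Sub_models K \<kappa> Z" using mm presM unfolding Sub_models_def by blast
    then obtain n0 where n0: "n0 \<in> F" "sub_le K mm n0" using F unfolding club_def by blast
    have "n0 \<in> Sub_models K \<kappa> Z" using n0(1) F unfolding club_def by blast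
    then obtain M0 where M0: "extension K M0 n0 Z" "presentable ?U \<kappa> (models K) M0" unfolding Sub_models_def by blast
    have "n0 \<in> hom (models K) M0 Z" using M0(1) by (auto simp: extension_iff hom_def)
    then have "\<exists>i\<in>Field \<kappa>. \<exists>u\<in>hom (models K) M0 (?D i). k i \<cdot>\<^bsub>models K\<^esub> u = n0"
      using M0(2) Z regular_directed[OF \<kappa>(1)] unfolding presentable_def by blast
    then obtain i u where i: "i \<in> Field \<kappa>" and u: "extension K M0 u (D (e i))" "k i \<cdot> u = n0"
      by (auto simp: extension_iff hom_def)
    have zn0: "extension K M0 (z \<cdot> n0) N'" by (rule extension_Comp[OF M0(1) z])
    have "z \<cdot> n0 = (z \<cdot> k i) \<cdot> u" using z kext[OF i] u by (auto simp: extension_iff)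
    also have "\<dots> = (g \<cdot> m (e i)) \<cdot> u" using zk[OF i] by simp
    finally have "sub_le K (z \<cdot> n0) (g \<cdot> m (e i))"
      using sub_le_Comp[of u "g \<cdot> m (e i)"] u g mext[OF eF[OF i]] by (simp add: extension_iff)
    moreover have "ind N' (g \<cdot> bs (e i)) (g \<cdot> (f \<cdot> c)) (g \<cdot> m (e i))"
      using ind_ext[OF _ g] in0 eF[OF i] by blast
    ultimately have 1: "ind N' (g \<cdot> bs (e i)) (g \<cdot> (f \<cdot> c)) (z \<cdot> n0)" using ind_mono_right by blast
    \<comment> \<open>\<open>bs (e i)\<close> lies only in the segment with index
      \<open>osuc \<nu> (e i)\<close>, which need not be among the chosen ones. As \<open>e\<close>
      is strictly increasing, the segment at \<open>e ?j\<close> contains it, so the term lies below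
      \<open>z\<close>.\<close>
    let ?j = "osuc \<kappa> i"
    have j: "?j \<in> Field \<kappa>" "(i, ?j) \<in> \<kappa>" "?j \<noteq> i" using i \<kappa>.suc_ne by auto
    have "e i \<noteq> e ?j" using einj i j by (metis inj_onD)
    then have ij: "(osuc \<nu> (e i), e ?j) \<in> \<nu>" using \<nu>.suc_le[OF eF[OF i] ele[OF j(2)]] by blast
    have "m (e ?j) \<cdot> t (osuc \<nu> (e i)) (e ?j) = m (osuc \<nu> (e i))"
      using M.coconeD(5)[OF coc ij] by simp
    then have "sub_le K (m (osuc \<nu> (e i))) (m (e ?j))"
      using sub_le_Comp[of "t (osuc \<nu> (e i)) (e ?j)" "m (e ?j)"] models_diagram_ext[OF dia ij] mext[OF eF[OF j(1)]]
      by (simp add: extension_iff)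
    then have "sub_le K (bs (e i)) (m (e ?j))"
      using sub_le_trans[OF bsm[OF eF[OF i]]] mext[OF eF[OF j(1)]] by (simp add: extension_iff)
    then have "sub_le K (g \<cdot> bs (e i)) (g \<cdot> m (e ?j))"
      using sub_le_post g mext[OF eF[OF j(1)]] by (simp add: extension_iff)
    moreover have "sub_le K (g \<cdot> m (e ?j)) z"
      using sub_le_Comp[of "k ?j" z] zk[OF j(1)] kext[OF j(1)] z by (simp add: extension_iff)
    ultimately have "sub_le K (g \<cdot> bs (e i)) z" using sub_le_trans z by (simp add: extension_iff)
    then have "ind N' a' (z \<cdot> n0) (g \<cdot> bs (e i))" using indF[OF n0(1)] ind_mono_right by blast
    \<comment> \<open>Transitivity changes the base of a fixed left-hand side. That side has to be
      \<open>bs (e i)\<close>, known to be independent over \<open>c\<close> from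
      \<open>z \<cdot> n0\<close>; hence symmetry before and after.\<close>
    then have 2: "ind N' (g \<cdot> bs (e i)) (z \<cdot> n0) a'" by (rule ind_sym)
    have "sub_le K (z \<cdot> mm) (z \<cdot> n0)"
      using sub_le_post[OF n0(2)] M0(1) z by (simp add: extension_iff)
    moreover have "sub_le K (g \<cdot> (f \<cdot> c)) (z \<cdot> mm)"
      using sub_le_Comp[of c "g \<cdot> f"] c f g zmm by (simp add: extension_iff into_def)
    ultimately have "sub_le K (g \<cdot> (f \<cdot> c)) (z \<cdot> n0)" using sub_le_trans zn0 by (simp add: extension_iff)
    then have "ind N' (g \<cdot> bs (e i)) (g \<cdot> (f \<cdot> c)) a'" using ind_trans[OF 1 2] by blast
    then have "ind N' a' (g \<cdot> (f \<cdot> c)) (g \<cdot> bs (e i))" by (rule ind_sym)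
    then show "ind M a c b" using ind_invariant tp[OF eI[OF i]] by blast
  qed
  then show ?thesis using \<kappa>(1) by blast
qed

end

text \<open>An arrow \<open>(n, t, h, n')\<close> from \<open>n\<close> to \<open>n'\<close> is a commutative square with \<open>t\<close> on the domains and \<open>h\<close> on the codomains.\<close>

definition arrow_cat :: "('o, 'a, 'm) category_scheme \<Rightarrow> ('a, 'a \<times> 'a \<times> 'a \<times> 'a) category" where
  "arrow_cat C = \<lparr> Obj = Arr C,
     Arr = {(n, t, h, n'). n \<in> Arr C \<and> n' \<in> Arr C \<and> t \<in> hom C (Dom C n) (Dom C n') \<and>
       h \<in> hom C (Cod C n) (Cod C n') \<and> h \<cdot>\<^bsub>C\<^esub> n = n' \<cdot>\<^bsub>C\<^esub> t},
     Dom = (\<lambda>(n, t, h, n'). n), Cod = (\<lambda>(n, t, h, n'). n'),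
     Ident = (\<lambda>n. (n, Ident C (Dom C n), Ident C (Cod C n), n)),
     Comp = (\<lambda>(m, t', h', m') (n, t, h, n'). (n, t' \<cdot>\<^bsub>C\<^esub> t, h' \<cdot>\<^bsub>C\<^esub> h, m')) \<rparr>"

definition src :: "'a \<times> 'a \<times> 'a \<times> 'a \<Rightarrow> 'a" where "src x = fst (snd x)"
definition trg :: "'a \<times> 'a \<times> 'a \<times> 'a \<Rightarrow> 'a" where "trg x = fst (snd (snd x))"

lemma arrow_cat_simps [simp]:
  "Obj (arrow_cat C) = Arr C"
  "Dom (arrow_cat C) (n, t, h, n') = n" "Cod (arrow_cat C) (n, t, h, n') = n'"
  "Ident (arrow_cat C) n = (n, Ident C (Dom C n), Ident C (Cod C n), n)"
  "(m, t', h', m') \<cdot>\<^bsub>arrow_cat C\<^esub> (n, t, h, n') = (n, t' \<cdot>\<^bsub>C\<^esub> t, h' \<cdot>\<^bsub>C\<^esub> h, m')"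
  "src (n, t, h, n') = t" "trg (n, t, h, n') = h"
  by (simp_all add: arrow_cat_def src_def trg_def)

lemma arrow_cat_Arr [simp]:
  "(n, t, h, n') \<in> Arr (arrow_cat C) \<longleftrightarrow> n \<in> Arr C \<and> n' \<in> Arr C \<and>
     (t \<in> Arr C \<and> Dom C t = Dom C n \<and> Cod C t = Dom C n') \<and>
     (h \<in> Arr C \<and> Dom C h = Cod C n \<and> Cod C h = Cod C n') \<and> h \<cdot>\<^bsub>C\<^esub> n = n' \<cdot>\<^bsub>C\<^esub> t"
  by (auto simp: arrow_cat_def hom_def)

lemma arrow_cat_eta: "x = (Dom (arrow_cat C) x, src x, trg x, Cod (arrow_cat C) x)"
  by (cases x) simp

lemma arrow_homE:
  assumes "f \<in> hom (arrow_cat C) X Y"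
  obtains t h where "f = (X, t, h, Y)" "(X, t, h, Y) \<in> Arr (arrow_cat C)"
  using assms by (cases f) (auto simp: hom_def)

section \<open>Diagrams and cocones in the arrow category\<close>

context category
begin

lemma category_arrow_cat: "category (arrow_cat C)"
proof
  fix f assume "f \<in> Arr (arrow_cat C)"
  then show "Dom (arrow_cat C) f \<in> Obj (arrow_cat C)" "Cod (arrow_cat C) f \<in> Obj (arrow_cat C)"
    by (cases f, simp)+
next
  fix X assume "X \<in> Obj (arrow_cat C)"
  then show "Ident (arrow_cat C) X \<in> hom (arrow_cat C) X X" by (simp add: hom_def)
next
  fix f X Y g Z
  assume "f \<in> hom (arrow_cat C) X Y" "g \<in> hom (arrow_cat C) Y Z"
  then obtain t h t' h' where *: "f = (X, t, h, Y)" "g = (Y, t', h', Z)"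
    "(X, t, h, Y) \<in> Arr (arrow_cat C)" "(Y, t', h', Z) \<in> Arr (arrow_cat C)"
    by (elim arrow_homE)
  have "h' \<cdot> (h \<cdot> X) = h' \<cdot> (Y \<cdot> t)" using * by simp
  also have "\<dots> = Z \<cdot> (t' \<cdot> t)" by (rule reassoc) (use * in auto)
  finally show "g \<cdot>\<^bsub>arrow_cat C\<^esub> f \<in> hom (arrow_cat C) X Z"
    unfolding *(1,2) hom_def using *(3,4) by simp
next
  fix f X Y assume "f \<in> hom (arrow_cat C) X Y"
  then obtain t h where "f = (X, t, h, Y)" "(X, t, h, Y) \<in> Arr (arrow_cat C)" by (elim arrow_homE)
  then show "f \<cdot>\<^bsub>arrow_cat C\<^esub> Ident (arrow_cat C) X = f" "Ident (arrow_cat C) Y \<cdot>\<^bsub>arrow_cat C\<^esub> f = f"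
    by simp_all
next
  fix f W X g Y h Z
  assume "f \<in> hom (arrow_cat C) W X" "g \<in> hom (arrow_cat C) X Y" "h \<in> hom (arrow_cat C) Y Z"
  then obtain a b c d e k where *: "f = (W, a, b, X)" "g = (X, c, d, Y)" "h = (Y, e, k, Z)"
    "(W, a, b, X) \<in> Arr (arrow_cat C)" "(X, c, d, Y) \<in> Arr (arrow_cat C)" "(Y, e, k, Z) \<in> Arr (arrow_cat C)"
    by (elim arrow_homE)
  then show "(h \<cdot>\<^bsub>arrow_cat C\<^esub> g) \<cdot>\<^bsub>arrow_cat C\<^esub> f = h \<cdot>\<^bsub>arrow_cat C\<^esub> (g \<cdot>\<^bsub>arrow_cat C\<^esub> f)"
    by simp
qed

lemma arrow_diagramD:
  assumes "diagram (arrow_cat C) r D \<tau>"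
  shows "\<And>i. i \<in> Field r \<Longrightarrow> D i \<in> Arr C"
    and "\<And>i j. (i, j) \<in> r \<Longrightarrow> \<tau> i j = (D i, src (\<tau> i j), trg (\<tau> i j), D j)"
    and "\<And>i j. (i, j) \<in> r \<Longrightarrow> trg (\<tau> i j) \<cdot> D i = D j \<cdot> src (\<tau> i j)"
    and "diagram C r (\<lambda>i. Dom C (D i)) (\<lambda>i j. src (\<tau> i j))"
    and "diagram C r (\<lambda>i. Cod C (D i)) (\<lambda>i j. trg (\<tau> i j))"
proof -
  interpret A: category "arrow_cat C" by (rule category_arrow_cat)
  note d = A.diagramD[OF assms]
  show D: "\<And>i. i \<in> Field r \<Longrightarrow> D i \<in> Arr C" using d(2) by simp
  show t: "\<And>i j. (i, j) \<in> r \<Longrightarrow> \<tau> i j = (D i, src (\<tau> i j), trg (\<tau> i j), D j)"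
    using d(5,6) arrow_cat_eta by metis
  have ar: "(D i, src (\<tau> i j), trg (\<tau> i j), D j) \<in> Arr (arrow_cat C)" if "(i, j) \<in> r" for i j
    using d(4)[OF that] t[OF that] by simp
  then show "\<And>i j. (i, j) \<in> r \<Longrightarrow> trg (\<tau> i j) \<cdot> D i = D j \<cdot> src (\<tau> i j)" by simp
  have comp: "src (\<tau> j k) \<cdot> src (\<tau> i j) = src (\<tau> i k) \<and> trg (\<tau> j k) \<cdot> trg (\<tau> i j) = trg (\<tau> i k)"
    if "(i, j) \<in> r" "(j, k) \<in> r" for i j k
  proof -
    have "(D j, src (\<tau> j k), trg (\<tau> j k), D k) \<cdot>\<^bsub>arrow_cat C\<^esub> (D i, src (\<tau> i j), trg (\<tau> i j), D j) = \<tau> i k"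
      using d(7)[OF that] t[OF that(1)] t[OF that(2)] by metis
    then have "\<tau> i k = (D i, src (\<tau> j k) \<cdot> src (\<tau> i j), trg (\<tau> j k) \<cdot> trg (\<tau> i j), D k)" by simp
    then show ?thesis by simp
  qed
  show "diagram C r (\<lambda>i. Dom C (D i)) (\<lambda>i j. src (\<tau> i j))"
    "diagram C r (\<lambda>i. Cod C (D i)) (\<lambda>i j. trg (\<tau> i j))"
    unfolding diagram_def using d(1,3) D ar comp by (auto simp: hom_def)
qed

text \<open>On the domain side a colimit is required, since its universal property induces
  \<open>n\<close>; on the codomain side a cocone suffices. The domains of a chain can therefore be
  kept continuous, or prescribed, while the codomains grow as needed.\<close>

lemma arrow_cocone_exists:
  assumes d: "diagram (arrow_cat C) r D \<tau>"
    and X: "colimit C r (\<lambda>i. Dom C (D i)) (\<lambda>i j. src (\<tau> i j)) X k"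
    and Y: "cocone C r (\<lambda>i. Cod C (D i)) (\<lambda>i j. trg (\<tau> i j)) Y l"
  shows "\<exists>n. n \<in> Arr C \<and> Dom C n = X \<and> Cod C n = Y \<and> (\<forall>i\<in>Field r. n \<cdot> k i = l i \<cdot> D i) \<and>
    cocone (arrow_cat C) r D \<tau> n (\<lambda>i. (D i, k i, l i, n))"
proof -
  note D = arrow_diagramD[OF d]
  have F: "i \<in> Field r" "j \<in> Field r" if "(i, j) \<in> r" for i j using that by (auto simp: Field_def)
  have cX: "cocone C r (\<lambda>i. Dom C (D i)) (\<lambda>i j. src (\<tau> i j)) X k" using X by (simp add: colimit_def)
  have "cocone C r (\<lambda>i. Dom C (D i)) (\<lambda>i j. src (\<tau> i j)) Y (\<lambda>i. l i \<cdot> D i)"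
    unfolding cocone_def
  proof (intro conjI ballI allI impI)
    show "Y \<in> Obj C" using coconeD(1)[OF Y] .
    show "l i \<cdot> D i \<in> hom C (Dom C (D i)) Y" if "i \<in> Field r" for i
      using D(1)[OF that] coconeD(2-4)[OF Y that] by (simp add: hom_def)
    show "(l j \<cdot> D j) \<cdot> src (\<tau> i j) = l i \<cdot> D i" if ij: "(i, j) \<in> r" for i j
    proof -
      note s = diagramD(4-6)[OF D(4) ij] and u = diagramD(4-6)[OF D(5) ij]
      note c = coconeD(2-4)[OF Y F(1)[OF ij]] coconeD(2-4)[OF Y F(2)[OF ij]]
      have "(l j \<cdot> D j) \<cdot> src (\<tau> i j) = l j \<cdot> (trg (\<tau> i j) \<cdot> D i)"
        using s c D(1)[OF F(2)[OF ij]] D(3)[OF ij] by simp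
      also have "\<dots> = l i \<cdot> D i"
        by (rule reassoc1[OF coconeD(5)[OF Y ij]]) (use u c D(1)[OF F(1)[OF ij]] in auto)
      finally show ?thesis .
    qed
  qed
  then obtain n where n: "n \<in> Arr C" "Dom C n = X" "Cod C n = Y" "\<And>i. i \<in> Field r \<Longrightarrow> n \<cdot> k i = l i \<cdot> D i"
    using colimit_induced[OF X] by blast
  have "cocone (arrow_cat C) r D \<tau> n (\<lambda>i. (D i, k i, l i, n))"
    unfolding cocone_def
  proof (intro conjI ballI allI impI)
    show "n \<in> Obj (arrow_cat C)" using n by simp
    show "(D i, k i, l i, n) \<in> hom (arrow_cat C) (D i) n" if "i \<in> Field r" for i
      using n(1-3) n(4)[OF that] D(1)[OF that] coconeD(2-4)[OF cX that] coconeD(2-4)[OF Y that] by (simp add: hom_def)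
    show "(D j, k j, l j, n) \<cdot>\<^bsub>arrow_cat C\<^esub> \<tau> i j = (D i, k i, l i, n)" if "(i, j) \<in> r" for i j
      using D(2)[OF that] coconeD(5)[OF cX that] coconeD(5)[OF Y that] by (metis arrow_cat_simps(5))
  qed
  then show ?thesis using n by blast
qed

end

section \<open>Independent sequences and the dividing test\<close>

context nsop1
begin

text \<open>
  In the arrow category of models, an object \<open>n : M \<rightarrow> N\<close> together with \<open>\<alpha> : A \<rightarrow> N\<close> stands for the type
  of \<open>\<alpha>\<close> over \<open>M\<close>; the transition maps of a diagram keep \<open>\<alpha>\<close> fixed, so colimits realize limits of types.
\<close>

lemma limit_independent:
  assumes r: "directed (Univ K) natLeq r" and d: "diagram (arrow_cat (models K)) r D \<tau>"
    and z: "z \<in> Field r" "\<And>i. i \<in> Field r \<Longrightarrow> (z, i) \<in> r"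
    and X: "colimit (models K) r (\<lambda>i. Dom K (D i)) (\<lambda>i j. src (\<tau> i j)) X k"
    and \<alpha>: "into K \<alpha> (Cod K (D z))" and c: "into K c (Dom K (D z))"
    and ind: "\<And>i. i \<in> Field r \<Longrightarrow> ind (Cod K (D i)) (trg (\<tau> z i) \<cdot> \<alpha>) (D i \<cdot> (src (\<tau> z i) \<cdot> c)) (D i)"
  shows "\<exists>n l. cocone (arrow_cat (models K)) r D \<tau> n (\<lambda>i. (D i, k i, l i, n)) \<and> Dom K n = X \<and>
    ind (Cod K n) (l z \<cdot> \<alpha>) (n \<cdot> (k z \<cdot> c)) n"
proof -
  note D = M.arrow_diagramD[OF d]
  have diaN: "diagram (models K) r (\<lambda>i. Cod K (D i)) (\<lambda>i j. trg (\<tau> i j))" using D(5) by simp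
  have diaM: "diagram (models K) r (\<lambda>i. Dom K (D i)) (\<lambda>i j. src (\<tau> i j))" using D(4) by simp
  obtain Y l where Y: "colimit (models K) r (\<lambda>i. Cod K (D i)) (\<lambda>i j. trg (\<tau> i j)) Y l"
    using models_colimit_exists[OF r diaN] .
  have cY: "cocone (models K) r (\<lambda>i. Cod K (D i)) (\<lambda>i j. trg (\<tau> i j)) Y l"
    and cX: "cocone (models K) r (\<lambda>i. Dom K (D i)) (\<lambda>i j. src (\<tau> i j)) X k"
    using X Y by (simp_all add: colimit_def)
  obtain n where n: "n \<in> Arr (models K)" "Dom K n = X" "Cod K n = Y" "\<And>i. i \<in> Field r \<Longrightarrow> n \<cdot> k i = l i \<cdot> D i"
    "cocone (arrow_cat (models K)) r D \<tau> n (\<lambda>i. (D i, k i, l i, n))"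
    using M.arrow_cocone_exists[OF d, of X k Y l] X cY by auto
  have nE: "extension K X n Y" using n by (auto simp: extension_iff)
  have kE: "extension K (Dom K (D i)) (k i) X" if "i \<in> Field r" for i using models_cocone_ext[OF cX that] .
  have lE: "extension K (Cod K (D i)) (l i) Y" if "i \<in> Field r" for i using models_cocone_ext[OF cY that] .
  have DE: "extension K (Dom K (D i)) (D i) (Cod K (D i))" if "i \<in> Field r" for i
    using D(1)[OF that] by (auto simp: extension_iff)
  \<comment> \<open>The pieces of \<open>n\<close> are
    \<open>n \<cdot> k i = l i \<cdot> D i\<close>, so independence at stage \<open>i\<close>, moved
    along \<open>l i\<close>, is independence from the \<open>i\<close>-th piece, and the union
    property collects the pieces.\<close>
  have "ind Y (l z \<cdot> \<alpha>) (n \<cdot> (k z \<cdot> c)) n"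
  proof (rule ind_union[OF r])
    show "Y \<in> Mod K" using nE by (simp add: extension_iff)
    show "cocone K r (\<lambda>i. Dom K (D i)) (\<lambda>i j. src (\<tau> i j)) Y (\<lambda>i. n \<cdot> k i)"
    proof -
      have "cocone (models K) r (\<lambda>i. Dom K (D i)) (\<lambda>i j. src (\<tau> i j)) Y (\<lambda>i. n \<cdot> k i)"
        using M.cocone_post[OF cX diaM n(1)] n(2,3) by simp
      then show ?thesis
        using models_cocone[OF Mod_subset, of r "\<lambda>i. Dom K (D i)"] D(1) by auto
    qed
    show "colimit K r (\<lambda>i. Dom K (D i)) (\<lambda>i j. src (\<tau> i j)) X k" by (rule M_preserves[OF r X])
    show "n \<in> hom K X Y" using nE by (simp add: extension_def)
    show "n \<cdot> k i = n \<cdot> k i" for i by simp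
    fix i assume i: "i \<in> Field r"
    note zi = z(2)[OF i]
    have sE: "extension K (Dom K (D z)) (src (\<tau> z i)) (Dom K (D i))"
      and tE: "extension K (Cod K (D z)) (trg (\<tau> z i)) (Cod K (D i))"
      using models_diagram_ext[OF diaM zi] models_diagram_ext[OF diaN zi] .
    have "l i \<cdot> trg (\<tau> z i) = l z" "k i \<cdot> src (\<tau> z i) = k z"
      using M.coconeD(5)[OF cY zi] M.coconeD(5)[OF cX zi] by simp_all
    then have e: "l i \<cdot> (trg (\<tau> z i) \<cdot> \<alpha>) = l z \<cdot> \<alpha>" "k i \<cdot> (src (\<tau> z i) \<cdot> c) = k z \<cdot> c"
      using ext_assoc[OF tE lE[OF i] \<alpha>] ext_assoc[OF sE kE[OF i] c] by simp_all
    have "l i \<cdot> (D i \<cdot> (src (\<tau> z i) \<cdot> c)) = n \<cdot> (k i \<cdot> (src (\<tau> z i) \<cdot> c))"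
      using ext_assoc[OF DE[OF i] lE[OF i] into_ext[OF c sE]] ext_assoc[OF kE[OF i] nE into_ext[OF c sE]] n(4)[OF i]
      by simp
    then show "ind Y (l z \<cdot> \<alpha>) (n \<cdot> (k z \<cdot> c)) (n \<cdot> k i)"
      using ind_ext[OF ind[OF i] lE[OF i]] e n(4)[OF i] by simp
  qed
  then show ?thesis using n(2,3,5) by (intro exI[of _ n] exI[of _ l]) simp
qed

text \<open>
  At stage \<open>n : M \<rightarrow> N\<close> the next initial segment is \<open>N\<close> itself, whose copy of \<open>\<alpha>\<close> realizes the type
  of \<open>\<alpha>\<close> over \<open>M\<close>; then \<open>\<alpha>\<close> is extended to be independent from \<open>N\<close>.
\<close>

lemma independent_isi_sequence_exists:
  assumes b: "into K b M" and c: "into K c M" and cB: "sub_in K c B"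
    and \<nu>: "regular_cardinal (Univ K) \<nu>"
  shows "\<exists>N f bs D t m. extension K M f N \<and> initial_segments K \<nu> N bs D t m \<and> D (ozero \<nu>) = M \<and> m (ozero \<nu>) = f \<and>
    (\<forall>i\<in>Field \<nu>. ind N (bs i) (f \<cdot> c) (m i) \<and> gtp_eq K [bs i, f \<cdot> c] N [b, c] M) \<and>
    (\<forall>i j. (i, j) \<in> \<nu> \<longrightarrow> gtp_eq K [bs i, m i] N [bs j, m i] N)"
proof -
  interpret \<nu>: ordinal "Univ K" \<nu> using \<nu> by unfold_locales
  interpret A: category "arrow_cat (models K)" by (rule M.category_arrow_cat)
  let ?A = "arrow_cat (models K)" and ?z = "ozero \<nu>"
  have M: "M \<in> Mod K" using b by (simp add: into_def)
  have cId: "sub_le K c (Ident K M)"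
    using c sub_le_Comp[of c "Ident K M"] M by (simp add: into_def)
  \<comment> \<open>\<open>b\<close> is independent from \<open>c\<close> over \<open>c\<close> by
    existence; extension replaces it by a copy \<open>\<alpha>\<close> that is independent from all
    of \<open>M\<close>.\<close>
  obtain N0 n0 \<alpha> where n0: "extension K M n0 N0" and \<alpha>: "into K \<alpha> N0"
    and tp0': "gtp_eq K [\<alpha>, n0 \<cdot> c, n0 \<cdot> c] N0 [b, c, c] M" and ind0: "ind N0 \<alpha> (n0 \<cdot> c) (n0 \<cdot> Ident K M)"
    using ind_extend[OF ind_base[OF b c cB] extension_into[OF extension_Ident[OF M]] cId] .
  have tp0: "gtp_eq K [\<alpha>, n0 \<cdot> c] N0 [b, c] M" using tp0' by (auto simp: gtp_iff)
  have n0A: "n0 \<in> Obj ?A" using n0 by (simp add: extension_iff)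
  define G where "G x \<longleftrightarrow> ind (Cod K (Cod ?A x)) (trg x \<cdot> \<alpha>) (Cod ?A x \<cdot> (src x \<cdot> c)) (Cod ?A x)" for x
  define P where "P j T \<longleftrightarrow> (j \<in> Field \<nu> \<longrightarrow> G (T ?z))" for j and T :: "'u \<Rightarrow> _"
  \<comment> \<open>Says that the transition on the domain side is the arrow \<open>n\<close>
    itself, so that the next segment is the current codomain.\<close>
  define S where "S (p :: 'u) (x :: 'a \<times> 'a \<times> 'a \<times> 'a) y \<longleftrightarrow>
    src y = Dom ?A y \<and> Dom K (Cod ?A y) = Cod K (Dom ?A y)" for p x y
  \<comment> \<open>Continuity is demanded of the domains, which become the initial
    segments.\<close>
  define L where "L l D \<tau> X k \<longleftrightarrow> colimit (models K) (Restr \<nu> (underS \<nu> l)) (\<lambda>i. Dom K (D i)) (\<lambda>i j. src (\<tau> i j))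
     (Dom K X) (\<lambda>i. src (k i))" for l D and \<tau> :: "'u \<Rightarrow> 'u \<Rightarrow> 'a \<times> 'a \<times> 'a \<times> 'a" and X and k :: "'u \<Rightarrow> 'a \<times> 'a \<times> 'a \<times> 'a"
  have "\<exists>D \<tau>. diagram ?A \<nu> D \<tau> \<and> D ?z = n0 \<and> (\<forall>j\<in>Field \<nu>. P j (\<lambda>i. \<tau> i j)) \<and>
    (\<forall>p\<in>Field \<nu>. S p (\<tau> ?z p) (\<tau> p (osuc \<nu> p))) \<and>
    (\<forall>l. olimit \<nu> l \<longrightarrow> L l D \<tau> (D l) (\<lambda>i. \<tau> i l))"
  proof (rule A.chain_exists_cases[OF \<nu>.Cinf n0A])
    show "P j T'" if "\<forall>i\<in>under \<nu> j. T i = T' i" "P j T" for j T T'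
      using that unfolding P_def under_def by auto
    show "L l D' \<tau>' X k'" if "\<forall>i\<in>underS \<nu> l. D i = D' i \<and> k i = k' i"
      "\<forall>i j. (i, j) \<in> \<nu> \<longrightarrow> j \<in> underS \<nu> l \<longrightarrow> \<tau> i j = \<tau>' i j" "L l D \<tau> X k" for l D \<tau> X k D' \<tau>' k'
      using that(3) unfolding L_def
      by (rule colimit_cong) (use that(1,2) \<nu>.Field_Restr_underS in auto)
    show "P ?z (\<lambda>i. Ident ?A n0)"
      using ind0 n0 \<alpha> c by (auto simp: P_def G_def extension_iff into_def)
  next
    fix p D \<tau> assume p: "p \<in> Field \<nu>" and d: "diagram ?A (Restr \<nu> (under \<nu> p)) D \<tau>"
      and Dz: "D ?z = n0" and Pp: "P p (\<lambda>i. \<tau> i p)"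
    have zp: "(?z, p) \<in> Restr \<nu> (under \<nu> p)" using p by (simp add: under_def)
    define n s h where "n = D p" and "s = src (\<tau> ?z p)" and "h = trg (\<tau> ?z p)"
    have t: "\<tau> ?z p = (n0, s, h, n)" using M.arrow_diagramD(2)[OF d zp] Dz by (simp add: n_def s_def h_def)
    have "(n0, s, h, n) \<in> Arr ?A" using A.diagramD(4)[OF d zp] t by simp
    then have ar: "n \<in> Arr K" "Dom K n \<in> Mod K" "Cod K n \<in> Mod K" "s \<in> Arr K" "Dom K s = M" "Cod K s = Dom K n"
      "h \<in> Arr K" "Dom K h = N0" "Cod K h = Cod K n" "h \<cdot> n0 = n \<cdot> s"
      using n0 by (auto simp: extension_iff)
    have ii: "ind (Cod K n) (h \<cdot> \<alpha>) (n \<cdot> (s \<cdot> c)) n" using Pp p t by (simp add: P_def G_def)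
    let ?N = "Cod K n"
    have sl: "sub_le K n (Ident K ?N)" using sub_le_Comp[of n "Ident K ?N"] ar by simp
    have nE: "extension K (Dom K n) n ?N" using ar by (simp add: extension_iff)
    have sc: "into K (s \<cdot> c) (Dom K n)" using ar c by (simp add: into_def)
    obtain N' g \<alpha>' where g: "extension K ?N g N'" and \<alpha>': "into K \<alpha>' N'"
      and gt: "gtp_eq K [\<alpha>', g \<cdot> n, g \<cdot> (n \<cdot> (s \<cdot> c))] N' [h \<cdot> \<alpha>, n, n \<cdot> (s \<cdot> c)] ?N"
      and ig': "ind N' \<alpha>' (g \<cdot> (n \<cdot> (s \<cdot> c))) (g \<cdot> Ident K ?N)"
      using ind_extend[OF ii extension_into[OF extension_Ident[OF ar(3)]] sl] .
    have ig: "ind N' \<alpha>' (g \<cdot> (n \<cdot> (s \<cdot> c))) g" using ig' g by (simp add: extension_iff)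
    \<comment> \<open>Equality of types over the segment is realized in \<open>N''\<close>, where
      \<open>v\<close> sends the old realization to \<open>u \<cdot> \<alpha>'\<close>. There are
      now two embeddings of \<open>?N\<close>, in general different: \<open>v\<close> carries the
      realization, while \<open>u \<cdot> g\<close> is the segment from which it is independent.
      They agree on the previous segment.\<close>
    obtain N'' u v where u: "extension K N' u N''" and v: "extension K ?N v N''"
      and eq: "u \<cdot> \<alpha>' = v \<cdot> (h \<cdot> \<alpha>)" "u \<cdot> (g \<cdot> n) = v \<cdot> n"
      using gt by (auto simp: gtp_iff)
    have ug: "extension K ?N (u \<cdot> g) N''" by (rule extension_Comp[OF g u])
    define y where "y = (n, n, v, u \<cdot> g)"
    have sq: "v \<cdot> n = (u \<cdot> g) \<cdot> n" using eq(2) u g ar by (simp add: extension_iff)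
    have yA: "y \<in> Arr ?A" unfolding y_def arrow_cat_Arr
      using sq ar ug v by (auto simp: extension_iff)
    have "ind N'' (u \<cdot> \<alpha>') (u \<cdot> (g \<cdot> (n \<cdot> (s \<cdot> c)))) (u \<cdot> g)" by (rule ind_ext[OF ig u])
    moreover have "u \<cdot> \<alpha>' = (v \<cdot> h) \<cdot> \<alpha>" using eq(1) ar v \<alpha> by (simp add: extension_iff into_def)
    moreover have "u \<cdot> (g \<cdot> (n \<cdot> (s \<cdot> c))) = (u \<cdot> g) \<cdot> ((n \<cdot> s) \<cdot> c)"
      using ar u g c by (simp add: extension_iff into_def)
    ultimately have "G (y \<cdot>\<^bsub>?A\<^esub> \<tau> ?z p)"
      unfolding G_def t y_def using ug by (simp add: extension_iff)
    moreover have "?z \<noteq> osuc \<nu> p" using \<nu>.zero_le[OF p] \<nu>.le_suc[OF p] \<nu>.suc_ne[OF p] \<nu>.le_antisym by metis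
    ultimately have "P (osuc \<nu> p) (\<lambda>i. if i = osuc \<nu> p then Ident ?A (Cod ?A y) else y \<cdot>\<^bsub>?A\<^esub> \<tau> i p)"
      by (simp add: P_def)
    moreover have "S p (\<tau> ?z p) y" using ug by (simp add: S_def y_def extension_iff)
    moreover have "Dom ?A y = D p" by (simp add: y_def n_def)
    ultimately show "\<exists>f. f \<in> Arr ?A \<and> Dom ?A f = D p \<and> S p (\<tau> ?z p) f \<and>
        P (osuc \<nu> p) (\<lambda>i. if i = osuc \<nu> p then Ident ?A (Cod ?A f) else f \<cdot>\<^bsub>?A\<^esub> \<tau> i p)" using yA by blast
  next
    fix l D \<tau> assume l: "olimit \<nu> l" and d: "diagram ?A (Restr \<nu> (underS \<nu> l)) D \<tau>"
      and Dz: "D ?z = n0" and Pj: "\<forall>j\<in>underS \<nu> l. P j (\<lambda>i. \<tau> i j)"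
    let ?r = "Restr \<nu> (underS \<nu> l)"
    have Fr: "Field ?r = underS \<nu> l" by (rule \<nu>.Field_Restr_underS)
    have zl: "?z \<in> underS \<nu> l" using underS_nonempty_limit[OF _ l] \<nu>.WELL by blast
    have dir: "directed (Univ K) natLeq ?r" by (rule directed_underS[OF \<nu> l])
    have diaM: "diagram (models K) ?r (\<lambda>i. Dom K (D i)) (\<lambda>i j. src (\<tau> i j))"
      using M.arrow_diagramD(4)[OF d] by simp
    obtain X k where X: "colimit (models K) ?r (\<lambda>i. Dom K (D i)) (\<lambda>i j. src (\<tau> i j)) X k"
      using models_colimit_exists[OF dir diaM] .
    have zi: "(?z, i) \<in> ?r" if "i \<in> Field ?r" for i
    proof -
      have iu: "i \<in> underS \<nu> l" using that unfolding Fr .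
      then have "i \<in> Field \<nu>" unfolding Order_Relation.underS_def by (auto intro: FieldI1)
      then show ?thesis using iu zl \<nu>.zero_le by simp
    qed
    have ii: "ind (Cod K (D i)) (trg (\<tau> ?z i) \<cdot> \<alpha>) (D i \<cdot> (src (\<tau> ?z i) \<cdot> c)) (D i)" if "i \<in> Field ?r" for i
    proof -
      have "i \<in> underS \<nu> l" using that Fr by simp
      moreover from this have "i \<in> Field \<nu>" unfolding Order_Relation.underS_def by (auto intro: FieldI1)
      ultimately have "G (\<tau> ?z i)" using Pj by (auto simp: P_def)
      moreover have "Cod ?A (\<tau> ?z i) = D i" using A.diagramD(6)[OF d zi[OF that]] .
      ultimately show ?thesis by (simp add: G_def)
    qed
    have "\<exists>n l'. cocone ?A ?r D \<tau> n (\<lambda>i. (D i, k i, l' i, n)) \<and> Dom K n = X \<and>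
      ind (Cod K n) (l' ?z \<cdot> \<alpha>) (n \<cdot> (k ?z \<cdot> c)) n"
      by (rule limit_independent[OF dir d _ zi X _ _ ii]) (use zl Fr Dz \<alpha> c n0 in \<open>auto simp: extension_iff\<close>)
    then obtain n l' where n: "cocone ?A ?r D \<tau> n (\<lambda>i. (D i, k i, l' i, n))" "Dom K n = X"
      "ind (Cod K n) (l' ?z \<cdot> \<alpha>) (n \<cdot> (k ?z \<cdot> c)) n" by blast
    have "?z \<noteq> l" using zl by (auto simp: underS_def)
    then have "P l (\<lambda>i. if i = l then Ident ?A n else (D i, k i, l' i, n))"
      using n(3) by (simp add: P_def G_def)
    moreover have "L l D \<tau> n (\<lambda>i. (D i, k i, l' i, n))" using X n(2) by (simp add: L_def)
    ultimately show "\<exists>X k. cocone ?A ?r D \<tau> X k \<and> L l D \<tau> X k \<and> P l (\<lambda>i. if i = l then Ident ?A X else k i)"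
      using n(1) by blast
  qed
  then obtain n \<tau> where d: "diagram ?A \<nu> n \<tau>" and nz: "n ?z = n0"
    and P: "\<And>j. j \<in> Field \<nu> \<Longrightarrow> P j (\<lambda>i. \<tau> i j)"
    and S: "\<And>p. p \<in> Field \<nu> \<Longrightarrow> S p (\<tau> ?z p) (\<tau> p (osuc \<nu> p))"
    and L: "\<And>l. olimit \<nu> l \<Longrightarrow> L l n \<tau> (n l) (\<lambda>i. \<tau> i l)" by blast
  define D t where "D i = Dom K (n i)" and "t i j = src (\<tau> i j)" for i j
  note nd = M.arrow_diagramD[OF d]
  have dia: "diagram (models K) \<nu> D t" using nd(4) by (simp add: D_def[abs_def] t_def[abs_def])
  obtain W m where Wm: "colimit (models K) \<nu> D t W m"
    using models_colimit_exists[OF directed_regular[OF \<nu>] dia] .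
  have coc: "cocone (models K) \<nu> D t W m" using Wm by (simp add: colimit_def)
  define \<alpha>i where "\<alpha>i i = trg (\<tau> ?z i) \<cdot> \<alpha>" for i
  \<comment> \<open>The codomain of \<open>n i\<close> is the segment with index
    \<open>osuc \<nu> i\<close>, so the copy of \<open>\<alpha>\<close> inside it becomes the
    \<open>i\<close>-th term.\<close>
  define bs where "bs i = m (osuc \<nu> i) \<cdot> \<alpha>i i" for i
  have Dz: "D ?z = M" using n0 nz by (simp add: D_def extension_iff)
  have nE: "extension K (D i) (n i) (Cod K (n i))" if "i \<in> Field \<nu>" for i
    using nd(1)[OF that] by (simp add: extension_iff D_def)
  have hE: "extension K (Cod K (n i)) (trg (\<tau> i j)) (Cod K (n j))" if "(i, j) \<in> \<nu>" for i j
    using models_diagram_ext[of \<nu> "\<lambda>i. Cod K (n i)" "\<lambda>i j. trg (\<tau> i j)"] nd(5) that by simp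
  have tE: "extension K (D i) (t i j) (D j)" if "(i, j) \<in> \<nu>" for i j
    using models_diagram_ext[OF dia that] .
  have mE: "extension K (D i) (m i) W" if "i \<in> Field \<nu>" for i using models_cocone_ext[OF coc that] .
  have suc: "t i (osuc \<nu> i) = n i" "D (osuc \<nu> i) = Cod K (n i)" if i: "i \<in> Field \<nu>" for i
  proof -
    have "\<tau> i (osuc \<nu> i) = (n i, src (\<tau> i (osuc \<nu> i)), trg (\<tau> i (osuc \<nu> i)), n (osuc \<nu> i))"
      using nd(2)[of i "osuc \<nu> i"] i by simp
    then have "Dom ?A (\<tau> i (osuc \<nu> i)) = n i" "Cod ?A (\<tau> i (osuc \<nu> i)) = n (osuc \<nu> i)"
      by (metis arrow_cat_simps(2), metis arrow_cat_simps(3))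
    then show "t i (osuc \<nu> i) = n i" "D (osuc \<nu> i) = Cod K (n i)"
      using S[OF i] by (simp_all add: S_def t_def D_def)
  qed
  have msE: "extension K (Cod K (n i)) (m (osuc \<nu> i)) W" if "i \<in> Field \<nu>" for i
    using mE[of "osuc \<nu> i"] that suc(2)[OF that] by simp
  have mn: "m (osuc \<nu> i) \<cdot> n i = m i" if "i \<in> Field \<nu>" for i
    using M.coconeD(5)[OF coc, of i "osuc \<nu> i"] suc(1)[OF that] that by simp
  have \<alpha>E: "into K (\<alpha>i i) (Cod K (n i))" if "i \<in> Field \<nu>" for i
    unfolding \<alpha>i_def using into_ext[OF _ hE[of ?z i]] \<alpha> n0 nz that by (simp add: extension_iff)
  have cE: "into K (t ?z i \<cdot> c) (D i)" if "i \<in> Field \<nu>" for i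
    using into_ext[OF _ tE[of ?z i]] c Dz that by simp
  have mc: "m (osuc \<nu> i) \<cdot> (n i \<cdot> (t ?z i \<cdot> c)) = m ?z \<cdot> c" if i: "i \<in> Field \<nu>" for i
  proof -
    have "m (osuc \<nu> i) \<cdot> (n i \<cdot> (t ?z i \<cdot> c)) = m i \<cdot> (t ?z i \<cdot> c)"
      using ext_assoc[OF nE[OF i] msE[OF i] cE[OF i]] mn[OF i] by simp
    also have "\<dots> = (m i \<cdot> t ?z i) \<cdot> c" using ext_assoc[OF tE[of ?z i] mE[OF i]] i c Dz by simp
    also have "m i \<cdot> t ?z i = m ?z" using M.coconeD(5)[OF coc, of ?z i] i by simp
    finally show ?thesis .
  qed
  have main: "into K (bs i) W \<and> Dom K (bs i) = Dom K \<alpha> \<and> sub_le K (bs i) (m (osuc \<nu> i)) \<and>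
    ind W (bs i) (m ?z \<cdot> c) (m i) \<and> gtp_eq K [bs i, m ?z \<cdot> c] W [b, c] M" if i: "i \<in> Field \<nu>" for i
  proof (intro conjI)
    show "into K (bs i) W" unfolding bs_def by (rule into_ext[OF \<alpha>E[OF i] msE[OF i]])
    show "Dom K (bs i) = Dom K \<alpha>"
      using \<alpha>E[OF i] msE[OF i] hE[of ?z i] i \<alpha> n0 nz by (simp add: bs_def \<alpha>i_def extension_iff into_def)
    show "sub_le K (bs i) (m (osuc \<nu> i))"
      unfolding bs_def by (rule sub_le_Comp) (use \<alpha>E[OF i] msE[OF i] in \<open>auto simp: into_def extension_iff\<close>)
    have "Cod ?A (\<tau> ?z i) = n i" using A.diagramD(6)[OF d, of ?z i] i by simp
    then have ii: "ind (Cod K (n i)) (\<alpha>i i) (n i \<cdot> (t ?z i \<cdot> c)) (n i)"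
      using P[OF i] i by (simp add: P_def G_def \<alpha>i_def t_def)
    show "ind W (bs i) (m ?z \<cdot> c) (m i)"
      using ind_ext[OF ii msE[OF i]] by (simp add: bs_def mc[OF i] mn[OF i])
    have sq: "trg (\<tau> ?z i) \<cdot> n0 = n i \<cdot> t ?z i" using nd(3)[of ?z i] i nz by (simp add: t_def)
    have "trg (\<tau> ?z i) \<cdot> (n0 \<cdot> c) = n i \<cdot> (t ?z i \<cdot> c)"
      by (rule reassoc[OF sq]) (use n0 c nE[OF i] tE[of ?z i] hE[of ?z i] i Dz nz in \<open>auto simp: extension_iff into_def\<close>)
    then have "gtp_eq K [\<alpha>i i, n i \<cdot> (t ?z i \<cdot> c)] (Cod K (n i)) [b, c] M"
      using gtp_ext2[of N0 "trg (\<tau> ?z i)" "Cod K (n i)" \<alpha> "n0 \<cdot> c"] hE[of ?z i] i n0 nz \<alpha> into_ext[OF c n0] tp0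
      by (simp add: \<alpha>i_def extension_iff)
    then show "gtp_eq K [bs i, m ?z \<cdot> c] W [b, c] M"
      using gtp_ext2[OF msE[OF i] \<alpha>E[OF i] into_ext[OF cE[OF i] nE[OF i]]] by (simp add: bs_def mc[OF i])
  qed
  have isi: "gtp_eq K [bs i, m i] W [bs j, m i] W" if ij: "(i, j) \<in> \<nu>" for i j
  proof -
    have F: "i \<in> Field \<nu>" "j \<in> Field \<nu>" using \<nu>.le_Field[OF ij] .
    note nI = extension_into[OF nE[OF F(1)]]
    have "gtp_eq K [bs i, m i] W [\<alpha>i i, n i] (Cod K (n i))"
      using gtp_ext2[OF msE[OF F(1)] \<alpha>E[OF F(1)] nI] gtp_refl[of "Cod K (n i)" "[\<alpha>i i, n i]"] \<alpha>E[OF F(1)] nI mn[OF F(1)]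
      by (simp add: bs_def into_def)
    \<comment> \<open>The transition on codomains sends \<open>\<alpha>i i\<close> to
      \<open>\<alpha>i j\<close> and agrees with \<open>n j \<cdot> t i j\<close> on the segment
      \<open>D i\<close>; so the \<open>j\<close>-th term realizes over \<open>D i\<close> the same
      type as the \<open>i\<close>-th.\<close>
    moreover have "gtp_eq K [bs j, m i] W [\<alpha>i i, n i] (Cod K (n i))"
    proof -
      note h = hE[OF ij] and h0 = hE[of ?z i, OF \<nu>.zero_le[OF F(1)]]
      have "trg (\<tau> i j) \<cdot> trg (\<tau> ?z i) = trg (\<tau> ?z j)"
        using M.diagramD(7)[OF nd(5), of ?z i j] F ij by simp
      then have a: "trg (\<tau> i j) \<cdot> \<alpha>i i = \<alpha>i j"
        unfolding \<alpha>i_def using ext_assoc[OF h0 h, of \<alpha>] \<alpha> n0 nz by (simp add: extension_iff)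
      have "m (osuc \<nu> j) \<cdot> (trg (\<tau> i j) \<cdot> n i) = m (osuc \<nu> j) \<cdot> (n j \<cdot> t i j)"
        using nd(3)[OF ij] by (simp add: t_def)
      also have "\<dots> = m j \<cdot> t i j"
        by (rule reassoc1[OF mn[OF F(2)]]) (use nE[OF F(2)] msE[OF F(2)] tE[OF ij] in \<open>auto simp: extension_iff\<close>)
      also have "\<dots> = m i" using M.coconeD(5)[OF coc ij] by simp
      finally have b: "m (osuc \<nu> j) \<cdot> (trg (\<tau> i j) \<cdot> n i) = m i" .
      have "gtp_eq K [m (osuc \<nu> j) \<cdot> \<alpha>i j, m (osuc \<nu> j) \<cdot> (trg (\<tau> i j) \<cdot> n i)] W [\<alpha>i j, trg (\<tau> i j) \<cdot> n i] (Cod K (n j))"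
        using gtp_ext[OF msE[OF F(2)], of "[\<alpha>i j, trg (\<tau> i j) \<cdot> n i]"] \<alpha>E[OF F(2)] into_ext[OF nI h] by simp
      moreover have "gtp_eq K [\<alpha>i j, trg (\<tau> i j) \<cdot> n i] (Cod K (n j)) [\<alpha>i i, n i] (Cod K (n i))"
        using gtp_ext[OF h, of "[\<alpha>i i, n i]"] \<alpha>E[OF F(1)] nI a by simp
      ultimately show ?thesis using gtp_trans b by (simp add: bs_def)
    qed
    ultimately show ?thesis using gtp_trans gtp_sym by blast
  qed
  have "initial_segments K \<nu> W bs D t m"
    unfolding initial_segments_def using main dia coc L by (auto simp: L_def D_def[abs_def] t_def[abs_def])
  then show ?thesis using mE[of ?z] Dz main isi by (metis \<nu>.zero_in)
qed

text \<open>If independence fails, no \<open>\<kappa>\<close> many terms of an independent sequence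
  starting at \<open>M\<close> are consistent; any regular \<open>\<mu>\<close> above
  \<open>\<kappa>\<close> then witnesses dividing. The parameter \<open>Sq\<close> lets the same
  argument serve isi-dividing and long Kim-dividing.\<close>

lemma not_ind_imp_divides_along:
  assumes i: "into K a M" "into K b M" "into K c M" and n: "\<not> ind M a c b"
    and seq: "\<And>\<nu>. regular_cardinal (Univ K) \<nu> \<Longrightarrow> \<exists>N f bs D t m. extension K M f N \<and>
      initial_segments K \<nu> N bs D t m \<and> D (ozero \<nu>) = M \<and> m (ozero \<nu>) = f \<and>
      (\<forall>i\<in>Field \<nu>. ind N (bs i) (f \<cdot> c) (m i) \<and> gtp_eq K [bs i, f \<cdot> c] N [b, c] M) \<and> Sq \<nu> (f \<cdot> c) N bs"
  shows "divides_along K Sq a b c M"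
proof -
  obtain \<kappa> where \<kappa>: "regular_cardinal (Univ K) \<kappa>" and H0: "(\<forall>\<nu> N f bs D t m I b c. regular_cardinal (Univ K) \<nu> \<longrightarrow>
    into K b M \<longrightarrow> into K c M \<longrightarrow>
    extension K M f N \<longrightarrow> initial_segments K \<nu> N bs D t m \<longrightarrow> D (ozero \<nu>) = M \<longrightarrow> m (ozero \<nu>) = f \<longrightarrow>
    (\<forall>i\<in>Field \<nu>. ind N (bs i) (f \<cdot> c) (m i)) \<longrightarrow> I \<subseteq> Field \<nu> \<longrightarrow> |I| =o \<kappa> \<longrightarrow>
    consistent_for K a b c M f N bs I \<longrightarrow> ind M a c b)"
    using consistent_imp_ind[OF i(1)] by (elim exE conjE) (rule that)
  obtain \<mu> where \<mu>: "regular_cardinal (Univ K) \<mu>" "\<kappa> <o \<mu>"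
    using regular_above[OF small_finite[of "{} :: 'u set"] \<kappa> \<kappa>] by auto
  have "\<exists>N f bs. extension K M f N \<and> Sq \<nu> (f \<cdot> c) N bs \<and>
              (\<forall>i \<in> Field \<nu>. gtp_eq K [bs i, f \<cdot> c] N [b, c] M) \<and>
              (\<exists>\<kappa>. regular_cardinal (Univ K) \<kappa> \<and> \<kappa> <o \<nu> \<and>
                 (\<forall>I \<subseteq> Field \<nu>. |I| =o \<kappa> \<longrightarrow> \<not> consistent_for K a b c M f N bs I))"
    if \<nu>: "regular_cardinal (Univ K) \<nu>" "\<mu> \<le>o \<nu>" for \<nu>
  proof -
    obtain N f bs D t m where s: "extension K M f N" "initial_segments K \<nu> N bs D t m" "D (ozero \<nu>) = M"
      "m (ozero \<nu>) = f" "\<forall>i\<in>Field \<nu>. ind N (bs i) (f \<cdot> c) (m i) \<and> gtp_eq K [bs i, f \<cdot> c] N [b, c] M"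
      "Sq \<nu> (f \<cdot> c) N bs"
      using seq[OF \<nu>(1)] by (elim exE conjE) (rule that)
    have "\<kappa> <o \<nu>" using \<mu>(2) \<nu>(2) ordLess_ordLeq_trans by blast
    moreover have "\<not> consistent_for K a b c M f N bs I" if I: "I \<subseteq> Field \<nu>" "|I| =o \<kappa>" for I
    proof
      assume con: "consistent_for K a b c M f N bs I"
      have "\<forall>i\<in>Field \<nu>. ind N (bs i) (f \<cdot> c) (m i)" using s(5) by blast
      then have "ind M a c b"
        using H0[rule_format, OF \<nu>(1) i(2,3) s(1-4) _ I con] by blast
      then show False using n by blast
    qed
    ultimately have "\<exists>\<kappa>. regular_cardinal (Univ K) \<kappa> \<and> \<kappa> <o \<nu> \<and>
                 (\<forall>I \<subseteq> Field \<nu>. |I| =o \<kappa> \<longrightarrow> \<not> consistent_for K a b c M f N bs I)"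
      using \<kappa> by blast
    moreover have "\<forall>i \<in> Field \<nu>. gtp_eq K [bs i, f \<cdot> c] N [b, c] M" using s(5) by blast
    ultimately show ?thesis
      using s(1,6) by (intro exI[of _ N] exI[of _ f] exI[of _ bs] conjI)
  qed
  then show ?thesis using \<mu>(1) unfolding divides_along_def by blast
qed

lemma isi_f_imp_ind:
  assumes f: "isi_f_indep K M a c b" and cB: "sub_in K c B"
  shows "ind M a c b"
proof (rule ccontr)
  assume n: "\<not> ind M a c b"
  have i: "into K a M" "into K c M" "into K b M" and nf: "\<not> isi_forks K a b c M"
    using f by (auto simp: isi_f_indep_def)
  have "divides_along K (isi_sequence K) a b c M"
  proof (rule not_ind_imp_divides_along[OF i(1,3,2) n])
    fix \<nu> assume \<nu>: "regular_cardinal (Univ K) \<nu>"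
    obtain N f bs D t m where s: "extension K M f N" "initial_segments K \<nu> N bs D t m" "D (ozero \<nu>) = M"
      "m (ozero \<nu>) = f" "\<forall>i\<in>Field \<nu>. ind N (bs i) (f \<cdot> c) (m i) \<and> gtp_eq K [bs i, f \<cdot> c] N [b, c] M"
      "\<forall>i j. (i, j) \<in> \<nu> \<longrightarrow> gtp_eq K [bs i, m i] N [bs j, m i] N"
      using independent_isi_sequence_exists[OF i(3,2) cB \<nu>] by (elim exE conjE) (rule that)
    have "sub_le K (f \<cdot> c) (m (ozero \<nu>))"
      unfolding s(4) by (rule sub_le_Comp) (use s(1) i(2) in \<open>auto simp: extension_iff into_def\<close>)
    then have "isi_sequence K \<nu> (f \<cdot> c) N bs" using s unfolding isi_sequence_def by blast
    then show "\<exists>N f bs D t m. extension K M f N \<and>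
      initial_segments K \<nu> N bs D t m \<and> D (ozero \<nu>) = M \<and> m (ozero \<nu>) = f \<and>
      (\<forall>i\<in>Field \<nu>. ind N (bs i) (f \<cdot> c) (m i) \<and> gtp_eq K [bs i, f \<cdot> c] N [b, c] M) \<and>
      isi_sequence K \<nu> (f \<cdot> c) N bs" using s by blast
  qed
  then show False using nf isi_divides_imp_forks i by (simp add: isi_divides_def)
qed

lemma lK_imp_ind:
  assumes ex: "existence_axiom K B" and l: "lK_indep K M a c b" and cB: "sub_in K c B"
  shows "ind M a c b"
proof (rule ccontr)
  assume n: "\<not> ind M a c b"
  have i: "into K a M" "into K c M" "into K b M" and nf: "\<not> long_Kim_divides K a b c M"
    using l by (auto simp: lK_indep_def)
  have "divides_along K (independent_sequence K (isi_f_indep K)) a b c M"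
  proof (rule not_ind_imp_divides_along[OF i(1,3,2) n])
    fix \<nu> assume \<nu>: "regular_cardinal (Univ K) \<nu>"
    obtain N f bs D t m where s: "extension K M f N" "initial_segments K \<nu> N bs D t m" "D (ozero \<nu>) = M"
      "m (ozero \<nu>) = f"
      "\<forall>i\<in>Field \<nu>. isi_f_indep K N (bs i) (f \<cdot> c) (m i) \<and> gtp_eq K [bs i, f \<cdot> c] N [b, c] M"
      using isi_f_independent_sequence_exists[OF ex i(3,2) cB \<nu>] by (elim exE conjE) (rule that)
    have "sub_le K (f \<cdot> c) (m (ozero \<nu>))"
      unfolding s(4) by (rule sub_le_Comp) (use s(1) i(2) in \<open>auto simp: extension_iff into_def\<close>)
    then have "independent_sequence K (isi_f_indep K) \<nu> (f \<cdot> c) N bs"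
      using s unfolding independent_sequence_def by blast
    moreover have "\<forall>i\<in>Field \<nu>. ind N (bs i) (f \<cdot> c) (m i)"
      using s(5) isi_f_imp_ind sub_in_ext[OF cB i(2) s(1)] by blast
    ultimately show "\<exists>N f bs D t m. extension K M f N \<and>
      initial_segments K \<nu> N bs D t m \<and> D (ozero \<nu>) = M \<and> m (ozero \<nu>) = f \<and>
      (\<forall>i\<in>Field \<nu>. ind N (bs i) (f \<cdot> c) (m i) \<and> gtp_eq K [bs i, f \<cdot> c] N [b, c] M) \<and>
      independent_sequence K (isi_f_indep K) \<nu> (f \<cdot> c) N bs" using s by blast
  qed
  then show False using nf by (simp add: long_Kim_divides_def)
qed

section \<open>Realizing a type along an independent sequence\<close>

text \<open>The successor step of the realization. The independence theorem merges the type of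
  \<open>\<alpha>\<close> over the segment \<open>D\<close> with the type of \<open>a'\<close> over
  the new term \<open>\<beta>\<close>, into some \<open>s\<close> independent from all of
  \<open>V\<close> and so from the next segment \<open>D'\<close>. Maps in the arrow category must
  preserve the realization, so a last amalgamation turns \<open>s\<close> into an image of
  \<open>\<alpha>\<close>.\<close>

lemma amalgamate_independent:
  assumes n: "extension K D n N" and t: "extension K D t D'" and e: "into K e D" and ia: "ind N \<alpha> (n \<cdot> e) n"
    and x: "extension K N x V" and y: "extension K D' y V" and xy: "x \<cdot> n = y \<cdot> t"
    and \<beta>: "into K \<beta> D'"
    and ia': "ind V a' (x \<cdot> (n \<cdot> e)) (y \<cdot> \<beta>)" and ib: "ind V (x \<cdot> n) (x \<cdot> (n \<cdot> e)) (y \<cdot> \<beta>)"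
    and L: "Lgtp_eq K [x \<cdot> (n \<cdot> e)] V [x \<cdot> \<alpha>] [a']"
  shows "\<exists>N' v n'. extension K N v N' \<and> extension K D' n' N' \<and> v \<cdot> n = n' \<cdot> t \<and>
    ind N' (v \<cdot> \<alpha>) (n' \<cdot> (t \<cdot> e)) n' \<and>
    gtp_eq K [v \<cdot> \<alpha>, n' \<cdot> \<beta>, n' \<cdot> (t \<cdot> e)] N' [a', y \<cdot> \<beta>, x \<cdot> (n \<cdot> e)] V"
proof -
  let ?c = "x \<cdot> (n \<cdot> e)" and ?b = "y \<cdot> \<beta>"
  have \<alpha>: "into K \<alpha> N" using ind_into(1)[OF ia] .
  have nI: "into K n N" by (rule extension_into[OF n])
  have neI: "into K (n \<cdot> e) N" by (rule into_ext[OF e n])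
  have i: "into K (x \<cdot> \<alpha>) V" "into K (x \<cdot> n) V" "into K ?c V" "into K a' V" "into K ?b V"
    using into_ext[OF \<alpha> x] into_ext[OF nI x] into_ext[OF neI x] ind_into[OF ia'] by auto
  have "ind V (x \<cdot> \<alpha>) ?c (x \<cdot> n)" by (rule ind_ext[OF ia x])
  then obtain V' g s where g: "extension K V g V'" and s: "into K s V'"
    and L1: "Lgtp_eq K [g \<cdot> ?c] V' [s, g \<cdot> (x \<cdot> n)] [g \<cdot> (x \<cdot> \<alpha>), g \<cdot> (x \<cdot> n)]"
    and L2: "Lgtp_eq K [g \<cdot> ?c] V' [s, g \<cdot> ?b] [g \<cdot> a', g \<cdot> ?b]"
    and iis: "ind V' s (g \<cdot> ?c) g"
    using independence_theorem[OF _ ia' ib L] by blast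
  \<comment> \<open>The first Lascar equality gives \<open>s\<close> and \<open>\<alpha>\<close> the
    same type over \<open>D\<close>, which is what lets \<open>s\<close> be identified with the
    image of \<open>\<alpha>\<close> under \<open>v\<close>.\<close>
  have "gtp_eq K [s, g \<cdot> (x \<cdot> n)] V' [g \<cdot> (x \<cdot> \<alpha>), g \<cdot> (x \<cdot> n)] V'"
    using Lgtp_pair_gtp[OF L1] by (auto simp: gtp_iff)
  moreover have "gtp_eq K [g \<cdot> (x \<cdot> \<alpha>), g \<cdot> (x \<cdot> n)] V' [\<alpha>, n] N"
    using gtp_ext2[OF g i(1,2)] gtp_ext[OF x, of "[\<alpha>, n]"] \<alpha> nI by simp
  ultimately have "gtp_eq K [s, g \<cdot> (x \<cdot> n)] V' [\<alpha>, n] N" by (rule gtp_trans)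
  then obtain N' u v where u: "extension K V' u N'" and v: "extension K N v N'"
    and eq: "u \<cdot> s = v \<cdot> \<alpha>" "u \<cdot> (g \<cdot> (x \<cdot> n)) = v \<cdot> n"
    by (auto simp: gtp_iff)
  define n' where "n' = u \<cdot> (g \<cdot> y)"
  have n': "extension K D' n' N'" unfolding n'_def by (rule extension_Comp[OF extension_Comp[OF y g] u])
  have n'y: "n' \<cdot> d = u \<cdot> (g \<cdot> (y \<cdot> d))" if "into K d D'" for d
    using that u g y by (simp add: n'_def extension_iff into_def)
  have sq: "v \<cdot> n = n' \<cdot> t" using eq(2) xy n'y[OF extension_into[OF t]] by simp
  have "(u \<cdot> (g \<cdot> (x \<cdot> n))) \<cdot> e = (n' \<cdot> t) \<cdot> e" using eq(2) sq by simp
  then have c: "u \<cdot> (g \<cdot> ?c) = n' \<cdot> (t \<cdot> e)"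
    using u g x n e n' t by (simp add: extension_iff into_def)
  have "ind N' (u \<cdot> s) (u \<cdot> (g \<cdot> ?c)) (u \<cdot> g)" by (rule ind_ext[OF iis u])
  then have "ind N' (v \<cdot> \<alpha>) (n' \<cdot> (t \<cdot> e)) (u \<cdot> g)" using c eq by simp
  moreover have "sub_le K n' (u \<cdot> g)"
  proof -
    have "n' = (u \<cdot> g) \<cdot> y" using u g y by (simp add: n'_def extension_iff)
    then show ?thesis using sub_le_Comp[of y "u \<cdot> g"] u g y by (simp add: extension_iff)
  qed
  ultimately have ind': "ind N' (v \<cdot> \<alpha>) (n' \<cdot> (t \<cdot> e)) n'" by (rule ind_mono_right)
  have "gtp_eq K [v \<cdot> \<alpha>, n' \<cdot> \<beta>, n' \<cdot> (t \<cdot> e)] N' [s, g \<cdot> ?b, g \<cdot> ?c] V'"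
    using gtp_ext[OF u, of "[s, g \<cdot> ?b, g \<cdot> ?c]"] s into_ext[OF i(5) g] into_ext[OF i(3) g] c eq(1) n'y[OF \<beta>] by simp
  moreover have "gtp_eq K [s, g \<cdot> ?b, g \<cdot> ?c] V' [g \<cdot> a', g \<cdot> ?b, g \<cdot> ?c] V'" by (rule Lgtp_pair_gtp[OF L2])
  moreover have "gtp_eq K [g \<cdot> a', g \<cdot> ?b, g \<cdot> ?c] V' [a', ?b, ?c] V"
    using gtp_ext[OF g, of "[a', ?b, ?c]"] i by simp
  ultimately have "gtp_eq K [v \<cdot> \<alpha>, n' \<cdot> \<beta>, n' \<cdot> (t \<cdot> e)] N' [a', ?b, ?c] V" using gtp_trans by blast
  then show ?thesis using v n' sq ind' by blast
qed

text \<open>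
  The independence theorem, applied trivially over \<open>c\<close>, makes a realization independent from the
  ambient model without changing its Lascar type.
\<close>

lemma independent_Lascar:
  assumes a: "into K a M" and c: "into K c M" and cB: "sub_in K c B"
  obtains N f s where "extension K M f N" "ind N s (f \<cdot> c) f" "Lgtp_eq K [f \<cdot> c] N [s] [f \<cdot> a]"
  using independence_theorem[OF ind_base[OF a c cB] ind_base[OF a c cB] ind_base[OF c c cB] Lgtp_refl[OF a c]]
    Lgtp_fst by metis

text \<open>
  At a stage \<open>p \<in> I0\<close> the realization \<open>\<alpha>\<close> built so far, the starting point \<open>s\<close> and a realization \<open>a'\<close>
  matching \<open>bs p\<close> are compared in one model: \<open>\<alpha>\<close> and \<open>s\<close> have the same type over the first initial
  segment, while \<open>a'\<close> and the realization \<open>as\<close> matching \<open>bs i0\<close> have the same type over \<open>M\<close>. So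
  \<open>\<alpha>\<close> and \<open>a'\<close> have the same Lascar type over \<open>c\<close> and the independence theorem applies.
\<close>

lemma realize_independent_sequence:
  assumes iab: "ind M a c b" and f: "extension K M f N" and \<nu>: "regular_cardinal (Univ K) \<nu>"
    and ini: "initial_segments K \<nu> N bs D t m" and cm: "sub_le K (f \<cdot> c) (m (ozero \<nu>))"
    and ind: "\<And>i. i \<in> Field \<nu> \<Longrightarrow> ind N (bs i) (f \<cdot> c) (m i)"
    and I0: "I0 \<subseteq> Field \<nu>" and i0: "i0 \<in> I0"
    and same: "\<And>i. i \<in> I0 \<Longrightarrow> gtp_eq K [bs i, f] N [bs i0, f] N"
    and tpb: "gtp_eq K [bs i0, f \<cdot> c] N [b, c] M"
  shows "consistent_for K a b c M f N bs I0"
proof -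
  interpret \<nu>: ordinal "Univ K" \<nu> using \<nu> by unfold_locales
  interpret A: category "arrow_cat (models K)" by (rule M.category_arrow_cat)
  let ?A = "arrow_cat (models K)" and ?z = "ozero \<nu>"
  have i: "into K a M" "into K c M" "into K b M" using ind_into[OF iab] by auto
  have cB: "sub_in K c B" by (rule ind_sub_in[OF iab])
  define cc where "cc = f \<cdot> c"
  have ccI: "into K cc N" unfolding cc_def by (rule into_ext[OF i(2) f])
  have ccB: "sub_in K cc B" unfolding cc_def by (rule sub_in_ext[OF cB i(2) f])
  have dia: "diagram (models K) \<nu> D t" and coc: "cocone (models K) \<nu> D t N m"
    and bsm: "\<And>i. i \<in> Field \<nu> \<Longrightarrow> sub_le K (bs i) (m (osuc \<nu> i))"
    and lims: "\<And>l. olimit \<nu> l \<Longrightarrow> colimit (models K) (Restr \<nu> (underS \<nu> l)) D t (D l) (\<lambda>i. t i l)"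
    using ini by (auto simp: initial_segments_def)
  have tE: "extension K (D i) (t i j) (D j)" if "(i, j) \<in> \<nu>" for i j using models_diagram_ext[OF dia that] .
  have mE: "extension K (D i) (m i) N" if "i \<in> Field \<nu>" for i using models_cocone_ext[OF coc that] .
  have mt: "m j \<cdot> t i j = m i" if "(i, j) \<in> \<nu>" for i j using M.coconeD(5)[OF coc that] by simp
  have tt: "t j k \<cdot> t i j = t i k" if "(i, j) \<in> \<nu>" "(j, k) \<in> \<nu>" for i j k using M.diagramD(7)[OF dia that] by simp
  have tid: "t i i = Ident K (D i)" if "i \<in> Field \<nu>" for i using M.diagramD(3)[OF dia that] by simp
  \<comment> \<open>The base \<open>c\<close> and, next, the terms \<open>bs p\<close> are pulled
    back to arrows into the segments, the only data that the recursion sees of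
    \<open>N\<close>.\<close>
  obtain c0 where c0: "into K c0 (D ?z)" "m ?z \<cdot> c0 = cc"
    using cm mE[OF \<nu>.zero_in] unfolding sub_le_def cc_def[symmetric]
    by (auto simp: hom_def into_def extension_iff)
  have "\<exists>\<beta>. into K \<beta> (D (osuc \<nu> p)) \<and> m (osuc \<nu> p) \<cdot> \<beta> = bs p" if p: "p \<in> Field \<nu>" for p
    using bsm[OF p] mE[of "osuc \<nu> p"] p unfolding sub_le_def by (auto simp: hom_def into_def extension_iff)
  then obtain \<beta> where \<beta>: "\<And>p. p \<in> Field \<nu> \<Longrightarrow> into K (\<beta> p) (D (osuc \<nu> p))"
    "\<And>p. p \<in> Field \<nu> \<Longrightarrow> m (osuc \<nu> p) \<cdot> \<beta> p = bs p" by metis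
  have i0F: "i0 \<in> Field \<nu>" using I0 i0 by blast
  have bsI: "into K (bs p) N" if "p \<in> Field \<nu>" for p using ind_into(1)[OF ind[OF that]] .
  have fI: "into K f N" by (rule extension_into[OF f])
  obtain N1 x1 y1 where N1: "extension K N x1 N1" "extension K M y1 N1" "x1 \<cdot> bs i0 = y1 \<cdot> b" "x1 \<cdot> cc = y1 \<cdot> c"
    using tpb unfolding cc_def by (auto simp: gtp_iff)
  \<comment> \<open>A copy of \<open>a\<close> that stands to \<open>bs i0\<close> as
    \<open>a\<close> stands to \<open>b\<close>.\<close>
  define a1 where "a1 = y1 \<cdot> a"
  have a1I: "into K a1 N1" unfolding a1_def by (rule into_ext[OF i(1) N1(2)])
  have tp1: "gtp_eq K [a1, x1 \<cdot> bs i0, x1 \<cdot> cc] N1 [a, b, c] M"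
    using gtp_ext[OF N1(2), of "[a, b, c]"] i N1(3,4) by (simp add: a1_def)
  \<comment> \<open>The copy \<open>a1\<close> need not be independent from the first segment;
    \<open>s\<close> is, and keeps the Lascar type over \<open>c\<close>, so the recursion can start
    from it.\<close>
  obtain N2 x2 s where x2: "extension K N1 x2 N2" and sI: "ind N2 s (x2 \<cdot> (x1 \<cdot> cc)) x2"
    and sL: "Lgtp_eq K [x2 \<cdot> (x1 \<cdot> cc)] N2 [s] [x2 \<cdot> a1]"
    using independent_Lascar[OF a1I into_ext[OF ccI N1(1)] sub_in_ext[OF ccB ccI N1(1)]] .
  define w0 where "w0 = x2 \<cdot> x1"
  define as where "as = x2 \<cdot> a1"
  have w0: "extension K N w0 N2" unfolding w0_def by (rule extension_Comp[OF N1(1) x2])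
  have w0d: "x2 \<cdot> (x1 \<cdot> d) = w0 \<cdot> d" if "into K d N" for d
    unfolding w0_def using ext_assoc[OF N1(1) x2 that] by simp
  have asI: "into K as N2" unfolding as_def by (rule into_ext[OF a1I x2])
  have F3: "Lgtp_eq K [w0 \<cdot> cc] N2 [s] [as]" using sL w0d[OF ccI] by (simp add: as_def)
  have F4: "gtp_eq K [as, w0 \<cdot> bs i0, w0 \<cdot> cc] N2 [a, b, c] M"
    using gtp_ext3[OF x2 a1I into_ext[OF bsI[OF i0F] N1(1)] into_ext[OF ccI N1(1)]] tp1 w0d[OF ccI] w0d[OF bsI[OF i0F]]
    by (simp add: as_def)
  define \<sigma> where "\<sigma> = w0 \<cdot> m ?z"
  have mzI: "into K (m ?z) N" using extension_into[OF mE] by simp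
  have \<sigma>: "extension K (D ?z) \<sigma> N2" unfolding \<sigma>_def by (rule extension_Comp[OF mE w0]) simp
  have \<sigma>c: "\<sigma> \<cdot> c0 = w0 \<cdot> cc" unfolding \<sigma>_def using ext_assoc[OF mE w0 c0(1)] c0(2) by simp
  have sIn: "into K s N2" using ind_into(1)[OF sI] .
  have F2: "ind N2 s (\<sigma> \<cdot> c0) \<sigma>"
  proof -
    have "\<sigma> = x2 \<cdot> (x1 \<cdot> m ?z)" using w0d[OF mzI] by (simp add: \<sigma>_def)
    then have "sub_le K \<sigma> x2"
      using sub_le_Comp[of "x1 \<cdot> m ?z" x2] x2 N1(1) mE[OF \<nu>.zero_in] by (simp add: extension_iff)
    then show ?thesis using ind_mono_right[OF sI] w0d[OF ccI] \<sigma>c by simp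
  qed
  have \<sigma>A: "\<sigma> \<in> Obj ?A" using \<sigma> by (simp add: extension_iff)
  define G where "G x \<longleftrightarrow> ind (Cod K (Cod ?A x)) (trg x \<cdot> s) (Cod ?A x \<cdot> (src x \<cdot> c0)) (Cod ?A x)" for x
  \<comment> \<open>Here the segments are prescribed: besides independence, the invariant pins the
    domain side to the given chain \<open>t\<close>, whose continuity comes from
    \<open>lims\<close>.\<close>
  define P where "P j T \<longleftrightarrow> (j \<in> Field \<nu> \<longrightarrow> G (T ?z) \<and> (\<forall>i\<in>under \<nu> j. src (T i) = t i j))" for j and T :: "'u \<Rightarrow> _"
  define S where "S p x y \<longleftrightarrow> (p \<in> I0 \<longrightarrow>
     gtp_eq K [trg y \<cdot> (trg x \<cdot> s), Cod ?A y \<cdot> \<beta> p, Cod ?A y \<cdot> (t ?z (osuc \<nu> p) \<cdot> c0)] (Cod K (Cod ?A y)) [a, b, c] M)"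
    for p and x y :: "'a \<times> 'a \<times> 'a \<times> 'a"
  have "\<exists>E \<tau>. diagram ?A \<nu> E \<tau> \<and> E ?z = \<sigma> \<and> (\<forall>j\<in>Field \<nu>. P j (\<lambda>i. \<tau> i j)) \<and>
    (\<forall>p\<in>Field \<nu>. S p (\<tau> ?z p) (\<tau> p (osuc \<nu> p))) \<and> (\<forall>l. olimit \<nu> l \<longrightarrow> True)"
  proof (rule A.chain_exists_cases[where L = "\<lambda>_ _ _ _ _. True", OF \<nu>.Cinf \<sigma>A])
    show "P j T'" if "\<forall>i\<in>under \<nu> j. T i = T' i" "P j T" for j T T'
      using that unfolding P_def under_def by auto
    have "\<forall>i\<in>under \<nu> ?z. i = ?z"
      using \<nu>.zero_le \<nu>.le_antisym \<nu>.le_Field by (auto simp: under_def)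
    then show "P ?z (\<lambda>i. Ident ?A \<sigma>)"
      using F2 \<sigma> sIn c0(1) tid[OF \<nu>.zero_in] by (auto simp: P_def G_def extension_iff into_def)
  next
    fix p E \<tau> assume p: "p \<in> Field \<nu>" and d: "diagram ?A (Restr \<nu> (under \<nu> p)) E \<tau>"
      and Ez: "E ?z = \<sigma>" and Pp: "P p (\<lambda>i. \<tau> i p)"
    let ?s = "osuc \<nu> p"
    have zp: "(?z, p) \<in> Restr \<nu> (under \<nu> p)" using p by (simp add: under_def)
    define n h where "n = E p" and "h = trg (\<tau> ?z p)"
    have "src (\<tau> ?z p) = t ?z p" using Pp p by (simp add: P_def under_def)
    then have \<tau>: "\<tau> ?z p = (\<sigma>, t ?z p, h, n)" using M.arrow_diagramD(2)[OF d zp] Ez by (simp add: n_def h_def)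
    have "(\<sigma>, t ?z p, h, n) \<in> Arr ?A" using A.diagramD(4)[OF d zp] \<tau> by simp
    moreover have tzp: "extension K (D ?z) (t ?z p) (D p)" using tE[of ?z p] p by simp
    ultimately have n: "extension K (D p) n (Cod K n)" and h: "extension K N2 h (Cod K n)"
      and sq: "h \<cdot> \<sigma> = n \<cdot> t ?z p" using \<sigma> by (auto simp: extension_iff)
    let ?N = "Cod K n" and ?e = "t ?z p \<cdot> c0" and ?\<alpha> = "h \<cdot> s"
    have ia: "ind ?N ?\<alpha> (n \<cdot> ?e) n" using Pp p \<tau> by (simp add: P_def G_def)
    have eI: "into K ?e (D p)" by (rule into_ext[OF c0(1) tzp])
    have neI: "into K (n \<cdot> ?e) ?N" by (rule into_ext[OF eI n])
    have me: "m p \<cdot> ?e = cc" using ext_assoc[OF tzp mE[OF p] c0(1)] mt[of ?z p] p c0(2) by simp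
    have neB: "sub_in K (n \<cdot> ?e) B" by (rule ind_sub_in[OF ia])
    have ts: "extension K (D p) (t p ?s) (D ?s)" using tE[of p ?s] p by simp
    have tse: "t p ?s \<cdot> ?e = t ?z ?s \<cdot> c0" using ext_assoc[OF tzp ts c0(1)] tt[of ?z p ?s] p by simp
    have \<alpha>I: "into K ?\<alpha> ?N" by (rule into_ext[OF sIn h])
    have nI: "into K n ?N" by (rule extension_into[OF n])
    have "\<exists>N' v n'. extension K ?N v N' \<and> extension K (D ?s) n' N' \<and> v \<cdot> n = n' \<cdot> t p ?s \<and>
      ind N' (v \<cdot> ?\<alpha>) (n' \<cdot> (t p ?s \<cdot> ?e)) n' \<and>
      (p \<in> I0 \<longrightarrow> gtp_eq K [v \<cdot> ?\<alpha>, n' \<cdot> \<beta> p, n' \<cdot> (t p ?s \<cdot> ?e)] N' [a, b, c] M)"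
    proof (cases "p \<in> I0")
      case False
      \<comment> \<open>No term has to be matched at this stage. The realization is just made
        independent from the next segment, by the independence theorem with \<open>c\<close> in the
        role of the new term and existence supplying its premises.\<close>
      obtain V x y where V: "extension K ?N x V" "extension K (D ?s) y V" "x \<cdot> n = y \<cdot> t p ?s"
        using amalgamate[OF n ts] .
      have ye: "y \<cdot> (t p ?s \<cdot> ?e) = x \<cdot> (n \<cdot> ?e)"
        using ext_assoc[OF ts V(2) eI] ext_assoc[OF n V(1) eI] V(3) by simp
      have ce: "into K (x \<cdot> (n \<cdot> ?e)) V" "sub_in K (x \<cdot> (n \<cdot> ?e)) B"
        using into_ext[OF neI V(1)] sub_in_ext[OF neB neI V(1)] by auto
      have 1: "ind V (x \<cdot> ?\<alpha>) (x \<cdot> (n \<cdot> ?e)) (y \<cdot> (t p ?s \<cdot> ?e))"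
        unfolding ye by (rule ind_base[OF into_ext[OF \<alpha>I V(1)] ce])
      have 2: "ind V (x \<cdot> n) (x \<cdot> (n \<cdot> ?e)) (y \<cdot> (t p ?s \<cdot> ?e))"
        unfolding ye by (rule ind_base[OF into_ext[OF nI V(1)] ce])
      from amalgamate_independent[OF n ts eI ia V into_ext[OF eI ts] 1 2 Lgtp_refl[OF into_ext[OF \<alpha>I V(1)] ce(1)]]
      show ?thesis using False by blast
    next
      case True
      \<comment> \<open>The current stage and the model \<open>N\<close> of the sequence are joined
        over the segment \<open>D p\<close> that they share.\<close>
      obtain W w v where W: "extension K ?N w W" "extension K N v W" "w \<cdot> n = v \<cdot> m p"
        using amalgamate[OF n mE[OF p]] .
      have "gtp_eq K [w0 \<cdot> bs i0, w0 \<cdot> f] N2 [bs i0, f] N"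
        using gtp_ext[OF w0, of "[bs i0, f]"] bsI[OF i0F] fI by simp
      moreover have "gtp_eq K [bs p, f] N [v \<cdot> bs p, v \<cdot> f] W"
        using gtp_sym[OF gtp_ext[OF W(2), of "[bs p, f]"]] bsI[OF p] fI by simp
      ultimately have "gtp_eq K [w0 \<cdot> bs i0, w0 \<cdot> f] N2 [v \<cdot> bs p, v \<cdot> f] W"
        using same[OF True] gtp_sym gtp_trans by blast
      then obtain Q x' y' where Q: "extension K N2 x' Q" "extension K W y' Q"
        "x' \<cdot> (w0 \<cdot> bs i0) = y' \<cdot> (v \<cdot> bs p)" "x' \<cdot> (w0 \<cdot> f) = y' \<cdot> (v \<cdot> f)"
        by (auto simp: gtp_iff)
      have yv: "extension K N (y' \<cdot> v) Q" by (rule extension_Comp[OF W(2) Q(2)])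
      \<comment> \<open>\<open>N2\<close> now enters \<open>V\<close> twice. Along
        \<open>x''\<close> the model \<open>N\<close> keeps its place, while
        \<open>z1 \<cdot> x'\<close> moves \<open>bs i0\<close> to the place of \<open>bs p\<close>;
        on \<open>M\<close> the two agree, see \<open>fz\<close>.\<close>
      obtain V z1 x'' where V: "extension K Q z1 V" "extension K N2 x'' V" "z1 \<cdot> (y' \<cdot> v) = x'' \<cdot> w0"
        using amalgamate[OF yv w0] .
      have zyv: "z1 \<cdot> (y' \<cdot> (v \<cdot> d)) = x'' \<cdot> (w0 \<cdot> d)" if "into K d N" for d
        using ext_assoc[OF yv V(1) that] ext_assoc[OF W(2) Q(2) that] ext_assoc[OF w0 V(2) that] V(3) by simp
      define x where "x = z1 \<cdot> (y' \<cdot> w)"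
      define y where "y = x'' \<cdot> (w0 \<cdot> m ?s)"
      have msE: "extension K (D ?s) (m ?s) N" using mE[of ?s] p by simp
      have x: "extension K ?N x V" unfolding x_def by (rule extension_Comp[OF extension_Comp[OF W(1) Q(2)] V(1)])
      have y: "extension K (D ?s) y V" unfolding y_def by (rule extension_Comp[OF extension_Comp[OF msE w0] V(2)])
      have xd: "x \<cdot> d = z1 \<cdot> (y' \<cdot> (w \<cdot> d))" if "into K d ?N" for d
        using that W(1) Q(2) V(1) by (simp add: x_def extension_iff into_def)
      have yd: "y \<cdot> d = x'' \<cdot> (w0 \<cdot> (m ?s \<cdot> d))" if "into K d (D ?s)" for d
        using that msE w0 V(2) by (simp add: y_def extension_iff into_def)
      have mpI: "into K (m p) N" using extension_into[OF mE[OF p]] .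
      have xn: "x \<cdot> n = x'' \<cdot> (w0 \<cdot> m p)"
        using xd[OF nI] W(3) zyv[OF mpI] by simp
      have xy: "x \<cdot> n = y \<cdot> t p ?s"
        using xn yd[OF extension_into[OF ts]] mt[of p ?s] p by simp
      have w0mp: "extension K (D p) (w0 \<cdot> m p) N2" by (rule extension_Comp[OF mE[OF p] w0])
      have xne: "x \<cdot> (n \<cdot> ?e) = x'' \<cdot> (w0 \<cdot> cc)"
      proof -
        have "x \<cdot> (n \<cdot> ?e) = (x \<cdot> n) \<cdot> ?e" using ext_assoc[OF n x eI] by simp
        also have "\<dots> = x'' \<cdot> ((w0 \<cdot> m p) \<cdot> ?e)" unfolding xn using ext_assoc[OF w0mp V(2) eI] .
        also have "(w0 \<cdot> m p) \<cdot> ?e = w0 \<cdot> cc" using ext_assoc[OF mE[OF p] w0 eI] me by simp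
        finally show ?thesis .
      qed
      have y\<beta>: "y \<cdot> \<beta> p = x'' \<cdot> (w0 \<cdot> bs p)" using yd[OF \<beta>(1)[OF p]] \<beta>(2)[OF p] by simp
      have y\<beta>': "y \<cdot> \<beta> p = z1 \<cdot> (x' \<cdot> (w0 \<cdot> bs i0))" using y\<beta> Q(3) zyv[OF bsI[OF p]] by simp
      have w0f: "into K (w0 \<cdot> f) N2" by (rule into_ext[OF fI w0])
      have fz: "z1 \<cdot> (x' \<cdot> (w0 \<cdot> f)) = x'' \<cdot> (w0 \<cdot> f)" using Q(4) zyv[OF fI] by simp
      have zx': "extension K N2 (z1 \<cdot> x') V" by (rule extension_Comp[OF Q(1) V(1)])
      have w0fE: "extension K M (w0 \<cdot> f) N2" by (rule extension_Comp[OF f w0])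
      have cz: "z1 \<cdot> (x' \<cdot> (w0 \<cdot> cc)) = x'' \<cdot> (w0 \<cdot> cc)"
      proof -
        have fc: "(w0 \<cdot> f) \<cdot> c = w0 \<cdot> cc" using ext_assoc[OF f w0 i(2)] by (simp add: cc_def)
        have "(z1 \<cdot> x') \<cdot> (w0 \<cdot> f) = x'' \<cdot> (w0 \<cdot> f)" using fz ext_assoc[OF Q(1) V(1) w0f] by simp
        then have "((z1 \<cdot> x') \<cdot> (w0 \<cdot> f)) \<cdot> c = (x'' \<cdot> (w0 \<cdot> f)) \<cdot> c" by simp
        then have "(z1 \<cdot> x') \<cdot> (w0 \<cdot> cc) = x'' \<cdot> (w0 \<cdot> cc)"
          using ext_assoc[OF w0fE zx' i(2)] ext_assoc[OF w0fE V(2) i(2)] fc by simp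
        then show ?thesis using ext_assoc[OF Q(1) V(1) into_ext[OF ccI w0]] by simp
      qed
      \<comment> \<open>The embedding that moves \<open>bs i0\<close> to \<open>bs p\<close> moves
        \<open>as\<close> to a realization matching \<open>bs p\<close>.\<close>
      define a' where "a' = z1 \<cdot> (x' \<cdot> as)"
      have tpV: "gtp_eq K [a', y \<cdot> \<beta> p, x \<cdot> (n \<cdot> ?e)] V [a, b, c] M"
      proof -
        have "gtp_eq K [(z1 \<cdot> x') \<cdot> as, (z1 \<cdot> x') \<cdot> (w0 \<cdot> bs i0), (z1 \<cdot> x') \<cdot> (w0 \<cdot> cc)] V [a, b, c] M"
          using gtp_ext3[OF zx' asI into_ext[OF bsI[OF i0F] w0] into_ext[OF ccI w0]] F4 by simp
        then show ?thesis
          using ext_assoc[OF Q(1) V(1) asI] ext_assoc[OF Q(1) V(1) into_ext[OF bsI[OF i0F] w0]]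
            ext_assoc[OF Q(1) V(1) into_ext[OF ccI w0]] y\<beta>' cz xne by (simp add: a'_def)
      qed
      have 1: "ind V a' (x \<cdot> (n \<cdot> ?e)) (y \<cdot> \<beta> p)" by (rule ind_invariant[OF iab gtp_sym[OF tpV]])
      have "ind N (m p) cc (bs p)" using ind_sym[OF ind[OF p]] by (simp add: cc_def)
      from ind_ext[OF ind_ext[OF this w0] V(2)]
      have 2: "ind V (x \<cdot> n) (x \<cdot> (n \<cdot> ?e)) (y \<cdot> \<beta> p)" by (simp add: xn xne y\<beta>)
      have "Lgtp_eq K [x \<cdot> (n \<cdot> ?e)] V [x \<cdot> ?\<alpha>] [x'' \<cdot> s]"
      proof (rule Lgtp_model)
        show E: "extension K (D ?z) (x'' \<cdot> \<sigma>) V" by (rule extension_Comp[OF \<sigma> V(2)])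
        have "x \<cdot> (n \<cdot> ?e) = (x'' \<cdot> \<sigma>) \<cdot> c0" using xne \<sigma>c ext_assoc[OF \<sigma> V(2) c0(1)] by simp
        then show "sub_le K (x \<cdot> (n \<cdot> ?e)) (x'' \<cdot> \<sigma>)"
          using sub_le_Comp[of c0 "x'' \<cdot> \<sigma>"] c0(1) E by (simp add: extension_iff into_def)
        have \<sigma>I: "into K \<sigma> N2" by (rule extension_into[OF \<sigma>])
        have xh: "extension K N2 (x \<cdot> h) V" by (rule extension_Comp[OF h x])
        \<comment> \<open>\<open>x \<cdot> h\<close> and \<open>x''\<close> send the first segment
          to the same place, both through \<open>m p\<close>; hence the images of \<open>s\<close>
          under them have the same type over it.\<close>
        have "(x \<cdot> h) \<cdot> \<sigma> = x \<cdot> (n \<cdot> t ?z p)" using ext_assoc[OF h x \<sigma>I] sq by simp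
        also have "\<dots> = (x'' \<cdot> (w0 \<cdot> m p)) \<cdot> t ?z p" using ext_assoc[OF n x extension_into[OF tzp]] xn by simp
        also have "\<dots> = x'' \<cdot> \<sigma>"
          using ext_assoc[OF w0mp V(2) extension_into[OF tzp]] ext_assoc[OF mE[OF p] w0 extension_into[OF tzp]]
            mt[of ?z p] p by (simp add: \<sigma>_def)
        finally have xh\<sigma>: "(x \<cdot> h) \<cdot> \<sigma> = x'' \<cdot> \<sigma>" .
        have "gtp_eq K [(x \<cdot> h) \<cdot> s, (x \<cdot> h) \<cdot> \<sigma>] V [s, \<sigma>] N2"
          using gtp_ext[OF xh, of "[s, \<sigma>]"] sIn \<sigma>I by simp
        moreover have "gtp_eq K [s, \<sigma>] N2 [x'' \<cdot> s, x'' \<cdot> \<sigma>] V"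
          using gtp_sym[OF gtp_ext[OF V(2), of "[s, \<sigma>]"]] sIn \<sigma>I by simp
        ultimately have "gtp_eq K [(x \<cdot> h) \<cdot> s, (x \<cdot> h) \<cdot> \<sigma>] V [x'' \<cdot> s, x'' \<cdot> \<sigma>] V" by (rule gtp_trans)
        then show "gtp_eq K [x \<cdot> ?\<alpha>, x'' \<cdot> \<sigma>] V [x'' \<cdot> s, x'' \<cdot> \<sigma>] V"
          using xh\<sigma> ext_assoc[OF h x sIn] by simp
      qed
      moreover have "Lgtp_eq K [x \<cdot> (n \<cdot> ?e)] V [x'' \<cdot> s] [x'' \<cdot> as]"
        using Lgtp_ext[OF F3 V(2)] xne by simp
      moreover have "Lgtp_eq K [x \<cdot> (n \<cdot> ?e)] V [x'' \<cdot> as] [a']"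
      proof (rule Lgtp_model)
        show E: "extension K M (x'' \<cdot> (w0 \<cdot> f)) V" by (rule extension_Comp[OF w0fE V(2)])
        have "x \<cdot> (n \<cdot> ?e) = (x'' \<cdot> (w0 \<cdot> f)) \<cdot> c"
          using xne ext_assoc[OF w0fE V(2) i(2)] ext_assoc[OF f w0 i(2)] by (simp add: cc_def)
        then show "sub_le K (x \<cdot> (n \<cdot> ?e)) (x'' \<cdot> (w0 \<cdot> f))"
          using sub_le_Comp[of c "x'' \<cdot> (w0 \<cdot> f)"] i(2) E by (simp add: extension_iff into_def)
        have "gtp_eq K [x'' \<cdot> as, x'' \<cdot> (w0 \<cdot> f)] V [as, w0 \<cdot> f] N2"
          using gtp_ext[OF V(2), of "[as, w0 \<cdot> f]"] asI w0f by simp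
        moreover have "gtp_eq K [as, w0 \<cdot> f] N2 [(z1 \<cdot> x') \<cdot> as, (z1 \<cdot> x') \<cdot> (w0 \<cdot> f)] V"
          using gtp_sym[OF gtp_ext[OF zx', of "[as, w0 \<cdot> f]"]] asI w0f by simp
        ultimately have "gtp_eq K [x'' \<cdot> as, x'' \<cdot> (w0 \<cdot> f)] V [(z1 \<cdot> x') \<cdot> as, (z1 \<cdot> x') \<cdot> (w0 \<cdot> f)] V"
          by (rule gtp_trans)
        then show "gtp_eq K [x'' \<cdot> as, x'' \<cdot> (w0 \<cdot> f)] V [a', x'' \<cdot> (w0 \<cdot> f)] V"
          using ext_assoc[OF Q(1) V(1) asI] ext_assoc[OF Q(1) V(1) w0f] fz by (simp add: a'_def)
      qed
      ultimately have "Lgtp_eq K [x \<cdot> (n \<cdot> ?e)] V [x \<cdot> ?\<alpha>] [a']" using Lgtp_trans by blast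
      from amalgamate_independent[OF n ts eI ia x y xy \<beta>(1)[OF p] 1 2 this]
      show ?thesis using tpV gtp_trans by blast
    qed
    then obtain N' v n' where v: "extension K ?N v N'" and n': "extension K (D ?s) n' N'"
      and vn: "v \<cdot> n = n' \<cdot> t p ?s" and ia'': "ind N' (v \<cdot> ?\<alpha>) (n' \<cdot> (t p ?s \<cdot> ?e)) n'"
      and tpn: "p \<in> I0 \<longrightarrow> gtp_eq K [v \<cdot> ?\<alpha>, n' \<cdot> \<beta> p, n' \<cdot> (t p ?s \<cdot> ?e)] N' [a, b, c] M" by blast
    define y where "y = (n, t p ?s, v, n')"
    have yA: "y \<in> Arr ?A" unfolding y_def arrow_cat_Arr
      using vn v n' ts n by (auto simp: extension_iff)
    have C: "Cod K n' = N'" using n' by (simp add: extension_iff)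
    have zs: "?z \<noteq> ?s" using \<nu>.zero_le[OF p] \<nu>.le_suc[OF p] \<nu>.suc_ne[OF p] \<nu>.le_antisym by metis
    have "G (y \<cdot>\<^bsub>?A\<^esub> \<tau> ?z p)"
      using ia'' tse tt[of ?z p ?s] p C ext_assoc[OF h v sIn] unfolding G_def \<tau> y_def by simp
    \<comment> \<open>The invariant that domains follow the prescribed chain: an index below
      \<open>?s\<close> other than \<open>?s\<close> lies below \<open>p\<close>, and composition in
      the arrow category composes the domain parts.\<close>
    moreover have "src (if i = ?s then Ident ?A (Cod ?A y) else y \<cdot>\<^bsub>?A\<^esub> \<tau> i p) = t i ?s" if iu: "i \<in> under \<nu> ?s" for i
    proof (cases "i = ?s")
      case True
      then show ?thesis using tid[of ?s] p n' by (simp add: y_def extension_iff)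
    next
      case False
      then have ip: "(i, p) \<in> \<nu>" using \<nu>.le_of_le_suc[OF p] iu by (simp add: under_def)
      then have "src (\<tau> i p) = t i p" using Pp p by (simp add: P_def under_def)
      moreover have "(i, p) \<in> Restr \<nu> (under \<nu> p)" using ip p by (simp add: under_def)
      note M.arrow_diagramD(2)[OF d this]
      ultimately have "\<tau> i p = (E i, t i p, trg (\<tau> i p), n)" by (simp add: n_def)
      then have "src (y \<cdot>\<^bsub>?A\<^esub> \<tau> i p) = t p ?s \<cdot> t i p" unfolding y_def by (metis arrow_cat_simps(5,6) models_simps(5))
      then show ?thesis using False tt[OF ip, of ?s] p by simp
    qed
    ultimately have "P ?s (\<lambda>i. if i = ?s then Ident ?A (Cod ?A y) else y \<cdot>\<^bsub>?A\<^esub> \<tau> i p)"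
      using zs by (simp add: P_def)
    moreover have "S p (\<tau> ?z p) y" using tpn \<tau> tse C by (simp add: S_def y_def)
    moreover have "Dom ?A y = E p" by (simp add: y_def n_def)
    ultimately show "\<exists>f. f \<in> Arr ?A \<and> Dom ?A f = E p \<and> S p (\<tau> ?z p) f \<and>
        P ?s (\<lambda>i. if i = ?s then Ident ?A (Cod ?A f) else f \<cdot>\<^bsub>?A\<^esub> \<tau> i p)" using yA by blast
  next
    fix l E \<tau> assume l: "olimit \<nu> l" and d: "diagram ?A (Restr \<nu> (underS \<nu> l)) E \<tau>"
      and Ez: "E ?z = \<sigma>" and Pj: "\<forall>j\<in>underS \<nu> l. P j (\<lambda>i. \<tau> i j)"
    let ?r = "Restr \<nu> (underS \<nu> l)"
    have Fr: "Field ?r = underS \<nu> l" by (rule \<nu>.Field_Restr_underS)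
    have zl: "?z \<in> underS \<nu> l" using underS_nonempty_limit[OF _ l] \<nu>.WELL by blast
    have dir: "directed (Univ K) natLeq ?r" by (rule directed_underS[OF \<nu> l])
    have uF: "i \<in> Field \<nu>" if "i \<in> underS \<nu> l" for i
      using that unfolding Order_Relation.underS_def by (auto intro: FieldI1)
    have zi: "(?z, i) \<in> ?r" if "i \<in> Field ?r" for i
      using that zl \<nu>.zero_le[OF uF] unfolding Fr by simp
    have st: "src (\<tau> i j) = t i j" if "(i, j) \<in> ?r" for i j
      using Pj that uF by (auto simp: P_def under_def)
    have DE: "Dom K (E i) = D i" if "i \<in> Field ?r" for i
    proof -
      have "Cod K (src (\<tau> ?z i)) = Dom K (E i)"
        using M.diagramD(6)[OF M.arrow_diagramD(4)[OF d] zi[OF that]] by simp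
      then show ?thesis using st[OF zi[OF that]] tE[of ?z i] uF that Fr by (simp add: extension_iff)
    qed
    \<comment> \<open>At a limit the prescribed segment is already the colimit of the earlier ones,
      so the arrow category supplies a stage with exactly this domain.\<close>
    have X: "colimit (models K) ?r (\<lambda>i. Dom K (E i)) (\<lambda>i j. src (\<tau> i j)) (D l) (\<lambda>i. t i l)"
      by (rule colimit_cong[OF lims[OF l]]) (simp_all add: DE st)
    have ii: "ind (Cod K (E i)) (trg (\<tau> ?z i) \<cdot> s) (E i \<cdot> (src (\<tau> ?z i) \<cdot> c0)) (E i)" if "i \<in> Field ?r" for i
    proof -
      have "G (\<tau> ?z i)" using Pj uF that Fr by (auto simp: P_def)
      moreover have "Cod ?A (\<tau> ?z i) = E i" using A.diagramD(6)[OF d zi[OF that]] .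
      ultimately show ?thesis by (simp add: G_def)
    qed
    have "\<exists>n l'. cocone ?A ?r E \<tau> n (\<lambda>i. (E i, t i l, l' i, n)) \<and> Dom K n = D l \<and>
      ind (Cod K n) (l' ?z \<cdot> s) (n \<cdot> (t ?z l \<cdot> c0)) n"
      by (rule limit_independent[OF dir d _ zi X _ _ ii]) (use zl Fr Ez sIn c0 \<sigma> in \<open>auto simp: extension_iff\<close>)
    then obtain n l' where n: "cocone ?A ?r E \<tau> n (\<lambda>i. (E i, t i l, l' i, n))" "Dom K n = D l"
      "ind (Cod K n) (l' ?z \<cdot> s) (n \<cdot> (t ?z l \<cdot> c0)) n" by blast
    have "?z \<noteq> l" using zl by (auto simp: Order_Relation.underS_def)
    then have "P l (\<lambda>i. if i = l then Ident ?A n else (E i, t i l, l' i, n))"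
      using n(2,3) tid[of l] by (simp add: P_def G_def)
    then show "\<exists>X k. cocone ?A ?r E \<tau> X k \<and> True \<and> P l (\<lambda>i. if i = l then Ident ?A X else k i)"
      using n(1) by blast
  qed simp
  then obtain n \<tau> where d: "diagram ?A \<nu> n \<tau>" and nz: "n ?z = \<sigma>"
    and P: "\<And>j. j \<in> Field \<nu> \<Longrightarrow> P j (\<lambda>i. \<tau> i j)"
    and S: "\<And>p. p \<in> Field \<nu> \<Longrightarrow> S p (\<tau> ?z p) (\<tau> p (osuc \<nu> p))" by blast
  note nd = M.arrow_diagramD[OF d]
  have st: "src (\<tau> i j) = t i j" if "(i, j) \<in> \<nu>" for i j
    using P[OF \<nu>.le_Field(2)[OF that]] \<nu>.le_Field(2)[OF that] that by (simp add: P_def under_def)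
  have DE: "Dom K (n i) = D i" if "i \<in> Field \<nu>" for i
  proof -
    have "Cod K (src (\<tau> ?z i)) = Dom K (n i)"
      using M.diagramD(6)[OF nd(4), of ?z i] that by simp
    then show ?thesis using st[of ?z i] tE[of ?z i] that by (simp add: extension_iff)
  qed
  obtain X k where X: "colimit (models K) \<nu> D t X k"
    using models_colimit_exists[OF directed_regular[OF \<nu>] dia] .
  have diaN: "diagram (models K) \<nu> (\<lambda>i. Cod K (n i)) (\<lambda>i j. trg (\<tau> i j))" using nd(5) by simp
  obtain Y l where Y: "colimit (models K) \<nu> (\<lambda>i. Cod K (n i)) (\<lambda>i j. trg (\<tau> i j)) Y l"
    using models_colimit_exists[OF directed_regular[OF \<nu>] diaN] .
  have cX: "cocone (models K) \<nu> D t X k" and cY: "cocone (models K) \<nu> (\<lambda>i. Cod K (n i)) (\<lambda>i j. trg (\<tau> i j)) Y l"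
    using X Y by (simp_all add: colimit_def)
  have X': "colimit (models K) \<nu> (\<lambda>i. Dom K (n i)) (\<lambda>i j. src (\<tau> i j)) X k"
    by (rule colimit_cong[OF X]) (simp_all add: DE st)
  obtain n1 where n1: "n1 \<in> Arr (models K)" "Dom K n1 = X" "Cod K n1 = Y" "\<And>i. i \<in> Field \<nu> \<Longrightarrow> n1 \<cdot> k i = l i \<cdot> n i"
    using M.arrow_cocone_exists[OF d, of X k Y l] X' cY by auto
  have n1E: "extension K X n1 Y" using n1 by (auto simp: extension_iff)
  obtain q where q0: "q \<in> Arr (models K)" "Dom (models K) q = X" "Cod (models K) q = N"
      "\<And>i. i \<in> Field \<nu> \<Longrightarrow> q \<cdot>\<^bsub>models K\<^esub> k i = m i"
    by (rule M.colimit_induced[OF X coc]) blast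
  then have q: "extension K X q N" and qk: "\<And>i. i \<in> Field \<nu> \<Longrightarrow> q \<cdot> k i = m i" by (auto simp: extension_iff)
  \<comment> \<open>The realization lives in \<open>Y\<close>, which is not an extension of
    \<open>N\<close>. Both receive the union \<open>X\<close> of the segments, through which all
    terms factor; amalgamating over \<open>X\<close> brings the realization above
    \<open>N\<close>.\<close>
  obtain N' g g' where g: "extension K N g N'" "extension K Y g' N'" "g \<cdot> q = g' \<cdot> n1"
    using amalgamate[OF q n1E] .
  have kE: "extension K (D i) (k i) X" if "i \<in> Field \<nu>" for i using models_cocone_ext[OF cX that] .
  have lE: "extension K (Cod K (n i)) (l i) Y" if "i \<in> Field \<nu>" for i using models_cocone_ext[OF cY that] .
  have nE: "extension K (D i) (n i) (Cod K (n i))" if "i \<in> Field \<nu>" for i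
    using nd(1)[OF that] DE[OF that] by (simp add: extension_iff)
  have gm: "g \<cdot> (m i \<cdot> x) = g' \<cdot> (l i \<cdot> (n i \<cdot> x))" if iF: "i \<in> Field \<nu>" and x: "into K x (D i)" for i x
  proof -
    have "g \<cdot> (m i \<cdot> x) = g \<cdot> (q \<cdot> (k i \<cdot> x))" using ext_assoc[OF kE[OF iF] q x] qk[OF iF] by simp
    also have "\<dots> = (g \<cdot> q) \<cdot> (k i \<cdot> x)" using ext_assoc[OF q g(1) into_ext[OF x kE[OF iF]]] by simp
    also have "\<dots> = g' \<cdot> (n1 \<cdot> (k i \<cdot> x))" using ext_assoc[OF n1E g(2) into_ext[OF x kE[OF iF]]] g(3) by simp
    also have "n1 \<cdot> (k i \<cdot> x) = l i \<cdot> (n i \<cdot> x)"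
      using ext_assoc[OF kE[OF iF] n1E x] ext_assoc[OF nE[OF iF] lE[OF iF] x] n1(4)[OF iF] by simp
    finally show ?thesis .
  qed
  define a' where "a' = g' \<cdot> (l ?z \<cdot> s)"
  have lz: "extension K N2 (l ?z) Y" using lE[of ?z] nz \<sigma> by (simp add: extension_iff)
  have a'I: "into K a' N'" unfolding a'_def by (rule into_ext[OF into_ext[OF sIn lz] g(2)])
  have "gtp_eq K [a', g \<cdot> bs p, g \<cdot> (f \<cdot> c)] N' [a, b, c] M" if p: "p \<in> I0" for p
  proof -
    have pF: "p \<in> Field \<nu>" using p I0 by blast
    let ?s = "osuc \<nu> p"
    have sF: "?s \<in> Field \<nu>" using pF by simp
    have h1: "extension K N2 (trg (\<tau> ?z p)) (Cod K (n p))" and h2: "extension K (Cod K (n p)) (trg (\<tau> p ?s)) (Cod K (n ?s))"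
      using models_diagram_ext[OF diaN, of ?z p] models_diagram_ext[OF diaN, of p ?s] pF nz \<sigma>
      by (auto simp: extension_iff)
    have Cy: "Cod ?A (\<tau> p ?s) = n ?s" using A.diagramD(6)[OF d, of p ?s] pF by simp
    \<comment> \<open>The type required at \<open>p\<close> is achieved at stage \<open>?s\<close>;
      later transitions preserve the realization, so it remains true in \<open>N'\<close>.\<close>
    have gt: "gtp_eq K [trg (\<tau> p ?s) \<cdot> (trg (\<tau> ?z p) \<cdot> s), n ?s \<cdot> \<beta> p, n ?s \<cdot> (t ?z ?s \<cdot> c0)] (Cod K (n ?s)) [a, b, c] M"
      using S[OF pF] p Cy by (simp add: S_def)
    note gi = gtp_into(1)[OF gt]
    have lg: "extension K (Cod K (n ?s)) (g' \<cdot> l ?s) N'" by (rule extension_Comp[OF lE[OF sF] g(2)])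
    have tz: "extension K (D ?z) (t ?z ?s) (D ?s)" using tE[of ?z ?s] sF by simp
    have c1: "into K (t ?z ?s \<cdot> c0) (D ?s)" by (rule into_ext[OF c0(1) tz])
    have "trg (\<tau> p ?s) \<cdot> trg (\<tau> ?z p) = trg (\<tau> ?z ?s)" "l ?s \<cdot> trg (\<tau> ?z ?s) = l ?z"
      using M.diagramD(7)[OF diaN, of ?z p ?s] M.coconeD(5)[OF cY, of ?z ?s] pF by simp_all
    moreover have h3: "extension K N2 (trg (\<tau> ?z ?s)) (Cod K (n ?s))"
      using models_diagram_ext[OF diaN, of ?z ?s] sF nz \<sigma> by (simp add: extension_iff)
    ultimately have "l ?s \<cdot> (trg (\<tau> p ?s) \<cdot> (trg (\<tau> ?z p) \<cdot> s)) = l ?z \<cdot> s"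
      using ext_assoc[OF h1 h2 sIn] ext_assoc[OF h3 lE[OF sF] sIn] by simp
    then have e1: "(g' \<cdot> l ?s) \<cdot> (trg (\<tau> p ?s) \<cdot> (trg (\<tau> ?z p) \<cdot> s)) = a'"
      using ext_assoc[OF lE[OF sF] g(2)] gi by (simp add: a'_def)
    have e2: "(g' \<cdot> l ?s) \<cdot> (n ?s \<cdot> \<beta> p) = g \<cdot> bs p"
      using ext_assoc[OF lE[OF sF] g(2)] gi gm[OF sF \<beta>(1)[OF pF]] \<beta>(2)[OF pF] by simp
    have "m ?s \<cdot> (t ?z ?s \<cdot> c0) = cc"
      using ext_assoc[OF tz mE[OF sF] c0(1)] mt[of ?z ?s] sF c0(2) by simp
    then have e3: "(g' \<cdot> l ?s) \<cdot> (n ?s \<cdot> (t ?z ?s \<cdot> c0)) = g \<cdot> (f \<cdot> c)"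
      using ext_assoc[OF lE[OF sF] g(2)] gi gm[OF sF c1] by (simp add: cc_def)
    show ?thesis
      using gtp_ext3[OF lg, of "trg (\<tau> p ?s) \<cdot> (trg (\<tau> ?z p) \<cdot> s)" "n ?s \<cdot> \<beta> p" "n ?s \<cdot> (t ?z ?s \<cdot> c0)"] gi gt e1 e2 e3
      by simp
  qed
  then show ?thesis unfolding consistent_for_def using g(1) a'I by blast
qed

end

lemma card_of_subset_ordIso:
  assumes "Card_order \<kappa>" "\<kappa> \<le>o |A|"
  shows "\<exists>I\<subseteq>A. |I| =o \<kappa>"
proof -
  have "|Field \<kappa>| =o \<kappa>" using assms(1) by (rule card_of_Field_ordIso)
  then have "|Field \<kappa>| \<le>o |A|" using assms(2) ordIso_ordLeq_trans by blast
  then obtain e where e: "inj_on e (Field \<kappa>)" "e ` Field \<kappa> \<subseteq> A" unfolding card_of_ordLeq[symmetric] by blast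
  have "|Field \<kappa>| =o |e ` Field \<kappa>|" using e(1) card_of_ordIso inj_on_imp_bij_betw by blast
  then have "|e ` Field \<kappa>| =o \<kappa>" using \<open>|Field \<kappa>| =o \<kappa>\<close> ordIso_symmetric ordIso_transitive by blast
  then show ?thesis using e(2) by blast
qed

text \<open>Otherwise \<open>Field \<nu>\<close> would be a union of fewer than \<open>\<nu>\<close>
  sets, each of size below \<open>\<nu>\<close>.\<close>

lemma regular_pigeonhole:
  assumes "Cinfinite \<nu>" "regularCard \<nu>" "|T| <o \<nu>" "p ` Field \<nu> \<subseteq> T"
  shows "\<exists>q\<in>T. \<nu> \<le>o |{i \<in> Field \<nu>. p i = q}|"
proof (rule ccontr)
  assume n: "\<not> ?thesis"
  have wo: "Well_order \<nu>" using assms(1) by (simp add: card_order_on_def)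
  have "|{i \<in> Field \<nu>. p i = q}| <o \<nu>" if "q \<in> T" for q
    using n that ordLess_or_ordLeq[OF card_of_Well_order wo] by blast
  then have "|\<Union>q\<in>T. {i \<in> Field \<nu>. p i = q}| <o \<nu>"
    by (intro card_of_UNION_ordLess_infinite_Field_regularCard[OF assms(2,1,3)]) blast
  moreover have "(\<Union>q\<in>T. {i \<in> Field \<nu>. p i = q}) = Field \<nu>" using assms(4) by auto
  moreover have "|Field \<nu>| =o \<nu>" using assms(1) card_of_Field_ordIso by blast
  ultimately show False using not_ordLess_ordIso by auto
qed

text \<open>Terms are sorted by their type over \<open>M\<close> and not merely over
  \<open>c\<close>: moving one term to another while fixing the model \<open>M\<close> keeps Lascar
  types over \<open>c\<close>.\<close>

lemma (in nsop1) ind_imp_lK: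
  assumes iab: "ind M a c b"
  shows "lK_indep K M a c b"
proof -
  have i: "into K a M" "into K c M" "into K b M" using ind_into[OF iab] by auto
  have cB: "sub_in K c B" by (rule ind_sub_in[OF iab])
  have M: "M \<in> Mod K" and Db: "Dom K b \<in> Obj K" using i by (auto simp: into_def)
  have "\<not> long_Kim_divides K a b c M"
  proof
    assume "long_Kim_divides K a b c M"
    then obtain \<mu> where \<mu>: "regular_cardinal (Univ K) \<mu>" and
      H: "\<forall>\<nu>. regular_cardinal (Univ K) \<nu> \<longrightarrow> \<mu> \<le>o \<nu> \<longrightarrow>
           (\<exists>N f bs. extension K M f N \<and> independent_sequence K (isi_f_indep K) \<nu> (f \<cdot> c) N bs \<and>
              (\<forall>i \<in> Field \<nu>. gtp_eq K [bs i, f \<cdot> c] N [b, c] M) \<and>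
              (\<exists>\<kappa>. regular_cardinal (Univ K) \<kappa> \<and> \<kappa> <o \<nu> \<and>
                 (\<forall>I \<subseteq> Field \<nu>. |I| =o \<kappa> \<longrightarrow> \<not> consistent_for K a b c M f N bs I)))"
      unfolding long_Kim_divides_def divides_along_def by (elim exE conjE) (rule that)
    obtain T where T: "small (Univ K) T"
      and cov: "\<And>N x f. into K x N \<Longrightarrow> Dom K x = Dom K b \<Longrightarrow> extension K M f N \<Longrightarrow>
        \<exists>(N', x', f')\<in>T. gtp_eq K [x, f] N [x', f'] N'"
      using small_types[OF Db M] by blast
    \<comment> \<open>Beyond the number of types over \<open>M\<close>, so that \<open>\<nu>\<close>
      many terms share one type; this is enough for whichever \<open>\<kappa>\<close> below
      \<open>\<nu>\<close> dividing supplies.\<close>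
    obtain \<nu> where \<nu>: "regular_cardinal (Univ K) \<nu>" "|T| <o \<nu>" "\<mu> <o \<nu>"
      using regular_above[OF T \<mu> \<mu>] by blast
    obtain N f bs \<kappa> where f: "extension K M f N" and s: "independent_sequence K (isi_f_indep K) \<nu> (f \<cdot> c) N bs"
      and g: "\<forall>i \<in> Field \<nu>. gtp_eq K [bs i, f \<cdot> c] N [b, c] M"
      and \<kappa>: "regular_cardinal (Univ K) \<kappa>" "\<kappa> <o \<nu>"
      and n: "\<forall>I \<subseteq> Field \<nu>. |I| =o \<kappa> \<longrightarrow> \<not> consistent_for K a b c M f N bs I"
      using H[rule_format, OF \<nu>(1) ordLess_imp_ordLeq[OF \<nu>(3)]] by (elim exE conjE) (rule that)
    obtain D t m where ini: "initial_segments K \<nu> N bs D t m" and cm: "sub_le K (f \<cdot> c) (m (ozero \<nu>))"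
      and isf: "\<forall>i \<in> Field \<nu>. isi_f_indep K N (bs i) (f \<cdot> c) (m i)"
      using s unfolding independent_sequence_def by blast
    have ind: "ind N (bs i) (f \<cdot> c) (m i)" if "i \<in> Field \<nu>" for i
      using isi_f_imp_ind isf that sub_in_ext[OF cB i(2) f] by blast
    have "\<exists>q\<in>T. case q of (N', x', f') \<Rightarrow> gtp_eq K [bs i, f] N [x', f'] N'" if "i \<in> Field \<nu>" for i
      using cov[OF ind_into(1)[OF ind[OF that]] _ f] gtp_Dom[OF g[rule_format, OF that]] by auto
    then obtain p where p: "\<And>i. i \<in> Field \<nu> \<Longrightarrow> p i \<in> T"
      "\<And>i. i \<in> Field \<nu> \<Longrightarrow> case p i of (N', x', f') \<Rightarrow> gtp_eq K [bs i, f] N [x', f'] N'" by metis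
    have "p ` Field \<nu> \<subseteq> T" using p(1) by blast
    then obtain q where q: "\<nu> \<le>o |{i \<in> Field \<nu>. p i = q}|"
      using regular_pigeonhole[OF regular_cardinalD(1,2)[OF \<nu>(1)] \<nu>(2)] by blast
    define I0 where "I0 = {i \<in> Field \<nu>. p i = q}"
    have "\<kappa> \<le>o |I0|" using ordLeq_transitive[OF ordLess_imp_ordLeq[OF \<kappa>(2)]] q unfolding I0_def by blast
    then obtain I where I: "I \<subseteq> I0" "|I| =o \<kappa>" using card_of_subset_ordIso regular_cardinalD(4)[OF \<kappa>(1)] by blast
    have "I \<noteq> {}"
    proof
      assume "I = {}"
      then have "\<kappa> =o |{} :: 'u set|" using I(2) ordIso_symmetric by blast
      then have "\<kappa> \<le>o |{} :: 'u set|" using ordIso_iff_ordLeq by blast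
      then have "|Field \<kappa>| \<le>o |{} :: 'u set|"
        using regular_cardinalD(4)[OF \<kappa>(1)] card_of_Field_ordIso ordIso_ordLeq_trans by blast
      then show False
        using regular_cardinalD(1)[OF \<kappa>(1)] unfolding card_of_ordLeq[symmetric] by (auto simp: cinfinite_def)
    qed
    then obtain i0 where i0: "i0 \<in> I0" using I(1) by blast
    have same: "gtp_eq K [bs i, f] N [bs i0, f] N" if "i \<in> I0" for i
    proof -
      obtain N' x' f' where q': "q = (N', x', f')" by (cases q) auto
      have "gtp_eq K [bs i, f] N [x', f'] N'" "gtp_eq K [bs i0, f] N [x', f'] N'"
        using p(2)[of i] p(2)[of i0] that i0 q' by (auto simp: I0_def)
      then show ?thesis using gtp_sym gtp_trans by blast
    qed
    have I0F: "I0 \<subseteq> Field \<nu>" by (auto simp: I0_def)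
    have "gtp_eq K [bs i0, f \<cdot> c] N [b, c] M" using g i0 I0F by blast
    from realize_independent_sequence[OF iab f \<nu>(1) ini cm ind I0F i0 same this]
    have "consistent_for K a b c M f N bs I" using I(1) unfolding consistent_for_def by blast
    then show False using n I I0F by blast
  qed
  then show ?thesis using i by (simp add: lK_indep_def)
qed

theorem theorem1p1:
  fixes K :: "('o, 'a, 'u) aecat"
    and B :: "'o set"
    and ind :: "('o, 'a) indep"
  assumes "inaccessible (Univ K)"
    and "AECat K"
    and "amalgamation_property K"
    and "base_class K B"
    and "existence_axiom K B"
    and "NSOP1_like K B ind"
  shows "\<forall>M a b c. into K a M \<longrightarrow> into K b M \<longrightarrow> into K c M \<longrightarrow> sub_in K c B \<longrightarrow>
           (ind M a c b \<longleftrightarrow> lK_indep K M a c b)"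
proof -
  interpret nsop1 K B ind
    using assms by (simp add: nsop1_def amalgamation_def amalgamation_axioms_def nsop1_axioms_def)
  show ?thesis using ind_imp_lK lK_imp_ind[OF assms(5)] by blast
qed

end
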